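(* Assume that $(e^{-tL})_{t>0}$ satisfies $\mathrm{GGE}_m(1,2)$ and that $\inf\sigma(L)>0$. Then there is a constant $C$ such that for every $f\in\mathcal{L}^2$, \[ \|Sf\|_1\le C\big(\|S_{loc}f\|_1+\|f\|_1\big). \] Consequently (since also $\|f\|_1\lesssim\|Sf\|_1$ and $S_{loc}f\le Sf$), the local Hardy space $\mathfrak{h}^1_L$ and the Hardy space $H^1_L$ coincide with equivalent norms.
   Context: $(M,d,\mu)$ is a doubling metric measure space: all balls have finite positive measure and there exist $n>0$, $C_D$ with $\mu(\alpha B)\le C_D\alpha^n\mu(B)$ for all balls $B$ and $\alpha\ge1$. $L$ is a non-negative self-adjoint operator on $\mathcal{L}^2(M,\mu)$, $m\ge2$, $\sigma(L)$ its spectrum. Definition ($\mathrm{GGE}_m(p,2)$): for $p\in[1,2]$, a family $(T_t)_{t>0}$ of linear operators on $\mathcal{L}^2$ satisfies it if there exist $C,c>0$ such that for all $x,y\in M$, $t>0$: $\| 1_{B(x,t)} T_{t^m} 1_{B(y,t)}\|_{p\to2}\le C\mu(B(x,t))^{-(\frac1p-\frac12)}\exp(-c(d(x,y)/t)^{\frac{m}{m-1}})$, with $\|\cdot\|_{p\to2}$ the $\mathcal{L}^p\to\mathcal{L}^2$ operator norm. Square functions: for $f\in\mathcal{L}^2$, $x\in M$, $Sf(x)=\big(\int_0^\infty\frac{1}{\mu(B(x,t))}\int_{B(x,t)}|t^mLe^{-t^mL}f(y)|^2\,d\mu(y)\,\frac{dt}{t}\big)^{1/2}$, and $S_{loc}f$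 is defined in the same way with $\int_0^\infty$ replaced by $\int_0^1$. $H^1_L$ is the completion (of the subspace of $\mathcal{L}^2$ where the norm is finite) with respect to $\|f\|_{H^1_L}=\|Sf\|_1$, and $\mathfrak{h}^1_L$ is the analogous space with norm $\|f\|_{\mathfrak{h}^1_L}=\|S_{loc}f\|_1+\|f\|_1$. *)

theory Defs
  imports "HOL-Analysis.Analysis"
begin

text \<open>Setting: a metric measure space given by a type 'a of class metric_space
  and a Borel measure mu on it (space = UNIV). Elements of L^2 are represented by
  measurable complex-valued functions (all statements below are insensitive to
  changing functions on null sets).\<close>

definition enn_root :: "real \<Rightarrow> ennreal \<Rightarrow> ennreal" where
  "enn_root p X = (if X = \<infinity> then \<infinity> else ennreal (enn2real X powr (1 / p)))"

definition Lp_norm :: "'a measure \<Rightarrow> real \<Rightarrow> ('a \<Rightarrow> complex) \<Rightarrow> ennreal" where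
  "Lp_norm mu p f = enn_root p (\<integral>\<^sup>+ x. ennreal (cmod (f x) powr p) \<partial>mu)"

definition L2 :: "'a measure \<Rightarrow> ('a \<Rightarrow> complex) set" where
  "L2 mu = {f. f \<in> borel_measurable mu \<and> (\<integral>\<^sup>+ x. ennreal (cmod (f x) ^ 2) \<partial>mu) < \<infinity>}"

definition L2_norm :: "'a measure \<Rightarrow> ('a \<Rightarrow> complex) \<Rightarrow> real" where
  "L2_norm mu f = sqrt (enn2real (\<integral>\<^sup>+ x. ennreal (cmod (f x) ^ 2) \<partial>mu))"

definition L2_inner :: "'a measure \<Rightarrow> ('a \<Rightarrow> complex) \<Rightarrow> ('a \<Rightarrow> complex) \<Rightarrow> complex" where
  "L2_inner mu f g = (\<integral> x. f x * cnj (g x) \<partial>mu)"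

definition L1_norm :: "'a measure \<Rightarrow> ('a \<Rightarrow> complex) \<Rightarrow> ennreal" where
  "L1_norm mu f = (\<integral>\<^sup>+ x. ennreal (cmod (f x)) \<partial>mu)"

definition doubling_mms :: "'a::metric_space measure \<Rightarrow> bool" where
  "doubling_mms mu \<longleftrightarrow>
     space mu = UNIV \<and> sets mu = sets borel \<and>
     (\<forall>x r. r > 0 \<longrightarrow> 0 < emeasure mu (ball x r) \<and> emeasure mu (ball x r) < \<infinity>) \<and>
     (\<exists>n::real. \<exists>CD::real. n > 0 \<and>
        (\<forall>x r \<alpha>. r > 0 \<longrightarrow> \<alpha> \<ge> 1 \<longrightarrow>
           emeasure mu (ball x (\<alpha> * r)) \<le> ennreal (CD * \<alpha> powr n) * emeasure mu (ball x r)))"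

text \<open>A (possibly unbounded) linear operator on L^2 is given by its domain D
  and its action L. Non-negative self-adjoint operator:\<close>
definition nonneg_selfadjoint ::
  "'a measure \<Rightarrow> ('a \<Rightarrow> complex) set \<Rightarrow> (('a \<Rightarrow> complex) \<Rightarrow> ('a \<Rightarrow> complex)) \<Rightarrow> bool" where
  "nonneg_selfadjoint mu D L \<longleftrightarrow>
     D \<subseteq> L2 mu \<and>
     \<comment> \<open>well defined on equivalence classes\<close>
     (\<forall>f\<in>D. \<forall>g\<in>L2 mu. (AE x in mu. f x = g x) \<longrightarrow> g \<in> D \<and> (AE x in mu. L f x = L g x)) \<and>
     \<comment> \<open>linear subspace, linear map into L^2\<close>
     (\<forall>f\<in>D. \<forall>g\<in>D. \<forall>a b::complex. (\<lambda>x. a * f x + b * g x) \<in> D \<and>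
        (AE x in mu. L (\<lambda>y. a * f y + b * g y) x = a * L f x + b * L g x)) \<and>
     (\<forall>f\<in>D. L f \<in> L2 mu) \<and>
     \<comment> \<open>densely defined\<close>
     (\<forall>g\<in>L2 mu. \<forall>\<epsilon>>0. \<exists>f\<in>D. L2_norm mu (\<lambda>x. f x - g x) < \<epsilon>) \<and>
     \<comment> \<open>self-adjoint: L equals its adjoint (same domain, same action)\<close>
     (\<forall>g\<in>L2 mu. g \<in> D \<longleftrightarrow> (\<exists>h\<in>L2 mu. \<forall>f\<in>D. L2_inner mu (L f) g = L2_inner mu f h)) \<and>
     (\<forall>g\<in>D. \<forall>f\<in>D. L2_inner mu (L f) g = L2_inner mu f (L g)) \<and>
     \<comment> \<open>non-negative\<close>
     (\<forall>f\<in>D. Re (L2_inner mu (L f) f) \<ge> 0)"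

text \<open>Spectrum: the set of lambda for which L - lambda I : D \<rightarrow> L^2 has no bounded
  inverse. (For self-adjoint L the spectrum is real; we take real lambda.)\<close>
definition spectrum_op ::
  "'a measure \<Rightarrow> ('a \<Rightarrow> complex) set \<Rightarrow> (('a \<Rightarrow> complex) \<Rightarrow> ('a \<Rightarrow> complex)) \<Rightarrow> real set" where
  "spectrum_op mu D L = {lam. \<not> (
      (\<forall>f\<in>D. (AE x in mu. L f x - complex_of_real lam * f x = 0) \<longrightarrow> (AE x in mu. f x = 0)) \<and>
      (\<exists>K::real. \<forall>g\<in>L2 mu. \<exists>f\<in>D.
          (AE x in mu. L f x - complex_of_real lam * f x = g x) \<and> L2_norm mu f \<le> K * L2_norm mu g))}"

text \<open>P is the semigroup e^{-tL}: for every f in L^2, u(t) = P t f is the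
  solution of u' = -L u on (0,\<infinity>), u(0) = f, continuous on [0,\<infinity>) in L^2.
  For non-negative self-adjoint L this determines e^{-tL} f uniquely (a.e.).\<close>
definition is_heat_semigroup ::
  "'a measure \<Rightarrow> ('a \<Rightarrow> complex) set \<Rightarrow> (('a \<Rightarrow> complex) \<Rightarrow> ('a \<Rightarrow> complex))
     \<Rightarrow> (real \<Rightarrow> ('a \<Rightarrow> complex) \<Rightarrow> ('a \<Rightarrow> complex)) \<Rightarrow> bool" where
  "is_heat_semigroup mu D L P \<longleftrightarrow>
     (\<forall>f\<in>L2 mu.
        (\<forall>t\<ge>0. P t f \<in> L2 mu) \<and>
        (AE x in mu. P 0 f x = f x) \<and>
        (\<forall>t\<ge>0. ((\<lambda>s. L2_norm mu (\<lambda>x. P s f x - P t f x)) \<longlongrightarrow> 0) (at t within {0..})) \<and>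
        (\<forall>t>0. P t f \<in> D \<and>
           ((\<lambda>s. L2_norm mu (\<lambda>x. (P s f x - P t f x) / complex_of_real (s - t) + L (P t f) x))
              \<longlongrightarrow> 0) (at t within {0<..})))"

text \<open>Generalized Gaussian estimate GGE_m(p,2) for a family T, with the
  L^p \<rightarrow> L^2 operator norm of 1_{B(x,t)} T_{t^m} 1_{B(y,t)} written out.\<close>
definition GGE ::
  "'a::metric_space measure \<Rightarrow> real \<Rightarrow> real \<Rightarrow> (real \<Rightarrow> ('a \<Rightarrow> complex) \<Rightarrow> ('a \<Rightarrow> complex)) \<Rightarrow> bool" where
  "GGE mu m p T \<longleftrightarrow>
     (\<exists>C c. C > 0 \<and> c > 0 \<and>
       (\<forall>x y t f. t > 0 \<longrightarrow> f \<in> L2 mu \<longrightarrow>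
          Lp_norm mu 2 (\<lambda>z. indicator (ball x t) z * T (t powr m) (\<lambda>w. indicator (ball y t) w * f w) z)
          \<le> ennreal (C * (measure mu (ball x t)) powr (-(1 / p - 1 / 2))
                       * exp (- c * (dist x y / t) powr (m / (m - 1))))
            * Lp_norm mu p f))"

definition sq_fun_on ::
  "real set \<Rightarrow> 'a::metric_space measure \<Rightarrow> real \<Rightarrow> (('a \<Rightarrow> complex) \<Rightarrow> ('a \<Rightarrow> complex))
     \<Rightarrow> (real \<Rightarrow> ('a \<Rightarrow> complex) \<Rightarrow> ('a \<Rightarrow> complex)) \<Rightarrow> ('a \<Rightarrow> complex) \<Rightarrow> 'a \<Rightarrow> ennreal" where
  "sq_fun_on I mu m L P f x = enn_root 2
     (\<integral>\<^sup>+ t. indicator I t *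
        ((\<integral>\<^sup>+ y. indicator (ball x t) y *
             ennreal ((cmod (complex_of_real (t powr m) * L (P (t powr m) f) y)) ^ 2) \<partial>mu)
          / emeasure mu (ball x t)) / ennreal t \<partial>lborel)"

abbreviation sq_fun where "sq_fun \<equiv> sq_fun_on {0<..}"
abbreviation sq_fun_loc where "sq_fun_loc \<equiv> sq_fun_on {0<..<1}"

end

theory Submission
  imports Defs
begin

text \<open>The spectral gap enters through the form bound \<open>\<langle>L f, f\<rangle> \<ge> \<delta> \<parallel>f\<parallel>\<^sup>2\<close>, which makes orbits of the
  semigroup decay exponentially. Summing the generalized Gaussian estimate over a partition of \<open>f\<close>
  into pieces living on balls of radius \<open>t / 4\<close>, and passing to the time derivative by a
  Landau-type interpolation (first differences decay off the diagonal, second differences are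
  controlled globally), one obtains with \<open>T = t\<^sup>m\<close>
  \<open>T \<parallel>1\<^bsub>B(x,t)\<^esub> L e\<^bsup>-TL\<^esup> f\<parallel>\<^sub>2 \<le> C e\<^bsup>-\<epsilon>T\<^esup> \<mu>(B(x,t))\<^bsup>-1/2\<^esup> \<integral> (1 + d(x,y)/t)\<^bsup>-M\<^esup> |f(y)| d\<mu>(y)\<close>.
  For \<open>t \<ge> 1\<close> this bounds the non-local part of the square function by an integral operator that
  is bounded on \<open>L\<^sup>1\<close>, which is the first inequality.

  For \<open>\<parallel>f\<parallel>\<^sub>1 \<lesssim> \<parallel>S f\<parallel>\<^sub>1\<close>, test \<open>f\<close> against bounded functions \<open>g\<close> by means of the reproducing formula
  \<open>\<langle>f, g\<rangle> = 4 \<integral> s \<langle>L e\<^bsup>-sL\<^esup> f, L e\<^bsup>-sL\<^esup> g\<rangle> ds\<close>. The same off-diagonal estimate yields a Carleson bound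
  for \<open>g\<close>, and the stopping-time argument of Coifman, Meyer and Stein (restrict the cone at \<open>x\<close> to
  those scales at which the truncated square function of \<open>g\<close> is still bounded) gives the tent-space
  duality inequality without any covering lemma.\<close>

subsection \<open>The Hilbert space structure\<close>

text \<open>No functional calculus is used: \<open>P\<close> enters only through orbits, the
  solutions of \<open>u' = - L u\<close>. A pairing of two orbits depends on the total time alone,
  so c -> \<open>ip mu (u 0) (u c)\<close> is the squared norm at c / 2; its derivative is
  non-positive and its second derivative is a non-increasing squared norm. The smoothing and decay
  usually read off the spectral theorem thus become calculus for a real function, and the real part
  of the inner product suffices for it. The obstacle is that GGE speaks of \<open>P\<close>, not of
  \<open>L\<close> applied to it. A difference quotient with step h costs 1 / h on the localized
  term and gains h on the global one, so h must shrink polynomially with the distance, and the decay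
  order of GGE has to exceed the desired one accordingly. Weights of arbitrary polynomial order are
  enough, and they also absorb every change of centre, radius or volume under doubling. Pieces of
  radius t / 4 leave time to spare: since m \<ge> 2, smoothing from \<open>L^1\<close> to
  \<open>L^2\<close> at that radius uses at most T / 16, and the rest of T turns into exponential
  decay.\<close>

definition ip :: "'a measure \<Rightarrow> ('a \<Rightarrow> complex) \<Rightarrow> ('a \<Rightarrow> complex) \<Rightarrow> real" where
  "ip mu f g = Re (L2_inner mu f g)"

text \<open>Source of two Cauchy-Schwarz inequalities: for \<open>ip\<close> itself and for the
  possibly degenerate form of \<open>L - lam\<close>.\<close>

lemma quadratic_form_discriminant:
  fixes a b c :: real
  assumes "\<And>t. 0 \<le> a + 2 * t * b + t\<^sup>2 * c"
  shows "b\<^sup>2 \<le> a * c"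
proof -
  have a: "0 \<le> a" using assms[of 0] by simp
  have c: "0 \<le> c"
  proof (rule ccontr)
    assume "\<not> 0 \<le> c"
    then have c: "c < 0" by simp
    \<comment> \<open>Large enough for t^2 * (- c) to exceed 2 * t * \<bar>b\<bar> + a, so the
      negative quadratic term wins.\<close>
    define t where "t = (2 * \<bar>b\<bar> + a + 1) / (- c) + 1"
    have t1: "t \<ge> 1" "t * (- c) \<ge> 2 * \<bar>b\<bar> + a + 1"
      using c a by (auto simp: t_def field_simps)
    have "2 * t * b \<le> 2 * t * \<bar>b\<bar>" using t1 by (simp add: mult_left_mono)
    moreover have "t\<^sup>2 * (-c) \<ge> t * (2 * \<bar>b\<bar> + a + 1)"
      using mult_left_mono[OF t1(2), of t] t1 by (simp add: power2_eq_square mult.assoc)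
    moreover have "t * (a + 1) \<ge> a + 1" using t1 a by (simp add: mult_le_cancel_right1)
    ultimately show False using assms[of t] by (simp add: algebra_simps)
  qed
  show ?thesis
  proof (cases "c = 0")
    case True
    have "b = 0"
    proof (rule ccontr)
      assume "b \<noteq> 0"
      \<comment> \<open>With c = 0 the polynomial is affine and takes the value -1 at this
        point.\<close>
      then show False using assms[of "- (a + 1) / (2 * b)"] True a by (simp add: field_simps)
    qed
    then show ?thesis using True by simp
  next
    case False
    \<comment> \<open>The vertex of the parabola.\<close>
    then show ?thesis using assms[of "- b / c"] c
      by (simp add: field_simps power2_eq_square)
  qed
qed

lemma L2_measurable: "f \<in> L2 mu \<Longrightarrow> f \<in> borel_measurable mu"
  by (simp add: L2_def)

lemma L2_iff: "f \<in> L2 mu \<longleftrightarrow> f \<in> borel_measurable mu \<and> integrable mu (\<lambda>x. (cmod (f x))\<^sup>2)"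
  by (auto simp: L2_def integrable_iff_bounded)

lemma L2_norm_eq: "f \<in> L2 mu \<Longrightarrow> L2_norm mu f = sqrt (\<integral>x. (cmod (f x))\<^sup>2 \<partial>mu)"
  unfolding L2_norm_def
  by (subst integral_eq_nn_integral) (auto simp: L2_def)

lemma L2_norm_nonneg [simp]: "0 \<le> L2_norm mu f"
  by (simp add: L2_norm_def)

lemma nn_integral_L2: 
  assumes "f \<in> L2 mu"
  shows "(\<integral>\<^sup>+x. ennreal ((cmod (f x))\<^sup>2) \<partial>mu) = ennreal ((L2_norm mu f)\<^sup>2)"
  using assms unfolding L2_norm_def L2_def by simp

lemma L2_lincomb: 
  assumes "f \<in> L2 mu" "g \<in> L2 mu"
  shows "(\<lambda>x. a * f x + b * g x) \<in> L2 mu"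
proof -
  have *: "(cmod (a * f x + b * g x))\<^sup>2 \<le> 2 * (cmod a)\<^sup>2 * (cmod (f x))\<^sup>2 + 2 * (cmod b)\<^sup>2 * (cmod (g x))\<^sup>2" for x
  proof -
    have "(cmod (a * f x + b * g x))\<^sup>2 \<le> (cmod (a * f x) + cmod (b * g x))\<^sup>2"
      by (intro power_mono norm_triangle_ineq norm_ge_zero)
    also have "\<dots> \<le> 2 * (cmod (a * f x))\<^sup>2 + 2 * (cmod (b * g x))\<^sup>2"
      using sum_squares_bound[of "cmod (a * f x)" "cmod (b * g x)"] by (simp add: power2_sum)
    finally show ?thesis by (simp add: norm_mult power_mult_distrib)
  qed
  have "integrable mu (\<lambda>x. 2 * (cmod a)\<^sup>2 * (cmod (f x))\<^sup>2 + 2 * (cmod b)\<^sup>2 * (cmod (g x))\<^sup>2)"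
    using assms by (auto simp: L2_iff)
  then have "integrable mu (\<lambda>x. (cmod (a * f x + b * g x))\<^sup>2)"
    by (rule Bochner_Integration.integrable_bound) (use assms * in \<open>auto simp: L2_iff intro!: always_eventually\<close>)
  then show ?thesis using assms by (auto simp: L2_iff)
qed

lemma L2_zero [simp]: "(\<lambda>x. 0) \<in> L2 mu" by (simp add: L2_iff)

lemma L2_scale: "f \<in> L2 mu \<Longrightarrow> (\<lambda>x. a * f x) \<in> L2 mu"
  using L2_lincomb[of f mu f a 0] by simp

lemma L2_divide: "f \<in> L2 mu \<Longrightarrow> (\<lambda>x. f x / a) \<in> L2 mu"
  using L2_scale[of f mu "1 / a"] by simp

lemma L2_add: "f \<in> L2 mu \<Longrightarrow> g \<in> L2 mu \<Longrightarrow> (\<lambda>x. f x + g x) \<in> L2 mu"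
  using L2_lincomb[of f mu g 1 1] by simp

lemma L2_diff: "f \<in> L2 mu \<Longrightarrow> g \<in> L2 mu \<Longrightarrow> (\<lambda>x. f x - g x) \<in> L2 mu"
  using L2_lincomb[of f mu g 1 "-1"] by simp

lemma L2_minus: "f \<in> L2 mu \<Longrightarrow> (\<lambda>x. - f x) \<in> L2 mu"
  using L2_scale[of f mu "-1"] by simp

lemma L2_indicator:
  assumes "f \<in> L2 mu" "A \<in> sets mu"
  shows "(\<lambda>x. indicator A x * f x) \<in> L2 mu"
proof -
  have "integrable mu (\<lambda>x. (cmod (f x))\<^sup>2)" using assms by (auto simp: L2_iff)
  then have "integrable mu (\<lambda>x. (cmod (indicator A x * f x))\<^sup>2)"
    by (rule Bochner_Integration.integrable_bound) 
       (use assms in \<open>auto simp: L2_iff indicator_def intro!: always_eventually\<close>)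
  then show ?thesis using assms by (auto simp: L2_iff)
qed

lemmas L2_intros = L2_lincomb L2_add L2_diff L2_scale L2_divide L2_indicator L2_minus

lemma integrable_L2_mult:
  assumes "f \<in> L2 mu" "g \<in> L2 mu"
  shows "integrable mu (\<lambda>x. f x * cnj (g x))"
proof -
  have "integrable mu (\<lambda>x. (cmod (f x))\<^sup>2 + (cmod (g x))\<^sup>2)" using assms by (auto simp: L2_iff)
  then show ?thesis
  proof (rule Bochner_Integration.integrable_bound)
    show "AE x in mu. norm (f x * cnj (g x)) \<le> norm ((cmod (f x))\<^sup>2 + (cmod (g x))\<^sup>2)"
    proof (rule always_eventually, rule allI)
      fix x
      have "2 * cmod (f x) * cmod (g x) \<le> (cmod (f x))\<^sup>2 + (cmod (g x))\<^sup>2"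
        by (rule sum_squares_bound)
      moreover have "0 \<le> cmod (f x) * cmod (g x)" by simp
      ultimately show "norm (f x * cnj (g x)) \<le> norm ((cmod (f x))\<^sup>2 + (cmod (g x))\<^sup>2)"
        unfolding norm_mult complex_mod_cnj real_norm_def by linarith
    qed
  next
    have "(cnj :: complex \<Rightarrow> complex) \<in> borel_measurable borel"
      by (intro borel_measurable_continuous_onI continuous_on_cnj continuous_on_id)
    from measurable_compose[OF L2_measurable[OF assms(2)] this]
    show "(\<lambda>x. f x * cnj (g x)) \<in> borel_measurable mu"
      using L2_measurable[OF assms(1)] by simp
  qed
qed

lemma integrable_ip:
  assumes "f \<in> L2 mu" "g \<in> L2 mu"
  shows "integrable mu (\<lambda>x. Re (f x) * Re (g x) + Im (f x) * Im (g x))"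
  using integrable_Re[OF integrable_L2_mult[OF assms]] by simp

lemma ip_eq: 
  assumes "f \<in> L2 mu" "g \<in> L2 mu"
  shows "ip mu f g = (\<integral>x. Re (f x) * Re (g x) + Im (f x) * Im (g x) \<partial>mu)"
  unfolding ip_def L2_inner_def using integral_Re[OF integrable_L2_mult[OF assms]] by simp

lemma ip_commute: "f \<in> L2 mu \<Longrightarrow> g \<in> L2 mu \<Longrightarrow> ip mu f g = ip mu g f"
  by (simp add: ip_eq mult.commute)

lemma ip_lincomb_left:
  assumes "f \<in> L2 mu" "g \<in> L2 mu" "h \<in> L2 mu"
  shows "ip mu (\<lambda>x. complex_of_real a * f x + complex_of_real b * g x) h = a * ip mu f h + b * ip mu g h"
proof -
  have "ip mu (\<lambda>x. complex_of_real a * f x + complex_of_real b * g x) h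
     = (\<integral>x. a * (Re (f x) * Re (h x) + Im (f x) * Im (h x)) + b * (Re (g x) * Re (h x) + Im (g x) * Im (h x)) \<partial>mu)"
    using assms by (subst ip_eq) (auto intro!: L2_lincomb Bochner_Integration.integral_cong simp: algebra_simps)
  also have "\<dots> = a * ip mu f h + b * ip mu g h"
    using assms integrable_ip[of f mu h] integrable_ip[of g mu h] 
    by (subst Bochner_Integration.integral_add) (auto simp: ip_eq)
  finally show ?thesis .
qed

lemma ip_scale_left: "f \<in> L2 mu \<Longrightarrow> h \<in> L2 mu \<Longrightarrow> ip mu (\<lambda>x. complex_of_real a * f x) h = a * ip mu f h"
  using ip_lincomb_left[of f mu f h a 0] by simp

lemma ip_add_left: "f \<in> L2 mu \<Longrightarrow> g \<in> L2 mu \<Longrightarrow> h \<in> L2 mu \<Longrightarrow> ip mu (\<lambda>x. f x + g x) h = ip mu f h + ip mu g h"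
  using ip_lincomb_left[of f mu g h 1 1] by simp

lemma ip_diff_left: "f \<in> L2 mu \<Longrightarrow> g \<in> L2 mu \<Longrightarrow> h \<in> L2 mu \<Longrightarrow> ip mu (\<lambda>x. f x - g x) h = ip mu f h - ip mu g h"
  using ip_lincomb_left[of f mu g h 1 "-1"] by simp

lemma ip_minus_left: "f \<in> L2 mu \<Longrightarrow> h \<in> L2 mu \<Longrightarrow> ip mu (\<lambda>x. - f x) h = - ip mu f h"
  using ip_scale_left[of f mu h "-1"] by simp

lemma ip_divide_left: "f \<in> L2 mu \<Longrightarrow> h \<in> L2 mu \<Longrightarrow> ip mu (\<lambda>x. f x / complex_of_real a) h = ip mu f h / a"
  using ip_scale_left[of f mu h "1 / a"] by simp

lemma ip_add_right: "f \<in> L2 mu \<Longrightarrow> g \<in> L2 mu \<Longrightarrow> h \<in> L2 mu \<Longrightarrow> ip mu h (\<lambda>x. f x + g x) = ip mu h f + ip mu h g"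
  by (subst (1 2 3) ip_commute) (auto intro: L2_intros ip_add_left)

lemma ip_diff_right: "f \<in> L2 mu \<Longrightarrow> g \<in> L2 mu \<Longrightarrow> h \<in> L2 mu \<Longrightarrow> ip mu h (\<lambda>x. f x - g x) = ip mu h f - ip mu h g"
  by (subst (1 2 3) ip_commute) (auto intro: L2_intros ip_diff_left)

lemma ip_minus_right: "f \<in> L2 mu \<Longrightarrow> h \<in> L2 mu \<Longrightarrow> ip mu h (\<lambda>x. - f x) = - ip mu h f"
  by (subst (1 2) ip_commute) (auto intro: L2_intros ip_minus_left)

lemma ip_self: 
  assumes "f \<in> L2 mu"
  shows "ip mu f f = (L2_norm mu f)\<^sup>2"
proof -
  have "0 \<le> (\<integral>x. (cmod (f x))\<^sup>2 \<partial>mu)" by (intro integral_nonneg_AE) auto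
  then show ?thesis using assms by (simp add: ip_eq L2_norm_eq cmod_power2 power2_eq_square[of "Re _"] power2_eq_square[of "Im _"])
qed

lemma ip_cong_AE:
  assumes "f \<in> L2 mu" "g \<in> L2 mu" "f' \<in> L2 mu" "g' \<in> L2 mu"
    "AE x in mu. f x = f' x" "AE x in mu. g x = g' x"
  shows "ip mu f g = ip mu f' g'"
  using assms(5,6) assms(1-4)[THEN L2_measurable] unfolding ip_eq[OF assms(1,2)] ip_eq[OF assms(3,4)]
  by (intro integral_cong_AE) (auto intro!: borel_measurable_add borel_measurable_times)

lemma L2_norm_cong_AE:
  assumes "AE x in mu. f x = f' x"
  shows "L2_norm mu f = L2_norm mu f'"
  unfolding L2_norm_def using assms
  by (intro arg_cong[of _ _ "\<lambda>a. sqrt (enn2real a)"] nn_integral_cong_AE) auto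

lemma ip_Cauchy_Schwarz:
  assumes f: "f \<in> L2 mu" and g: "g \<in> L2 mu"
  shows "\<bar>ip mu f g\<bar> \<le> L2_norm mu f * L2_norm mu g"
proof -
  have "(ip mu f g)\<^sup>2 \<le> (L2_norm mu f)\<^sup>2 * (L2_norm mu g)\<^sup>2"
  proof (rule quadratic_form_discriminant)
    fix t :: real
    let ?h = "\<lambda>x. complex_of_real 1 * f x + complex_of_real t * g x"
    have h: "?h \<in> L2 mu" using f g by (intro L2_lincomb)
    have "0 \<le> ip mu ?h ?h" unfolding ip_self[OF h] by simp
    also have "\<dots> = ip mu f ?h + t * ip mu g ?h" 
      using f g h by (subst ip_lincomb_left) auto
    also have "ip mu f ?h = ip mu f f + t * ip mu f g"
      using f g h by (subst ip_commute, simp, simp, subst ip_lincomb_left) (auto simp: ip_commute[of f mu g])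
    also have "ip mu g ?h = ip mu f g + t * ip mu g g"
      using f g h by (subst ip_commute, simp, simp, subst ip_lincomb_left) auto
    finally show "0 \<le> (L2_norm mu f)\<^sup>2 + 2 * t * ip mu f g + t\<^sup>2 * (L2_norm mu g)\<^sup>2"
      using f g by (simp add: ip_self algebra_simps power2_eq_square)
  qed
  then show ?thesis
    by (metis abs_le_square_iff abs_mult abs_of_nonneg L2_norm_nonneg power_mult_distrib)
qed

lemma L2_norm_triangle:
  assumes f: "f \<in> L2 mu" and g: "g \<in> L2 mu"
  shows "L2_norm mu (\<lambda>x. f x + g x) \<le> L2_norm mu f + L2_norm mu g"
proof -
  have h: "(\<lambda>x. f x + g x) \<in> L2 mu" using assms by (rule L2_add)
  have "(L2_norm mu (\<lambda>x. f x + g x))\<^sup>2 = (L2_norm mu f)\<^sup>2 + 2 * ip mu f g + (L2_norm mu g)\<^sup>2"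
    using f g h by (simp add: ip_self[symmetric] ip_add_left ip_add_right ip_commute[of g mu f])
  also have "\<dots> \<le> (L2_norm mu f + L2_norm mu g)\<^sup>2"
    using ip_Cauchy_Schwarz[OF assms] by (simp add: power2_sum)
  finally show ?thesis by (rule power2_le_imp_le) simp
qed

lemma L2_norm_scale:
  assumes "f \<in> L2 mu" shows "L2_norm mu (\<lambda>x. a * f x) = cmod a * L2_norm mu f"
  using assms by (simp add: L2_norm_eq L2_scale norm_mult power_mult_distrib real_sqrt_mult)

lemma L2_norm_minus: "L2_norm mu (\<lambda>x. - f x) = L2_norm mu f"
  by (simp add: L2_norm_def)

lemma L2_norm_divide:
  assumes "f \<in> L2 mu" shows "L2_norm mu (\<lambda>x. f x / a) = L2_norm mu f / cmod a"
  using L2_norm_scale[OF assms, of "1 / a"] by (simp add: norm_divide)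

lemma L2_norm_diff_commute: "L2_norm mu (\<lambda>x. f x - g x) = L2_norm mu (\<lambda>x. g x - f x)"
  by (simp add: L2_norm_def norm_minus_commute)

lemma L2_norm_le_add_diff:
  assumes f: "f \<in> L2 mu" and g: "g \<in> L2 mu"
  shows "L2_norm mu f \<le> L2_norm mu g + L2_norm mu (\<lambda>x. f x - g x)"
  using L2_norm_triangle[OF g L2_diff[OF f g]] by simp

lemma L2_norm_abs_diff:
  assumes f: "f \<in> L2 mu" and g: "g \<in> L2 mu"
  shows "\<bar>L2_norm mu f - L2_norm mu g\<bar> \<le> L2_norm mu (\<lambda>x. f x - g x)"
  using L2_norm_le_add_diff[OF f g] L2_norm_le_add_diff[OF g f] L2_norm_diff_commute[of mu f g] by linarith

lemma L2_norm_indicator_le: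
  assumes f: "f \<in> L2 mu" and A: "A \<in> sets mu" "B \<in> sets mu" "A \<subseteq> B"
  shows "L2_norm mu (\<lambda>x. indicator A x * f x) \<le> L2_norm mu (\<lambda>x. indicator B x * f x)"
proof -
  have "(\<integral>x. (cmod (indicator A x * f x))\<^sup>2 \<partial>mu) \<le> (\<integral>x. (cmod (indicator B x * f x))\<^sup>2 \<partial>mu)"
    using L2_indicator[OF f A(1)] L2_indicator[OF f A(2)] A
    by (intro integral_mono) (auto simp: L2_iff indicator_def)
  then show ?thesis using f A by (simp add: L2_norm_eq L2_indicator)
qed

lemma L2_norm_indicator_le_self:
  assumes f: "f \<in> L2 mu" and A: "A \<in> sets mu"
  shows "L2_norm mu (\<lambda>x. indicator A x * f x) \<le> L2_norm mu f"
proof -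
  have "(\<integral>x. (cmod (indicator A x * f x))\<^sup>2 \<partial>mu) \<le> (\<integral>x. (cmod (f x))\<^sup>2 \<partial>mu)"
    using L2_indicator[OF f A] f
    by (intro integral_mono) (auto simp: L2_iff indicator_def)
  then show ?thesis using f A by (simp add: L2_norm_eq L2_indicator)
qed

lemma L2_norm_eq_0_imp_AE:
  assumes "f \<in> L2 mu" "L2_norm mu f = 0"
  shows "AE x in mu. f x = 0"
proof -
  have "(\<integral>\<^sup>+x. ennreal ((cmod (f x))\<^sup>2) \<partial>mu) = 0"
    using nn_integral_L2[OF assms(1)] assms(2) by simp
  then show ?thesis using assms(1) by (subst (asm) nn_integral_0_iff_AE) (auto dest: L2_measurable)
qed

subsection \<open>Differentiable curves\<close>

text \<open>Differentiability in the norm of \<open>L^2\<close>. Membership of the nearby values is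
  demanded because \<open>L2_norm\<close> sends a function of infinite norm to 0, so the limit alone
  would not exclude values outside \<open>L2 mu\<close>.\<close>

definition l2_deriv :: "'a measure \<Rightarrow> (real \<Rightarrow> 'a \<Rightarrow> complex) \<Rightarrow> ('a \<Rightarrow> complex) \<Rightarrow> real \<Rightarrow> bool" where
  "l2_deriv mu X X' t \<longleftrightarrow> X t \<in> L2 mu \<and> X' \<in> L2 mu \<and> (\<forall>\<^sub>F s in at t. X s \<in> L2 mu) \<and>
     ((\<lambda>s. L2_norm mu (\<lambda>x. (X s x - X t x) / complex_of_real (s - t) - X' x)) \<longlongrightarrow> 0) (at t)"

lemma ip_tendsto:
  assumes X: "((\<lambda>s. L2_norm mu (\<lambda>x. X s x - X' x)) \<longlongrightarrow> 0) F" "\<forall>\<^sub>F s in F. X s \<in> L2 mu" "X' \<in> L2 mu"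
    and Y: "((\<lambda>s. L2_norm mu (\<lambda>x. Y s x - Y' x)) \<longlongrightarrow> 0) F" "\<forall>\<^sub>F s in F. Y s \<in> L2 mu" "Y' \<in> L2 mu"
  shows "((\<lambda>s. ip mu (X s) (Y s)) \<longlongrightarrow> ip mu X' Y') F"
proof -
  let ?dx = "\<lambda>s. L2_norm mu (\<lambda>x. X s x - X' x)"
  let ?dy = "\<lambda>s. L2_norm mu (\<lambda>x. Y s x - Y' x)"
  have "((\<lambda>s. ?dx s * (L2_norm mu Y' + ?dy s) + L2_norm mu X' * ?dy s) \<longlongrightarrow> 0 * (L2_norm mu Y' + 0) + L2_norm mu X' * 0) F"
    by (intro tendsto_intros X Y)
  then have lim: "((\<lambda>s. ?dx s * (L2_norm mu Y' + ?dy s) + L2_norm mu X' * ?dy s) \<longlongrightarrow> 0) F" by simp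
  have "((\<lambda>s. ip mu (X s) (Y s) - ip mu X' Y') \<longlongrightarrow> 0) F"
  proof (rule Lim_null_comparison[OF _ lim])
    show "\<forall>\<^sub>F s in F. norm (ip mu (X s) (Y s) - ip mu X' Y') \<le> ?dx s * (L2_norm mu Y' + ?dy s) + L2_norm mu X' * ?dy s"
      using X(2) Y(2)
    proof eventually_elim
      case (elim s)
      have "ip mu (X s) (Y s) - ip mu X' Y' = ip mu (\<lambda>x. X s x - X' x) (Y s) + ip mu X' (\<lambda>x. Y s x - Y' x)"
        using elim X Y by (simp add: ip_diff_left ip_diff_right)
      moreover have "\<bar>ip mu (\<lambda>x. X s x - X' x) (Y s)\<bar> \<le> ?dx s * L2_norm mu (Y s)"
        using elim X Y by (intro ip_Cauchy_Schwarz L2_diff)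
      moreover have "?dx s * L2_norm mu (Y s) \<le> ?dx s * (L2_norm mu Y' + ?dy s)"
        using elim Y L2_norm_le_add_diff[of "Y s" mu Y'] by (intro mult_left_mono) auto
      moreover have "\<bar>ip mu X' (\<lambda>x. Y s x - Y' x)\<bar> \<le> L2_norm mu X' * ?dy s"
        using elim X Y by (intro ip_Cauchy_Schwarz L2_diff)
      ultimately show ?case by simp
    qed
  qed
  then show ?thesis by (simp add: LIM_zero_iff)
qed

lemma l2_deriv_tendsto:
  assumes "l2_deriv mu X X' t"
  shows "((\<lambda>s. L2_norm mu (\<lambda>x. X s x - X t x)) \<longlongrightarrow> 0) (at t)"
proof -
  let ?q = "\<lambda>s. L2_norm mu (\<lambda>x. (X s x - X t x) / complex_of_real (s - t) - X' x)"
  have q: "(?q \<longlongrightarrow> 0) (at t)" using assms by (simp add: l2_deriv_def)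
  have "((\<lambda>s. \<bar>s - t\<bar> * (L2_norm mu X' + ?q s)) \<longlongrightarrow> \<bar>t - t\<bar> * (L2_norm mu X' + 0)) (at t)"
    by (intro tendsto_intros q)
  then have lim: "((\<lambda>s. \<bar>s - t\<bar> * (L2_norm mu X' + ?q s)) \<longlongrightarrow> 0) (at t)" by simp
  show ?thesis
  proof (rule Lim_null_comparison[OF _ lim])
    have "\<forall>\<^sub>F s in at t. X s \<in> L2 mu" using assms by (simp add: l2_deriv_def)
    then show "\<forall>\<^sub>F s in at t. norm (L2_norm mu (\<lambda>x. X s x - X t x)) \<le> \<bar>s - t\<bar> * (L2_norm mu X' + ?q s)"
      using eventually_neq_at_within[of t t UNIV]
    proof eventually_elim
      case (elim s)
      have L: "X s \<in> L2 mu" "X t \<in> L2 mu" "X' \<in> L2 mu" using elim assms by (auto simp: l2_deriv_def)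
      have "L2_norm mu (\<lambda>x. X s x - X t x) = \<bar>s - t\<bar> * L2_norm mu (\<lambda>x. (X s x - X t x) / complex_of_real (s - t))"
        using elim L L2_norm_divide[OF L2_diff[OF L(1,2)], of "complex_of_real (s - t)"]
        by (simp add: norm_of_real del: of_real_diff)
      also have "\<dots> \<le> \<bar>s - t\<bar> * (L2_norm mu X' + ?q s)"
        using L by (intro mult_left_mono L2_norm_le_add_diff L2_divide L2_diff) auto
      finally show ?case by simp
    qed
  qed
qed

lemma l2_deriv_ip:
  assumes X: "l2_deriv mu X X' t" and Y: "l2_deriv mu Y Y' t"
  shows "((\<lambda>s. ip mu (X s) (Y s)) has_real_derivative (ip mu X' (Y t) + ip mu (X t) Y')) (at t)"
proof -
  let ?qX = "\<lambda>s x. (X s x - X t x) / complex_of_real (s - t)"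
  let ?qY = "\<lambda>s x. (Y s x - Y t x) / complex_of_real (s - t)"
  have X1: "X t \<in> L2 mu" "X' \<in> L2 mu" "\<forall>\<^sub>F s in at t. X s \<in> L2 mu"
    and X2: "((\<lambda>s. L2_norm mu (\<lambda>x. ?qX s x - X' x)) \<longlongrightarrow> 0) (at t)" 
    using X by (auto simp: l2_deriv_def)
  have Y1: "Y t \<in> L2 mu" "Y' \<in> L2 mu" "\<forall>\<^sub>F s in at t. Y s \<in> L2 mu"
    and Y2: "((\<lambda>s. L2_norm mu (\<lambda>x. ?qY s x - Y' x)) \<longlongrightarrow> 0) (at t)" 
    using Y by (auto simp: l2_deriv_def)
  have qX: "\<forall>\<^sub>F s in at t. ?qX s \<in> L2 mu" using X1(3) by eventually_elim (simp add: L2_divide L2_diff X1 del: of_real_diff)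
  have qY: "\<forall>\<^sub>F s in at t. ?qY s \<in> L2 mu" using Y1(3) by eventually_elim (simp add: L2_divide L2_diff Y1 del: of_real_diff)
  have 1: "((\<lambda>s. ip mu (?qX s) (Y s)) \<longlongrightarrow> ip mu X' (Y t)) (at t)"
    by (intro ip_tendsto X2 qX X1 l2_deriv_tendsto[OF Y] Y1)
  have 2: "((\<lambda>s. ip mu (X t) (?qY s)) \<longlongrightarrow> ip mu (X t) Y') (at t)"
    by (intro ip_tendsto Y2 qY Y1 X1) (auto simp: L2_norm_def X1)
  have "((\<lambda>s. (ip mu (X s) (Y s) - ip mu (X t) (Y t)) / (s - t)) \<longlongrightarrow> ip mu X' (Y t) + ip mu (X t) Y') (at t)"
  proof (rule Lim_transform_eventually[OF tendsto_add[OF 1 2]])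
    show "\<forall>\<^sub>F s in at t. ip mu (?qX s) (Y s) + ip mu (X t) (?qY s) = (ip mu (X s) (Y s) - ip mu (X t) (Y t)) / (s - t)"
      using X1(3) Y1(3)
    proof eventually_elim
      case (elim s)
      have "ip mu (?qX s) (Y s) = ip mu (\<lambda>x. X s x - X t x) (Y s) / (s - t)"
        using elim X1 by (intro ip_divide_left L2_diff)
      moreover have "ip mu (X t) (?qY s) = ip mu (X t) (\<lambda>x. Y s x - Y t x) / (s - t)"
        using elim X1 Y1 ip_divide_left[of "\<lambda>x. Y s x - Y t x" mu "X t" "s - t"]
        by (subst (1 2) ip_commute) (auto intro: L2_intros)
      ultimately show ?case using elim X1 Y1 by (simp add: ip_diff_left ip_diff_right add_divide_distrib[symmetric])
    qed
  qed
  then show ?thesis by (simp add: has_field_derivative_iff)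
qed

lemma l2_deriv_const: "g \<in> L2 mu \<Longrightarrow> l2_deriv mu (\<lambda>s. g) (\<lambda>x. 0) t"
  by (simp add: l2_deriv_def L2_norm_def)

text \<open>The case e = 1 translates time; e = -1 reverses it and produces the backward orbit of
  \<open>pair_shift\<close>.\<close>

lemma l2_deriv_comp:
  assumes "l2_deriv mu X X' (c + e * t)" and e: "e = 1 \<or> e = -1"
  shows "l2_deriv mu (\<lambda>s. X (c + e * s)) (\<lambda>x. complex_of_real e * X' x) t"
proof -
  have lim: "filterlim (\<lambda>s. c + e * s) (at (c + e * t)) (at t)"
    using e by (auto simp: filterlim_at eventually_at_filter intro!: tendsto_eq_intros)
  have A: "X (c + e * t) \<in> L2 mu" "X' \<in> L2 mu" using assms by (auto simp: l2_deriv_def)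
  have ev: "\<forall>\<^sub>F s in at t. X (c + e * s) \<in> L2 mu"
    by (rule eventually_compose_filterlim[OF _ lim]) (use assms(1) in \<open>simp add: l2_deriv_def\<close>)
  have *: "((\<lambda>s. L2_norm mu (\<lambda>x. (X (c + e * s) x - X (c + e * t) x) / complex_of_real ((c + e * s) - (c + e * t)) - X' x)) \<longlongrightarrow> 0) (at t)"
    using assms(1) filterlim_compose[OF _ lim] unfolding l2_deriv_def by blast
  have "((\<lambda>s. L2_norm mu (\<lambda>x. (X (c + e * s) x - X (c + e * t) x) / complex_of_real (s - t) - complex_of_real e * X' x)) \<longlongrightarrow> 0) (at t)"
  proof (rule Lim_transform_eventually[OF *])
    show "\<forall>\<^sub>F s in at t. L2_norm mu (\<lambda>x. (X (c + e * s) x - X (c + e * t) x) / complex_of_real ((c + e * s) - (c + e * t)) - X' x)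
        = L2_norm mu (\<lambda>x. (X (c + e * s) x - X (c + e * t) x) / complex_of_real (s - t) - complex_of_real e * X' x)"
      using ev
    proof eventually_elim
      case (elim s)
      have "(\<lambda>x. (X (c + e * s) x - X (c + e * t) x) / complex_of_real (s - t) - complex_of_real e * X' x)
          = (\<lambda>x. complex_of_real e * ((X (c + e * s) x - X (c + e * t) x) / complex_of_real ((c + e * s) - (c + e * t)) - X' x))"
        using e by (auto simp: fun_eq_iff divide_simps algebra_simps)
      then show ?case using e elim A by (auto simp: L2_norm_scale L2_intros L2_norm_minus)
    qed
  qed
  then show ?thesis using A ev by (auto simp: l2_deriv_def L2_intros)
qed

lemma l2_deriv_lincomb:
  assumes X: "l2_deriv mu X X' t" and Y: "l2_deriv mu Y Y' t"
  shows "l2_deriv mu (\<lambda>s x. a * X s x + b * Y s x) (\<lambda>x. a * X' x + b * Y' x) t"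
proof -
  let ?qX = "\<lambda>s x. (X s x - X t x) / complex_of_real (s - t) - X' x"
  let ?qY = "\<lambda>s x. (Y s x - Y t x) / complex_of_real (s - t) - Y' x"
  have X1: "X t \<in> L2 mu" "X' \<in> L2 mu" "\<forall>\<^sub>F s in at t. X s \<in> L2 mu"
    and X2: "((\<lambda>s. L2_norm mu (?qX s)) \<longlongrightarrow> 0) (at t)" 
    using X by (auto simp: l2_deriv_def)
  have Y1: "Y t \<in> L2 mu" "Y' \<in> L2 mu" "\<forall>\<^sub>F s in at t. Y s \<in> L2 mu"
    and Y2: "((\<lambda>s. L2_norm mu (?qY s)) \<longlongrightarrow> 0) (at t)" 
    using Y by (auto simp: l2_deriv_def)
  have ev: "\<forall>\<^sub>F s in at t. (\<lambda>x. a * X s x + b * Y s x) \<in> L2 mu"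
    using X1(3) Y1(3) by eventually_elim (auto intro: L2_intros)
  have "((\<lambda>s. cmod a * L2_norm mu (?qX s) + cmod b * L2_norm mu (?qY s)) \<longlongrightarrow> cmod a * 0 + cmod b * 0) (at t)"
    by (intro tendsto_intros X2 Y2)
  then have lim: "((\<lambda>s. cmod a * L2_norm mu (?qX s) + cmod b * L2_norm mu (?qY s)) \<longlongrightarrow> 0) (at t)" by simp
  have "((\<lambda>s. L2_norm mu (\<lambda>x. (a * X s x + b * Y s x - (a * X t x + b * Y t x)) / complex_of_real (s - t) - (a * X' x + b * Y' x))) \<longlongrightarrow> 0) (at t)"
  proof (rule Lim_null_comparison[OF _ lim])
    show "\<forall>\<^sub>F s in at t. norm (L2_norm mu (\<lambda>x. (a * X s x + b * Y s x - (a * X t x + b * Y t x)) / complex_of_real (s - t) - (a * X' x + b * Y' x)))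
        \<le> cmod a * L2_norm mu (?qX s) + cmod b * L2_norm mu (?qY s)"
      using X1(3) Y1(3)
    proof eventually_elim
      case (elim s)
      have "(\<lambda>x. (a * X s x + b * Y s x - (a * X t x + b * Y t x)) / complex_of_real (s - t) - (a * X' x + b * Y' x))
          = (\<lambda>x. a * ?qX s x + b * ?qY s x)"
        by (auto simp: fun_eq_iff add_divide_distrib diff_divide_distrib algebra_simps)
      moreover have "?qX s \<in> L2 mu" "?qY s \<in> L2 mu" using X1 Y1 elim by (simp_all add: L2_divide L2_diff del: of_real_diff)
      ultimately show ?case
        using L2_norm_triangle[of "\<lambda>x. a * ?qX s x" mu "\<lambda>x. b * ?qY s x"]
        by (simp add: L2_norm_scale L2_scale)
    qed
  qed
  then show ?thesis using X1 Y1 ev by (auto simp: l2_deriv_def L2_intros)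
qed

lemma l2_deriv_cong_AE:
  assumes "l2_deriv mu X X' t" "AE x in mu. X' x = X'' x" "X'' \<in> L2 mu"
  shows "l2_deriv mu X X'' t"
proof -
  have "L2_norm mu (\<lambda>x. (X s x - X t x) / complex_of_real (s - t) - X' x)
      = L2_norm mu (\<lambda>x. (X s x - X t x) / complex_of_real (s - t) - X'' x)" for s
    using assms(2) by (intro L2_norm_cong_AE) auto
  then show ?thesis using assms by (simp add: l2_deriv_def)
qed

subsection \<open>Non-negative self-adjoint operators\<close>

locale selfadjoint =
  fixes mu :: "'a measure" and D :: "('a \<Rightarrow> complex) set" and L :: "('a \<Rightarrow> complex) \<Rightarrow> 'a \<Rightarrow> complex"
  assumes sa: "nonneg_selfadjoint mu D L"
begin

lemma D_L2: "f \<in> D \<Longrightarrow> f \<in> L2 mu"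
  using sa by (auto simp: nonneg_selfadjoint_def)

lemma L_L2: "f \<in> D \<Longrightarrow> L f \<in> L2 mu"
  using sa by (auto simp: nonneg_selfadjoint_def)

lemma D_lincomb: "f \<in> D \<Longrightarrow> g \<in> D \<Longrightarrow> (\<lambda>x. a * f x + b * g x) \<in> D"
  using sa by (auto simp: nonneg_selfadjoint_def)

lemma L_lincomb: "f \<in> D \<Longrightarrow> g \<in> D \<Longrightarrow> AE x in mu. L (\<lambda>y. a * f y + b * g y) x = a * L f x + b * L g x"
  using sa by (auto simp: nonneg_selfadjoint_def)

lemma L_cong_AE: "f \<in> D \<Longrightarrow> g \<in> L2 mu \<Longrightarrow> AE x in mu. f x = g x \<Longrightarrow> AE x in mu. L f x = L g x"
  using sa by (auto simp: nonneg_selfadjoint_def)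

lemma L_sym: "f \<in> D \<Longrightarrow> g \<in> D \<Longrightarrow> ip mu (L f) g = ip mu f (L g)"
  using sa unfolding nonneg_selfadjoint_def ip_def by metis

lemma L_nonneg: "f \<in> D \<Longrightarrow> 0 \<le> ip mu (L f) f"
  using sa unfolding nonneg_selfadjoint_def ip_def by metis

text \<open>By \<open>low\<close> the form of \<open>L - lam\<close> is non-negative, hence obeys
  Cauchy-Schwarz. It is applied at the bottom of the numerical range and, with
  \<open>lam = 0\<close>, in \<open>primitive_at_0\<close>.\<close>

lemma L_form_Cauchy_Schwarz:
  assumes f: "f \<in> D" and g: "g \<in> D" 
    and low: "\<And>h. h \<in> D \<Longrightarrow> lam * (L2_norm mu h)\<^sup>2 \<le> ip mu (L h) h"
  shows "(ip mu (L f) g - lam * ip mu f g)\<^sup>2 \<le> (ip mu (L f) f - lam * ip mu f f) * (ip mu (L g) g - lam * ip mu g g)"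
proof (rule quadratic_form_discriminant)
  fix t :: real
  let ?h = "\<lambda>x. complex_of_real 1 * f x + complex_of_real t * g x"
  let ?Lh = "\<lambda>x. complex_of_real 1 * L f x + complex_of_real t * L g x"
  have h: "?h \<in> D" by (intro D_lincomb f g)
  note I = D_L2[OF f] D_L2[OF g] L_L2[OF f] L_L2[OF g] D_L2[OF h] L_L2[OF h]
  have Lh: "?Lh \<in> L2 mu" using I by (intro L2_lincomb)
  have e: "ip mu k ?h = ip mu k f + t * ip mu k g" if "k \<in> L2 mu" for k
    using I that by (subst ip_commute, simp, simp, subst ip_lincomb_left) (auto simp: ip_commute[of k])
  have "ip mu (L ?h) ?h = ip mu ?Lh ?h"
    using L_lincomb[OF f g, of "complex_of_real 1" "complex_of_real t"] I Lh by (intro ip_cong_AE) auto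
  also have "\<dots> = ip mu (L f) ?h + t * ip mu (L g) ?h" using I by (subst ip_lincomb_left) auto
  also have "\<dots> = ip mu (L f) f + t * ip mu (L f) g + t * (ip mu (L g) f + t * ip mu (L g) g)"
    using I by (simp only: e)
  also have "ip mu (L g) f = ip mu (L f) g" using L_sym[OF f g] I by (simp add: ip_commute)
  finally have 1: "ip mu (L ?h) ?h = ip mu (L f) f + 2 * t * ip mu (L f) g + t\<^sup>2 * ip mu (L g) g"
    by (simp add: algebra_simps power2_eq_square)
  have "ip mu ?h ?h = ip mu f ?h + t * ip mu g ?h" using I by (subst ip_lincomb_left) auto
  also have "\<dots> = ip mu f f + t * ip mu f g + t * (ip mu g f + t * ip mu g g)"
    using I by (simp only: e)
  also have "ip mu g f = ip mu f g" using I by (simp add: ip_commute)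
  finally have 2: "ip mu ?h ?h = ip mu f f + 2 * t * ip mu f g + t\<^sup>2 * ip mu g g"
    by (simp add: algebra_simps power2_eq_square)
  show "0 \<le> (ip mu (L f) f - lam * ip mu f f) + 2 * t * (ip mu (L f) g - lam * ip mu f g) + t\<^sup>2 * (ip mu (L g) g - lam * ip mu g g)"
    using low[OF h] unfolding ip_self[OF I(5), symmetric] 1 2 by (simp add: algebra_simps)
qed

text \<open>The bottom of the numerical range belongs to the spectrum: a bounded inverse of
  \<open>L - lam\<close> together with Cauchy--Schwarz for the form of \<open>L - lam\<close> improves the bound \<open>lam\<close>.\<close>
lemma form_lower_bound:
  assumes gap: "\<And>lam. lam \<in> spectrum_op mu D L \<Longrightarrow> \<delta> \<le> lam" and "f \<in> D"
  shows "\<delta> * (L2_norm mu f)\<^sup>2 \<le> ip mu (L f) f"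
proof (rule ccontr)
  assume neg: "\<not> \<delta> * (L2_norm mu f)\<^sup>2 \<le> ip mu (L f) f"
  \<comment> \<open>The Rayleigh quotients of \<open>L\<close>. If the claim failed, their infimum
    \<open>lam\<close> would be below \<delta> and so outside the spectrum.\<close>
  define R where "R = {ip mu (L h) h / (L2_norm mu h)\<^sup>2 | h. h \<in> D \<and> L2_norm mu h > 0}"
  define lam where "lam = Inf R"
  have "L2_norm mu f \<noteq> 0" using neg L_nonneg[OF \<open>f \<in> D\<close>] by auto
  then have f0: "L2_norm mu f > 0" using L2_norm_nonneg[of mu f] by linarith
  have ne: "R \<noteq> {}" using f0 \<open>f \<in> D\<close> by (auto simp: R_def)
  have bdd: "bdd_below R" by (rule bdd_belowI[of _ 0]) (auto simp: R_def intro!: divide_nonneg_nonneg L_nonneg)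
  have low: "lam * (L2_norm mu h)\<^sup>2 \<le> ip mu (L h) h" if "h \<in> D" for h
  proof (cases "L2_norm mu h = 0")
    case False
    then have p: "L2_norm mu h > 0" using L2_norm_nonneg[of mu h] by linarith
    then have "lam \<le> ip mu (L h) h / (L2_norm mu h)\<^sup>2" 
      unfolding lam_def using that by (intro cInf_lower bdd) (auto simp: R_def)
    then show ?thesis using p by (simp add: field_simps)
  qed (use L_nonneg[OF that] in auto)
  have "lam \<le> ip mu (L f) f / (L2_norm mu f)\<^sup>2"
    unfolding lam_def using f0 \<open>f \<in> D\<close> by (intro cInf_lower bdd) (auto simp: R_def)
  also have "\<dots> < \<delta>" using neg f0 by (simp add: field_simps)
  finally have "lam \<notin> spectrum_op mu D L" using gap[of lam] by auto
  then obtain K where K: "\<And>g. g \<in> L2 mu \<Longrightarrow> \<exists>h\<in>D. (AE x in mu. L h x - complex_of_real lam * h x = g x) \<and> L2_norm mu h \<le> K * L2_norm mu g"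
    by (auto simp: spectrum_op_def)
  \<comment> \<open>The maximum with 1 guarantees a positive constant to divide by.\<close>
  define K' where "K' = max K 1"
  \<comment> \<open>Solve (L - lam) g = h. The form of \<open>L - lam\<close> between h and g is the
    squared norm of h, and on g itself it is \<open>ip mu h g\<close>, at most K' times that squared
    norm. Cauchy-Schwarz then bounds the form on h below by 1 / K' times it, so no Rayleigh quotient
    comes near its infimum.\<close>
  have "lam + 1 / K' \<le> r" if "r \<in> R" for r
  proof -
    obtain h where h: "h \<in> D" "L2_norm mu h > 0" "r = ip mu (L h) h / (L2_norm mu h)\<^sup>2"
      using \<open>r \<in> R\<close> unfolding R_def by blast
    note hI = D_L2[OF h(1)] L_L2[OF h(1)]
    obtain g where g: "g \<in> D" "AE x in mu. L g x - complex_of_real lam * g x = h x" "L2_norm mu g \<le> K * L2_norm mu h"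
      using K[OF hI(1)] by blast
    note gI = D_L2[OF g(1)] L_L2[OF g(1)]
    have eq: "ip mu (L g) k - lam * ip mu g k = ip mu h k" if "k \<in> L2 mu" for k
    proof -
      have "ip mu h k = ip mu (\<lambda>x. L g x - complex_of_real lam * g x) k"
        using hI gI g(2) that by (intro ip_cong_AE L2_intros) auto
      then show ?thesis using gI that by (simp add: ip_diff_left ip_scale_left L2_intros)
    qed
    have "ip mu (L h) g - lam * ip mu h g = ip mu (L g) h - lam * ip mu g h"
      using L_sym[OF h(1) g(1)] hI gI by (simp add: ip_commute)
    then have A: "ip mu (L h) g - lam * ip mu h g = (L2_norm mu h)\<^sup>2"
      using eq[OF hI(1)] ip_self[OF hI(1)] by simp
    have B: "ip mu (L g) g - lam * ip mu g g = ip mu h g" using eq[OF gI(1)] .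
    have "ip mu h g \<le> L2_norm mu h * L2_norm mu g" using ip_Cauchy_Schwarz[OF hI(1) gI(1)] by linarith
    also have "\<dots> \<le> L2_norm mu h * (K' * L2_norm mu h)"
      using g(3) h(2) by (intro mult_left_mono order_trans[OF g(3)] mult_right_mono) (auto simp: K'_def)
    finally have C: "ip mu h g \<le> K' * (L2_norm mu h)\<^sup>2" by (simp add: power2_eq_square algebra_simps)
    have "((L2_norm mu h)\<^sup>2)\<^sup>2 \<le> (ip mu (L h) h - lam * ip mu h h) * ip mu h g"
      using L_form_Cauchy_Schwarz[OF h(1) g(1) low] unfolding A B .
    also have "\<dots> \<le> (ip mu (L h) h - lam * ip mu h h) * (K' * (L2_norm mu h)\<^sup>2)"
      using C low[OF h(1)] by (intro mult_left_mono) (auto simp: ip_self[OF hI(1)])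
    finally have "(L2_norm mu h)\<^sup>2 * (L2_norm mu h)\<^sup>2 \<le> (L2_norm mu h)\<^sup>2 * ((ip mu (L h) h - lam * (L2_norm mu h)\<^sup>2) * K')"
      by (simp add: ip_self[OF hI(1)] power2_eq_square algebra_simps)
    then have "(L2_norm mu h)\<^sup>2 \<le> (ip mu (L h) h - lam * (L2_norm mu h)\<^sup>2) * K'"
      by (rule mult_left_le_imp_le) (use h(2) in simp)
    moreover have "ip mu (L h) h = r * (L2_norm mu h)\<^sup>2" using h(2,3) by simp
    ultimately have "(L2_norm mu h)\<^sup>2 * (1 + lam * K') \<le> (L2_norm mu h)\<^sup>2 * (r * K')" by (simp add: algebra_simps)
    then have "1 + lam * K' \<le> r * K'" by (rule mult_left_le_imp_le) (use h(2) in simp)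
    moreover have "K' > 0" by (simp add: K'_def)
    ultimately show ?thesis by (simp add: field_simps)
  qed
  then have "lam + 1 / K' \<le> lam" unfolding lam_def by (intro cInf_greatest ne) auto
  moreover have "1 / K' > 0" by (simp add: K'_def)
  ultimately show False by linarith
qed

end

subsection \<open>Orbits of the heat semigroup\<close>

locale gapped = selfadjoint +
  fixes \<delta> :: real
  assumes \<delta>_pos: "\<delta> > 0" and form_gap: "\<And>f. f \<in> D \<Longrightarrow> \<delta> * (L2_norm mu f)\<^sup>2 \<le> ip mu (L f) f"
begin

text \<open>An abstract orbit instead of \<open>P t f\<close>: the class is closed under linear
  combinations and forward shifts, so increments of orbits are orbits and inherit every estimate.
  Closure under shifts plays the part of the semigroup law.\<close>

definition sol :: "(real \<Rightarrow> 'a \<Rightarrow> complex) \<Rightarrow> bool" where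
  "sol u \<longleftrightarrow> (\<forall>t\<ge>0. u t \<in> L2 mu \<and> ((\<lambda>s. L2_norm mu (\<lambda>x. u s x - u t x)) \<longlongrightarrow> 0) (at t within {0..})) \<and>
     (\<forall>t>0. u t \<in> D \<and> l2_deriv mu u (\<lambda>x. - L (u t) x) t)"

lemma sol_L2: "sol u \<Longrightarrow> 0 \<le> t \<Longrightarrow> u t \<in> L2 mu" by (simp add: sol_def)
lemma sol_D: "sol u \<Longrightarrow> 0 < t \<Longrightarrow> u t \<in> D" by (simp add: sol_def)
lemma sol_L_L2: "sol u \<Longrightarrow> 0 < t \<Longrightarrow> L (u t) \<in> L2 mu" by (simp add: sol_def L_L2)
lemma sol_deriv: "sol u \<Longrightarrow> 0 < t \<Longrightarrow> l2_deriv mu u (\<lambda>x. - L (u t) x) t" by (simp add: sol_def)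

lemma sol_tendsto:
  assumes "sol u" "(p \<longlongrightarrow> t) F" "\<forall>\<^sub>F s in F. 0 \<le> p s" "0 \<le> t"
  shows "((\<lambda>s. L2_norm mu (\<lambda>x. u (p s) x - u t x)) \<longlongrightarrow> 0) F"
proof -
  have "continuous (at t within {0..}) (\<lambda>s. L2_norm mu (\<lambda>x. u s x - u t x))"
    using assms by (simp add: continuous_within sol_def L2_norm_def)
  from continuous_within_tendsto_compose[OF this _ assms(2)] assms(3)
  show ?thesis by (simp add: L2_norm_def)
qed

lemma sol_ip_tendsto:
  assumes "sol u" "(p \<longlongrightarrow> a) F" "\<forall>\<^sub>F s in F. 0 \<le> p s" "0 \<le> a"
    and "sol v" "(q \<longlongrightarrow> b) F" "\<forall>\<^sub>F s in F. 0 \<le> q s" "0 \<le> b"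
  shows "((\<lambda>s. ip mu (u (p s)) (v (q s))) \<longlongrightarrow> ip mu (u a) (v b)) F"
proof (intro ip_tendsto sol_tendsto assms)
  show "\<forall>\<^sub>F s in F. u (p s) \<in> L2 mu" using assms(3) by eventually_elim (simp add: sol_L2 assms)
  show "\<forall>\<^sub>F s in F. v (q s) \<in> L2 mu" using assms(7) by eventually_elim (simp add: sol_L2 assms)
qed (simp_all add: sol_L2 assms)

lemma sol_lincomb:
  assumes u: "sol u" and v: "sol v"
  shows "sol (\<lambda>t x. a * u t x + b * v t x)"
  unfolding sol_def
proof (intro conjI allI impI)
  fix t :: real assume t: "t \<ge> 0"
  show "(\<lambda>x. a * u t x + b * v t x) \<in> L2 mu" using t u v by (simp add: L2_lincomb sol_L2)
  let ?b = "\<lambda>s. cmod a * L2_norm mu (\<lambda>x. u s x - u t x) + cmod b * L2_norm mu (\<lambda>x. v s x - v t x)"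
  have ev: "\<forall>\<^sub>F s in at t within {0..}. s \<ge> 0" by (simp add: eventually_at_filter)
  have "(?b \<longlongrightarrow> cmod a * 0 + cmod b * 0) (at t within {0..})"
    using t u v ev by (intro tendsto_intros sol_tendsto) auto
  then have lim: "(?b \<longlongrightarrow> 0) (at t within {0..})" by simp
  show "((\<lambda>s. L2_norm mu (\<lambda>x. a * u s x + b * v s x - (a * u t x + b * v t x))) \<longlongrightarrow> 0) (at t within {0..})"
  proof (rule Lim_null_comparison[OF _ lim])
    show "\<forall>\<^sub>F s in at t within {0..}. norm (L2_norm mu (\<lambda>x. a * u s x + b * v s x - (a * u t x + b * v t x))) \<le> ?b s"
      using ev
    proof eventually_elim
      case (elim s)
      have "(\<lambda>x. a * u s x + b * v s x - (a * u t x + b * v t x)) = (\<lambda>x. a * (u s x - u t x) + b * (v s x - v t x))"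
        by (simp add: algebra_simps)
      moreover have "(\<lambda>x. u s x - u t x) \<in> L2 mu" "(\<lambda>x. v s x - v t x) \<in> L2 mu" 
        using u v t elim by (simp_all add: L2_diff sol_L2)
      ultimately show ?case
        using L2_norm_triangle[of "\<lambda>x. a * (u s x - u t x)" mu "\<lambda>x. b * (v s x - v t x)"]
        by (simp add: L2_scale L2_norm_scale)
    qed
  qed
next
  fix t :: real assume t: "t > 0"
  show D: "(\<lambda>x. a * u t x + b * v t x) \<in> D" using u v t by (simp add: sol_D D_lincomb)
  show "l2_deriv mu (\<lambda>t x. a * u t x + b * v t x) (\<lambda>x. - L (\<lambda>x. a * u t x + b * v t x) x) t"
  proof (rule l2_deriv_cong_AE[OF l2_deriv_lincomb[OF sol_deriv[OF u t] sol_deriv[OF v t]]])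
    show "AE x in mu. a * - L (u t) x + b * - L (v t) x = - L (\<lambda>x. a * u t x + b * v t x) x"
      using L_lincomb[OF sol_D[OF u t] sol_D[OF v t], of a b] by eventually_elim simp
    show "(\<lambda>x. - L (\<lambda>x. a * u t x + b * v t x) x) \<in> L2 mu"
      by (intro L2_minus L_L2 D)
  qed
qed

lemma sol_diff: "sol u \<Longrightarrow> sol v \<Longrightarrow> sol (\<lambda>t x. u t x - v t x)"
  using sol_lincomb[of u v 1 "-1"] by simp

lemma sol_add: "sol u \<Longrightarrow> sol v \<Longrightarrow> sol (\<lambda>t x. u t x + v t x)"
  using sol_lincomb[of u v 1 1] by simp

lemma L_diff: "f \<in> D \<Longrightarrow> g \<in> D \<Longrightarrow> AE x in mu. L (\<lambda>y. f y - g y) x = L f x - L g x"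
  using L_lincomb[of f g 1 "-1"] by simp

lemma L_add: "f \<in> D \<Longrightarrow> g \<in> D \<Longrightarrow> AE x in mu. L (\<lambda>y. f y + g y) x = L f x + L g x"
  using L_lincomb[of f g 1 1] by simp

lemma sol_shift:
  assumes u: "sol u" and r: "0 \<le> r"
  shows "sol (\<lambda>t. u (r + t))"
  unfolding sol_def
proof (intro conjI allI impI)
  fix t :: real assume t: "t \<ge> 0"
  show "u (r + t) \<in> L2 mu" using u t r by (simp add: sol_L2)
  show "((\<lambda>s. L2_norm mu (\<lambda>x. u (r + s) x - u (r + t) x)) \<longlongrightarrow> 0) (at t within {0..})"
    by (rule sol_tendsto[OF u]) (use t r in \<open>auto intro!: tendsto_intros simp: eventually_at_filter\<close>)
next
  fix t :: real assume t: "t > 0"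
  show "u (r + t) \<in> D" using u t r by (simp add: sol_D)
  show "l2_deriv mu (\<lambda>t. u (r + t)) (\<lambda>x. - L (u (r + t)) x) t"
    using l2_deriv_comp[of mu u _ r 1 t, OF _ disjI1] sol_deriv[OF u, of "r + t"] r t by simp
qed

text \<open>\<open>u (c - t)\<close> solves the backward equation, so pairings of two orbits depend only on the total time.\<close>
lemma pair_shift:
  assumes u: "sol u" and v: "sol v" and a: "0 \<le> a" "a \<le> c"
  shows "ip mu (u a) (v (c - a)) = ip mu (u 0) (v c)"
proof (cases "c = 0")
  case True then show ?thesis using a by simp
next
  case False
  then have c: "0 < c" using a by simp
  let ?F = "\<lambda>a. ip mu (u a) (v (c - a))"
  have "?F a = ?F 0"
  proof (rule DERIV_isconst2[where f = ?F, OF c])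
    show "continuous_on {0..c} ?F"
      unfolding continuous_on_def
    proof
      fix x assume "x \<in> {0..c}"
      then show "(?F \<longlongrightarrow> ?F x) (at x within {0..c})"
        by (intro sol_ip_tendsto u v) (auto intro!: tendsto_intros simp: eventually_at_filter)
    qed
    fix x assume x: "0 < x" "x < c"
    have "l2_deriv mu (\<lambda>s. v (c - s)) (L (v (c - x))) x"
      using l2_deriv_comp[of mu v "\<lambda>y. - L (v (c - x)) y" c "-1" x] sol_deriv[OF v, of "c - x"] x
      by simp
    from l2_deriv_ip[OF sol_deriv[OF u x(1)] this]
    show "(?F has_real_derivative 0) (at x)"
      using L_sym[OF sol_D[OF u x(1)] sol_D[OF v, of "c - x"]] x u v
      by (simp add: ip_minus_left sol_L2 sol_L_L2)
  qed (use a in auto)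
  then show ?thesis by simp
qed

lemma ip_sol_deriv:
  assumes "sol v" "0 < c" "g \<in> L2 mu"
  shows "((\<lambda>c. ip mu g (v c)) has_real_derivative - ip mu g (L (v c))) (at c)"
  using l2_deriv_ip[OF l2_deriv_const[OF assms(3)] sol_deriv[OF assms(1,2)]] assms
  by (simp add: ip_minus_right sol_L_L2 sol_L2 ip_def[of mu "\<lambda>x. 0"] L2_inner_def)

text \<open>Differentiate \<open>pair_shift\<close> in the total time c with a held fixed. Since
  \<open>L\<close> acts on v only, a = 0 is allowed although u 0 may lie outside the domain.\<close>

lemma pair_shift_L:
  assumes u: "sol u" and v: "sol v" and a: "0 \<le> a" "a < c"
  shows "ip mu (u a) (L (v (c - a))) = ip mu (u 0) (L (v c))"
proof -
  have 1: "((\<lambda>c. ip mu (u 0) (v c)) has_real_derivative - ip mu (u 0) (L (v c))) (at c)"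
    using u v a by (intro ip_sol_deriv) (auto simp: sol_L2)
  have "((\<lambda>c. ip mu (u a) (v (c - a))) has_real_derivative - ip mu (u a) (L (v (c - a)))) (at c)"
    using DERIV_shift[of "\<lambda>c. ip mu (u a) (v c)" "- ip mu (u a) (L (v (c - a)))" c "- a"] ip_sol_deriv[OF v, of "c - a" "u a"] u a
    by (auto simp: sol_L2)
  then have 2: "((\<lambda>c. ip mu (u 0) (v c)) has_real_derivative - ip mu (u a) (L (v (c - a)))) (at c)"
    by (rule has_field_derivative_transform_within_open[of _ _ _ "{a<..}"]) (use a u v in \<open>auto intro!: pair_shift\<close>)
  show ?thesis using DERIV_unique[OF 1 2] by simp
qed

text \<open>\<open>L (v c)\<close> is not known to lie in \<open>D\<close>, so v cannot simply be
  differentiated twice. For s near c, \<open>pair_shift_L\<close> freezes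
  \<open>L (v (c / 2))\<close> and moves the dependence on s into
  \<open>u (s - c / 2)\<close>.\<close>

lemma ip_sol_deriv2:
  assumes u: "sol u" and v: "sol v" and c: "0 < c"
  shows "((\<lambda>c. ip mu (u 0) (L (v c))) has_real_derivative - ip mu (L (u (c / 2))) (L (v (c / 2)))) (at c)"
proof -
  have d: "l2_deriv mu (\<lambda>s. u (- (c / 2) + 1 * s)) (\<lambda>x. complex_of_real 1 * (- L (u (c / 2)) x)) c"
    by (rule l2_deriv_comp) (use sol_deriv[OF u, of "c / 2"] c in auto)
  have "((\<lambda>s. ip mu (u (s - c / 2)) (L (v (c / 2)))) has_real_derivative - ip mu (L (u (c / 2))) (L (v (c / 2)))) (at c)"
    using l2_deriv_ip[OF d l2_deriv_const[OF sol_L_L2[OF v]], of "c / 2"] c u v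
    by (simp add: ip_minus_left sol_L_L2 sol_L2 ip_def[of mu _ "\<lambda>x. 0"] L2_inner_def)
  then show ?thesis
  proof (rule has_field_derivative_transform_within_open[of _ _ _ "{c/2<..}"])
    fix s assume "s \<in> {c/2<..}"
    then show "ip mu (u (s - c / 2)) (L (v (c / 2))) = ip mu (u 0) (L (v s))"
      using pair_shift_L[OF u v, of "s - c / 2" s] c by simp
  qed (use c in auto)
qed

lemma pair_self: "sol u \<Longrightarrow> 0 \<le> t \<Longrightarrow> ip mu (u 0) (u (2 * t)) = (L2_norm mu (u t))\<^sup>2"
  using pair_shift[of u u t "2 * t"] by (simp add: ip_self sol_L2)

lemma ip_sol_continuous:
  assumes "sol u" "g \<in> L2 mu"
  shows "continuous_on {0..c} (\<lambda>c. ip mu g (u c))"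
  unfolding continuous_on_def
proof
  fix x assume "x \<in> {0..c}"
  then show "((\<lambda>c. ip mu g (u c)) \<longlongrightarrow> ip mu g (u x)) (at x within {0..c})"
    using assms 
    by (intro ip_tendsto[where X = "\<lambda>_. g" and X' = g] sol_tendsto[where p = "\<lambda>c. c" and u = u]) 
       (auto simp: L2_norm_def[of mu "\<lambda>_. 0"] eventually_at_filter sol_L2)
qed

text \<open>At total time c the gap, applied to u (c / 2), is a differential inequality for c ->
  \<open>ip mu (u 0) (u c)\<close>. Integrating it up to c = 2 * t gives the square of the
  claim.\<close>

lemma sol_decay0:
  assumes u: "sol u" and t: "0 \<le> t"
  shows "L2_norm mu (u t) \<le> exp (- \<delta> * t) * L2_norm mu (u 0)"
proof -
  let ?G = "\<lambda>c. ip mu (u 0) (u c) * exp (\<delta> * c)"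
  have "?G (2 * t) \<le> ?G 0"
  proof (rule DERIV_nonpos_imp_decreasing_open[where f = ?G])
    show "continuous_on {0..2 * t} ?G"
      using u by (intro continuous_intros ip_sol_continuous) (auto simp: sol_L2)
    fix c assume c: "0 < c" "c < 2 * t"
    have "ip mu (u 0) (u c) = (L2_norm mu (u (c / 2)))\<^sup>2" using pair_self[OF u, of "c / 2"] c by simp
    moreover have "ip mu (u 0) (L (u c)) = ip mu (u (c / 2)) (L (u (c / 2)))"
      using pair_shift_L[OF u u, of "c / 2" c] c by simp
    ultimately have "\<delta> * ip mu (u 0) (u c) \<le> ip mu (u 0) (L (u c))"
      using form_gap[OF sol_D[OF u], of "c / 2"] c u by (simp add: ip_commute sol_L2 sol_L_L2)
    then have "(\<delta> * ip mu (u 0) (u c)) * exp (\<delta> * c) \<le> ip mu (u 0) (L (u c)) * exp (\<delta> * c)"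
      by (intro mult_right_mono) auto
    then have "- ip mu (u 0) (L (u c)) * exp (\<delta> * c) + exp (\<delta> * c) * \<delta> * ip mu (u 0) (u c) \<le> 0"
      by (simp add: algebra_simps)
    moreover have "(?G has_real_derivative (- ip mu (u 0) (L (u c)) * exp (\<delta> * c) + exp (\<delta> * c) * \<delta> * ip mu (u 0) (u c))) (at c)"
      using ip_sol_deriv[OF u c(1) sol_L2[OF u order_refl]]
      by (auto intro!: derivative_eq_intros)
    ultimately show "\<exists>y. (?G has_real_derivative y) (at c) \<and> y \<le> 0" by blast
  qed (use t in auto)
  then have "(L2_norm mu (u t))\<^sup>2 * exp (\<delta> * (2 * t)) \<le> (L2_norm mu (u 0))\<^sup>2"
    using pair_self[OF u t] pair_self[OF u order_refl] by simp
  also have "exp (\<delta> * (2 * t)) = (exp (\<delta> * t))\<^sup>2" by (simp add: exp_double[symmetric] algebra_simps)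
  finally have "(L2_norm mu (u t) * exp (\<delta> * t))\<^sup>2 \<le> (L2_norm mu (u 0))\<^sup>2" by (simp add: power_mult_distrib)
  then have "L2_norm mu (u t) * exp (\<delta> * t) \<le> L2_norm mu (u 0)" by (rule power2_le_imp_le) simp
  then show ?thesis by (simp add: exp_minus field_simps)
qed

lemma sol_decay:
  assumes u: "sol u" and t: "0 \<le> s" "s \<le> t"
  shows "L2_norm mu (u t) \<le> exp (- \<delta> * (t - s)) * L2_norm mu (u s)"
  using sol_decay0[OF sol_shift[OF u t(1)], of "t - s"] t by simp

lemma sol_mono:
  assumes u: "sol u" and t: "0 \<le> s" "s \<le> t"
  shows "L2_norm mu (u t) \<le> L2_norm mu (u s)"
proof -
  have "exp (- \<delta> * (t - s)) * L2_norm mu (u s) \<le> 1 * L2_norm mu (u s)"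
    using \<delta>_pos t by (intro mult_right_mono) auto
  then show ?thesis using sol_decay[OF assms] by linarith
qed

lemma sol_unique:
  assumes u: "sol u" and v: "sol v" and 0: "AE x in mu. u 0 x = v 0 x" and t: "0 \<le> t"
  shows "AE x in mu. u t x = v t x"
proof -
  have w: "sol (\<lambda>t x. u t x - v t x)" by (rule sol_diff[OF u v])
  have "L2_norm mu (\<lambda>x. u 0 x - v 0 x) = L2_norm mu (\<lambda>x. 0)"
    using 0 by (intro L2_norm_cong_AE) auto
  then have "L2_norm mu (\<lambda>x. u t x - v t x) \<le> 0"
    using sol_mono[OF w order_refl t] by (simp add: L2_norm_def)
  then have "L2_norm mu (\<lambda>x. u t x - v t x) = 0" using L2_norm_nonneg by (metis order_antisym)
  from L2_norm_eq_0_imp_AE[OF sol_L2[OF w t] this] show ?thesis by simp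
qed

lemma sol_unique_L:
  assumes u: "sol u" and v: "sol v" and 0: "AE x in mu. u 0 x = v 0 x" and t: "0 < t"
  shows "AE x in mu. L (u t) x = L (v t) x"
  using sol_unique[OF u v 0, of t] t u v by (intro L_cong_AE) (auto simp: sol_D sol_L2)

text \<open>Lets norm inequalities for increments pass to \<open>L (u t)\<close>. The limit is
  one-sided because orbits are shifted forward only.\<close>

lemma sol_quotient:
  assumes u: "sol u" and t: "0 < t"
  shows "((\<lambda>h. L2_norm mu (\<lambda>x. u (t + h) x - u t x) / h) \<longlongrightarrow> L2_norm mu (L (u t))) (at_right 0)"
proof -
  let ?q = "\<lambda>s x. (u s x - u t x) / complex_of_real (s - t) - - L (u t) x"
  have "filterlim (\<lambda>h. t + h) (at t) (at_right 0)"
    by (auto simp: filterlim_at eventually_at_filter intro!: tendsto_eq_intros)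
  then have lim: "((\<lambda>h. L2_norm mu (?q (t + h))) \<longlongrightarrow> 0) (at_right 0)"
    using sol_deriv[OF u t] filterlim_compose unfolding l2_deriv_def by blast
  have ev: "\<forall>\<^sub>F h in at_right 0. (h::real) > 0" by (simp add: eventually_at_filter)
  have "((\<lambda>h. L2_norm mu (\<lambda>x. u (t + h) x - u t x) / h - L2_norm mu (L (u t))) \<longlongrightarrow> 0) (at_right 0)"
  proof (rule Lim_null_comparison[OF _ lim])
    show "\<forall>\<^sub>F h in at_right 0. norm (L2_norm mu (\<lambda>x. u (t + h) x - u t x) / h - L2_norm mu (L (u t))) \<le> L2_norm mu (?q (t + h))"
      using ev
    proof eventually_elim
      case (elim h)
      have I: "(\<lambda>x. u (t + h) x - u t x) \<in> L2 mu" "(\<lambda>x. (u (t + h) x - u t x) / complex_of_real h) \<in> L2 mu" "(\<lambda>x. - L (u t) x) \<in> L2 mu"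
        using elim t u by (auto intro!: L2_divide L2_diff L2_minus simp: sol_L2 sol_L_L2)
      show ?case
        using L2_norm_abs_diff[OF I(2,3)] L2_norm_divide[OF I(1), of "complex_of_real h"] elim
        by (simp add: L2_norm_minus)
    qed
  qed
  then show ?thesis by (simp add: LIM_zero_iff)
qed

text \<open>Increments of u are orbits, so their norms decrease; divide by h and let h tend to
  0.\<close>

lemma sol_L_mono:
  assumes u: "sol u" and t: "0 < s" "s \<le> t"
  shows "L2_norm mu (L (u t)) \<le> L2_norm mu (L (u s))"
proof (rule tendsto_le[OF _ sol_quotient[OF u] sol_quotient[OF u]])
  have ev: "\<forall>\<^sub>F h in at_right 0. (h::real) > 0" by (simp add: eventually_at_filter)
  then show "\<forall>\<^sub>F h in at_right 0. L2_norm mu (\<lambda>x. u (t + h) x - u t x) / h \<le> L2_norm mu (\<lambda>x. u (s + h) x - u s x) / h"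
  proof eventually_elim
    case (elim h)
    have "sol (\<lambda>t x. u (h + t) x - u t x)"
      using elim u by (intro sol_diff sol_shift) auto
    from sol_mono[OF this, of s t] t elim show ?case by (simp add: divide_right_mono add.commute)
  qed
qed (use t in auto)

text \<open>With \<open>\<Psi> c = ip (u 0) (u c)\<close>, the second derivative \<open>\<Psi>'' c = \<parallel>L (u (c / 2))\<parallel>\<^sup>2\<close> is non-increasing, so
  Taylor's formula at \<open>c = 2 t\<close> bounds \<open>\<Psi>'' c\<close> by \<open>2 \<Psi> 0 / c\<^sup>2\<close>.\<close>
lemma sol_L_bound:
  assumes u: "sol u" and t: "0 < t"
  shows "t * L2_norm mu (L (u t)) \<le> L2_norm mu (u 0)"
proof -
  define M where "M = (L2_norm mu (L (u t)))\<^sup>2"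
  let ?c = "2 * t"
  let ?P = "\<lambda>x. ip mu (u 0) (u x)"
  let ?P' = "\<lambda>x. - ip mu (u 0) (L (u x))"
  \<comment> \<open>Subtracts the parabola with vertex 2 * t and second derivative \<open>M\<close>,
    a lower bound for the second derivative of \<open>?P\<close> on (0, 2 * t). It remains to see
    that the difference decreases.\<close>
  let ?H = "\<lambda>x. ?P x - M * (?c - x)\<^sup>2 / 2"
  have "?H ?c \<le> ?H 0"
  proof (rule DERIV_nonpos_imp_decreasing_open[where f = ?H])
    show "continuous_on {0..?c} ?H"
      using u by (intro continuous_intros ip_sol_continuous) (auto simp: sol_L2)
    fix x assume x: "0 < x" "x < ?c"
    have "\<exists>z. z > x \<and> z < ?c \<and> ?P' ?c - ?P' x = (?c - x) * ip mu (L (u (z / 2))) (L (u (z / 2)))"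
    proof (rule MVT2[OF x(2)])
      fix z assume "x \<le> z" "z \<le> ?c"
      then show "(?P' has_real_derivative ip mu (L (u (z / 2))) (L (u (z / 2)))) (at z)"
        using ip_sol_deriv2[OF u u, of z] x by (auto intro!: derivative_eq_intros)
    qed
    then obtain z where z: "z > x" "z < ?c" "?P' ?c - ?P' x = (?c - x) * ip mu (L (u (z / 2))) (L (u (z / 2)))" by blast
    have "M \<le> ip mu (L (u (z / 2))) (L (u (z / 2)))"
      using z x u sol_L_mono[OF u, of "z / 2" t] by (simp add: ip_self sol_L_L2 M_def power_mono)
    then have "(?c - x) * M \<le> ?P' ?c - ?P' x" unfolding z(3) using x by (intro mult_left_mono) auto
    \<comment> \<open>The first-order term at the right end has the favourable sign because
      \<open>L\<close> is non-negative.\<close>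
    moreover have "?P' ?c \<le> 0"
      using pair_shift_L[OF u u, of t ?c] L_nonneg[OF sol_D[OF u t]] t u by (simp add: ip_commute sol_L2 sol_L_L2)
    ultimately have "?P' x + M * (?c - x) \<le> 0" by (simp add: algebra_simps)
    moreover have "(?H has_real_derivative (?P' x + M * (?c - x))) (at x)"
      using ip_sol_deriv[OF u x(1) sol_L2[OF u order_refl]]
      by (auto intro!: derivative_eq_intros simp: field_simps)
    ultimately show "\<exists>y. (?H has_real_derivative y) (at x) \<and> y \<le> 0" by blast
  qed (use t in auto)
  then have "(L2_norm mu (u t))\<^sup>2 + 2 * (t\<^sup>2 * M) \<le> (L2_norm mu (u 0))\<^sup>2"
    using pair_self[OF u, of t] pair_self[OF u order_refl] t
    by (simp add: power_mult_distrib algebra_simps)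
  then have "2 * (t\<^sup>2 * M) \<le> (L2_norm mu (u 0))\<^sup>2" using zero_le_power2[of "L2_norm mu (u t)"] by linarith
  moreover have "0 \<le> t\<^sup>2 * M" by (simp add: M_def)
  ultimately have "t\<^sup>2 * M \<le> (L2_norm mu (u 0))\<^sup>2" by linarith
  then have "(t * L2_norm mu (L (u t)))\<^sup>2 \<le> (L2_norm mu (u 0))\<^sup>2"
    by (simp add: M_def power_mult_distrib)
  then show ?thesis by (rule power2_le_imp_le) simp
qed

lemma sol_L_bound':
  assumes u: "sol u" and t: "0 \<le> s" "s < t"
  shows "L2_norm mu (L (u t)) \<le> L2_norm mu (u s) / (t - s)"
  using sol_L_bound[OF sol_shift[OF u t(1)], of "t - s"] t by (simp add: field_simps)

text \<open>The mean value theorem fails for curves in \<open>L^2\<close>; tested against a fixed g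
  it holds, with an intermediate time depending on g.\<close>

lemma sol_MVT:
  assumes u: "sol u" and t: "0 < t" "0 < h" and g: "g \<in> L2 mu"
  obtains z where "t < z" "z < t + h" "ip mu (u (t + h)) g - ip mu (u t) g = - h * ip mu (L (u z)) g"
proof -
  have "\<exists>z. z > t \<and> z < t + h \<and> ip mu g (u (t + h)) - ip mu g (u t) = (t + h - t) * (- ip mu g (L (u z)))"
    using t u g by (intro MVT2 ip_sol_deriv) auto
  then obtain z where z: "z > t" "z < t + h" "ip mu g (u (t + h)) - ip mu g (u t) = (t + h - t) * (- ip mu g (L (u z)))"
    by blast
  show ?thesis
    by (rule that[OF z(1,2)]) (use z t u g in \<open>simp add: ip_commute[of _ mu g] sol_L2 sol_L_L2\<close>)
qed

text \<open>Test the increment against itself; \<open>sol_L_mono\<close> removes the unknown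
  intermediate time.\<close>

lemma sol_increment:
  assumes u: "sol u" and t: "0 < t" "0 \<le> h"
  shows "L2_norm mu (\<lambda>x. u (t + h) x - u t x) \<le> h * L2_norm mu (L (u t))"
proof (cases "h = 0 \<or> L2_norm mu (\<lambda>x. u (t + h) x - u t x) = 0")
  case True then show ?thesis using t by (auto simp: L2_norm_def)
next
  case False
  let ?g = "\<lambda>x. u (t + h) x - u t x"
  have g: "?g \<in> L2 mu" using u t by (simp add: L2_diff sol_L2)
  have N: "L2_norm mu ?g > 0" using False L2_norm_nonneg[of mu ?g] by linarith
  obtain z where z: "t < z" "z < t + h" "ip mu (u (t + h)) ?g - ip mu (u t) ?g = - h * ip mu (L (u z)) ?g"
    using sol_MVT[OF u t(1) _ g, of h] t False by auto
  have "(L2_norm mu ?g)\<^sup>2 = ip mu (u (t + h)) ?g - ip mu (u t) ?g"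
    using u t g by (simp add: ip_self[OF g, symmetric] ip_diff_left sol_L2)
  also have "\<dots> \<le> h * (L2_norm mu (L (u z)) * L2_norm mu ?g)"
    unfolding z(3) using ip_Cauchy_Schwarz[OF sol_L_L2[OF u, of z] g] z t mult_left_mono[of "- ip mu (L (u z)) ?g" _ h] by auto
  also have "\<dots> \<le> h * (L2_norm mu (L (u t)) * L2_norm mu ?g)"
    using sol_L_mono[OF u t(1), of z] z t by (intro mult_left_mono mult_right_mono) auto
  finally have "L2_norm mu ?g * L2_norm mu ?g \<le> (h * L2_norm mu (L (u t))) * L2_norm mu ?g"
    by (simp add: power2_eq_square algebra_simps)
  then show ?thesis using N by (simp only: mult_le_cancel_right_pos)
qed

text \<open>The increment \<open>u (\<cdot> + h) - u\<close> is itself an orbit, so no second power of \<open>L\<close> is needed.\<close>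
lemma sol_L_Lipschitz:
  assumes u: "sol u" and t: "0 < t" "0 \<le> h"
  shows "L2_norm mu (\<lambda>x. L (u (t + h)) x - L (u t) x) \<le> 8 * h / t\<^sup>2 * L2_norm mu (u (t / 4))"
proof -
  let ?w = "\<lambda>s x. u (h + s) x - u s x"
  have w: "sol ?w" using u t by (intro sol_diff sol_shift)
  have "L2_norm mu (\<lambda>x. L (u (t + h)) x - L (u t) x) = L2_norm mu (L (?w t))"
    using L_diff[OF sol_D[OF u, of "h + t"] sol_D[OF u t(1)]] t
    by (intro L2_norm_cong_AE) (auto simp: add.commute)
  \<comment> \<open>Time is halved twice: one bound on \<open>L\<close> costs 2 / t between t / 2
    and t, the other 4 / t between t / 4 and t / 2, which makes 8 / t^2. Keeping the norm at t / 4
    preserves the exponential decay accumulated by then.\<close>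
  also have "\<dots> \<le> L2_norm mu (?w (t / 2)) / (t - t / 2)"
    using t by (intro sol_L_bound'[OF w]) auto
  also have "\<dots> \<le> (h * L2_norm mu (L (u (t / 2)))) / (t - t / 2)"
    using sol_increment[OF u, of "t / 2" h] t by (intro divide_right_mono) (auto simp: add.commute)
  also have "\<dots> \<le> (h * (L2_norm mu (u (t / 4)) / (t / 2 - t / 4))) / (t - t / 2)"
    using t by (intro divide_right_mono mult_left_mono sol_L_bound'[OF u]) auto
  also have "\<dots> = 8 * h / t\<^sup>2 * L2_norm mu (u (t / 4))"
    using t by (simp add: field_simps power2_eq_square)
  finally show ?thesis .
qed

lemma sol_L_tendsto:
  assumes u: "sol u" and t: "0 < t"
  shows "((\<lambda>s. L2_norm mu (\<lambda>x. L (u s) x - L (u t) x)) \<longlongrightarrow> 0) (at t)"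
proof (rule Lim_null_comparison)
  \<comment> \<open>The Lipschitz constant valid from t / 2 on: 8 / (t / 2)^2 = 32 / t^2.\<close>
  let ?K = "32 / t\<^sup>2 * L2_norm mu (u 0)"
  have "((\<lambda>s. \<bar>s - t\<bar> * ?K) \<longlongrightarrow> \<bar>t - t\<bar> * ?K) (at t)" by (intro tendsto_intros)
  then show "((\<lambda>s. \<bar>s - t\<bar> * ?K) \<longlongrightarrow> 0) (at t)" by simp
  have *: "L2_norm mu (\<lambda>x. L (u b) x - L (u a) x) \<le> (b - a) * ?K" if "t / 2 \<le> a" "a \<le> b" for a b
  proof -
    have "L2_norm mu (\<lambda>x. L (u b) x - L (u a) x) \<le> 8 * (b - a) / a\<^sup>2 * L2_norm mu (u (a / 4))"
      using sol_L_Lipschitz[OF u, of a "b - a"] that t by simp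
    also have "\<dots> \<le> 8 * (b - a) / (t / 2)\<^sup>2 * L2_norm mu (u 0)"
      using that t u by (intro mult_mono divide_left_mono power_mono sol_mono) auto
    finally show ?thesis by (simp add: field_simps)
  qed
  have "\<forall>\<^sub>F s in at t. s \<in> {t / 2<..}" using t by (intro eventually_at_in_open') auto
  then show "\<forall>\<^sub>F s in at t. norm (L2_norm mu (\<lambda>x. L (u s) x - L (u t) x)) \<le> \<bar>s - t\<bar> * ?K"
  proof eventually_elim
    case (elim s)
    have "L2_norm mu (\<lambda>x. L (u s) x - L (u t) x) \<le> \<bar>s - t\<bar> * ?K"
    proof (cases "s \<le> t")
      case True
      then show ?thesis using *[of s t] elim L2_norm_diff_commute[of mu "L (u s)" "L (u t)"] by auto
    next
      case False
      then show ?thesis using *[of t s] t by auto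
    qed
    then show ?case by simp
  qed
qed

text \<open>Landau's interpolation with a free step h. At an intermediate time z the derivative,
  tested against its own localization \<open>?g\<close>, equals a difference quotient, which only
  sees u on \<open>A\<close>; replacing z by t is paid for globally through
  \<open>sol_L_Lipschitz\<close>.\<close>

lemma sol_local_derivative:
  assumes u: "sol u" and t: "0 < t" "0 < h" and A: "A \<in> sets mu"
  shows "L2_norm mu (\<lambda>x. indicator A x * L (u t) x) \<le>
     (L2_norm mu (\<lambda>x. indicator A x * u (t + h) x) + L2_norm mu (\<lambda>x. indicator A x * u t x)) / h
     + 8 * h / t\<^sup>2 * L2_norm mu (u (t / 4))"
proof (cases "L2_norm mu (\<lambda>x. indicator A x * L (u t) x) = 0")
  case True then show ?thesis using t by simp
next
  case False
  let ?g = "\<lambda>x. indicator A x * L (u t) x"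
  let ?N = "\<lambda>s. L2_norm mu (\<lambda>x. indicator A x * u s x)"
  note LU = sol_L_L2[OF u t(1)]
  have g: "?g \<in> L2 mu" using A LU by (simp add: L2_indicator)
  have N: "L2_norm mu ?g > 0" using False L2_norm_nonneg[of mu ?g] by linarith
  have ipA: "ip mu f ?g = ip mu (\<lambda>x. indicator A x * f x) ?g" if "f \<in> L2 mu" for f
    using that g A by (simp add: ip_eq L2_indicator) (auto intro!: Bochner_Integration.integral_cong simp: indicator_def)
  have ub: "\<bar>ip mu (u s) ?g\<bar> \<le> ?N s * L2_norm mu ?g" if "0 < s" for s
    using ip_Cauchy_Schwarz[of "\<lambda>x. indicator A x * u s x" mu ?g] ipA[of "u s"] that u A g
    by (simp add: sol_L2 L2_indicator)
  obtain z where z: "t < z" "z < t + h" "ip mu (u (t + h)) ?g - ip mu (u t) ?g = - h * ip mu (L (u z)) ?g"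
    using sol_MVT[OF u t g] .
  note LZ = sol_L_L2[OF u, of z]
  let ?d = "\<lambda>x. L (u z) x - L (u t) x"
  have d: "?d \<in> L2 mu" using LU LZ z t by (simp add: L2_diff)
  have "(L2_norm mu ?g)\<^sup>2 = ip mu (L (u t)) ?g" using ipA[OF LU] by (simp add: ip_self[OF g])
  also have "\<dots> = ip mu (L (u z)) ?g - ip mu ?d ?g"
    using LU LZ g z t by (simp add: ip_diff_left)
  finally have 1: "(L2_norm mu ?g)\<^sup>2 = ip mu (L (u z)) ?g - ip mu ?d ?g" .
  have "ip mu (L (u z)) ?g = (ip mu (u t) ?g - ip mu (u (t + h)) ?g) / h" using z t by (simp add: field_simps)
  also have "\<dots> \<le> ((?N (t + h) + ?N t) * L2_norm mu ?g) / h"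
    using ub[of t] ub[of "t + h"] t by (intro divide_right_mono) (auto simp: algebra_simps)
  finally have 2: "ip mu (L (u z)) ?g \<le> ((?N (t + h) + ?N t) * L2_norm mu ?g) / h" .
  have "- ip mu ?d ?g \<le> 8 * h / t\<^sup>2 * L2_norm mu (u (t / 4)) * L2_norm mu ?g"
  proof -
    have "- ip mu ?d ?g \<le> L2_norm mu ?d * L2_norm mu ?g" using ip_Cauchy_Schwarz[OF d g] by linarith
    also have "L2_norm mu ?d \<le> 8 * (z - t) / t\<^sup>2 * L2_norm mu (u (t / 4))"
      using sol_L_Lipschitz[OF u t(1), of "z - t"] z by simp
    also have "\<dots> \<le> 8 * h / t\<^sup>2 * L2_norm mu (u (t / 4))"
      using z t by (intro mult_right_mono divide_right_mono) auto
    finally show ?thesis by (simp add: mult_right_mono)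
  qed
  with 1 2 have "L2_norm mu ?g * L2_norm mu ?g \<le> ((?N (t + h) + ?N t) / h + 8 * h / t\<^sup>2 * L2_norm mu (u (t / 4))) * L2_norm mu ?g"
    by (simp add: power2_eq_square algebra_simps)
  then show ?thesis using N by (simp only: mult_le_cancel_right_pos)
qed

end

subsection \<open>The reproducing formula\<close>

context gapped
begin

lemma ip_L_L_continuous:
  assumes u: "sol u" and v: "sol v"
  shows "continuous_on {0<..} (\<lambda>s. ip mu (L (u s)) (L (v s)))"
  unfolding continuous_on_def
proof
  fix t :: real assume t: "t \<in> {0<..}"
  have ev: "\<forall>\<^sub>F s in at t. s \<in> {0<..}" using t by (intro eventually_at_in_open') auto
  have "((\<lambda>s. ip mu (L (u s)) (L (v s))) \<longlongrightarrow> ip mu (L (u t)) (L (v t))) (at t)"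
  proof (rule ip_tendsto)
    show "\<forall>\<^sub>F s in at t. L (u s) \<in> L2 mu" using ev by eventually_elim (simp add: sol_L_L2 u)
    show "\<forall>\<^sub>F s in at t. L (v s) \<in> L2 mu" using ev by eventually_elim (simp add: sol_L_L2 v)
  qed (use t u v in \<open>auto intro: sol_L_tendsto sol_L_L2\<close>)
  then show "((\<lambda>s. ip mu (L (u s)) (L (v s))) \<longlongrightarrow> ip mu (L (u t)) (L (v t))) (at t within {0<..})"
    by (rule tendsto_within_subset) simp
qed

lemma pair_shift_L_half:
  assumes "sol u" "sol v" "0 < s"
  shows "ip mu (u 0) (L (v (2 * s))) = ip mu (u s) (L (v s))"
  using pair_shift_L[OF assms(1,2), of s "2 * s"] assms by simp

text \<open>With \<open>\<Phi> c = ip (u 0) (v c)\<close> this is \<open>\<Phi> (2 s) - 2 s \<Phi>' (2 s)\<close>, a primitive of \<open>- 4 s \<Phi>'' (2 s)\<close>.\<close>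
definition primitive :: "(real \<Rightarrow> 'a \<Rightarrow> complex) \<Rightarrow> (real \<Rightarrow> 'a \<Rightarrow> complex) \<Rightarrow> real \<Rightarrow> real" where
  "primitive u v s = ip mu (u 0) (v (2 * s)) + 2 * s * ip mu (u 0) (L (v (2 * s)))"

lemma primitive_deriv:
  assumes u: "sol u" and v: "sol v" and s: "0 < s"
  shows "(primitive u v has_real_derivative - 4 * s * ip mu (L (u s)) (L (v s))) (at s)"
proof -
  have 1: "((\<lambda>c. ip mu (u 0) (v c)) has_real_derivative - ip mu (u 0) (L (v (2 * s)))) (at (2 * s))"
    using u s by (intro ip_sol_deriv v) (auto simp: sol_L2)
  have 2: "((\<lambda>c. ip mu (u 0) (L (v c))) has_real_derivative - ip mu (L (u s)) (L (v s))) (at (2 * s))"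
    using ip_sol_deriv2[OF u v, of "2 * s"] s by simp
  have 3: "((\<lambda>s. 2 * s) has_real_derivative 2) (at s)" by (auto intro!: derivative_eq_intros)
  have "((\<lambda>s. ip mu (u 0) (v (2 * s)) + 2 * s * ip mu (u 0) (L (v (2 * s)))) has_real_derivative - 4 * s * ip mu (L (u s)) (L (v s))) (at s)"
    using DERIV_chain2[OF 1 3] DERIV_chain2[OF 2 3]
    by (auto intro!: derivative_eq_intros simp: algebra_simps)
  moreover have "primitive u v = (\<lambda>s. ip mu (u 0) (v (2 * s)) + 2 * s * ip mu (u 0) (L (v (2 * s))))"
    by (simp add: primitive_def fun_eq_iff)
  ultimately show ?thesis by simp
qed

text \<open>c -> \<open>ip mu (u 0) (L (u c))\<close> is minus the derivative of
  \<open>ip mu (u 0) (u c)\<close> and is non-increasing, so s times its value at 2 * s is at most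
  the drop over [s, 2 * s]. That drop vanishes as s tends to 0 even when u 0 is outside the
  domain.\<close>

lemma energy_bound:
  assumes u: "sol u" and s: "0 < s"
  shows "s * ip mu (L (u s)) (u s) \<le> ip mu (u 0) (u s) - ip mu (u 0) (u (2 * s))"
proof -
  have "\<exists>z. z > s \<and> z < 2 * s \<and> ip mu (u 0) (u (2 * s)) - ip mu (u 0) (u s) = (2 * s - s) * - ip mu (u 0) (L (u z))"
    using s u by (intro MVT2 ip_sol_deriv) (auto simp: sol_L2)
  then obtain z where z: "z > s" "z < 2 * s" "ip mu (u 0) (u (2 * s)) - ip mu (u 0) (u s) = (2 * s - s) * - ip mu (u 0) (L (u z))"
    by blast
  have "ip mu (u 0) (L (u z)) \<ge> ip mu (u 0) (L (u (2 * s)))"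
  proof (rule DERIV_nonpos_imp_nonincreasing[where f = "\<lambda>c. ip mu (u 0) (L (u c))"])
    fix x assume "z \<le> x" "x \<le> 2 * s"
    then have "0 < x" using z s by simp
    have "- ip mu (L (u (x / 2))) (L (u (x / 2))) \<le> 0" using ip_self[OF sol_L_L2[OF u], of "x / 2"] \<open>0 < x\<close> by simp
    with ip_sol_deriv2[OF u u \<open>0 < x\<close>]
    show "\<exists>y. ((\<lambda>c. ip mu (u 0) (L (u c))) has_real_derivative y) (at x) \<and> y \<le> 0" by blast
  qed (use z in auto)
  then have "s * ip mu (u 0) (L (u (2 * s))) \<le> s * ip mu (u 0) (L (u z))" using s by simp
  also have "s * ip mu (u 0) (L (u z)) = ip mu (u 0) (u s) - ip mu (u 0) (u (2 * s))" using z(3) by simp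
  also have "ip mu (u 0) (L (u (2 * s))) = ip mu (L (u s)) (u s)"
    using pair_shift_L_half[OF u u s] s u by (simp add: ip_commute sol_L2 sol_L_L2)
  finally show ?thesis .
qed

text \<open>\<open>sol_L_bound\<close> only keeps the second term of \<open>primitive\<close>
  bounded. Splitting the time evenly and using Cauchy-Schwarz for the form of \<open>L\<close>
  reduces it to the energies of u and v, which tend to 0 by \<open>energy_bound\<close>.\<close>

lemma primitive_at_0:
  assumes u: "sol u" and v: "sol v"
  shows "(primitive u v \<longlongrightarrow> ip mu (u 0) (v 0)) (at_right 0)"
proof -
  have ev: "\<forall>\<^sub>F s in at_right 0. (s::real) > 0" by (simp add: eventually_at_filter)
  have T: "((\<lambda>s. ip mu (u 0) (v (c * s))) \<longlongrightarrow> ip mu (u 0) (v 0)) (at_right 0)" if "sol u" "sol v" "c > 0" for c u v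
  proof -
    have "((\<lambda>s. ip mu (u 0) (v (c * s))) \<longlongrightarrow> ip mu (u 0) (v (c * 0))) (at_right 0)"
      by (intro sol_ip_tendsto[where p = "\<lambda>_. 0"] tendsto_intros that) (use that in \<open>auto simp: eventually_at_filter\<close>)
    then show ?thesis by simp
  qed
  have E: "((\<lambda>s. s * ip mu (L (w s)) (w s)) \<longlongrightarrow> 0) (at_right 0)" if w: "sol w" for w
  proof (rule tendsto_sandwich[where f = "\<lambda>_. 0" and h = "\<lambda>s. ip mu (w 0) (w s) - ip mu (w 0) (w (2 * s))"])
    have "((\<lambda>s. ip mu (w 0) (w (1 * s)) - ip mu (w 0) (w (2 * s))) \<longlongrightarrow> ip mu (w 0) (w 0) - ip mu (w 0) (w 0)) (at_right 0)"
      by (intro tendsto_diff T w) auto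
    then show "((\<lambda>s. ip mu (w 0) (w s) - ip mu (w 0) (w (2 * s))) \<longlongrightarrow> 0) (at_right 0)" by simp
    show "\<forall>\<^sub>F s in at_right 0. 0 \<le> s * ip mu (L (w s)) (w s)"
      using ev by eventually_elim (simp add: L_nonneg sol_D w)
    show "\<forall>\<^sub>F s in at_right 0. s * ip mu (L (w s)) (w s) \<le> ip mu (w 0) (w s) - ip mu (w 0) (w (2 * s))"
      using ev by eventually_elim (intro energy_bound w)
  qed simp
  have "((\<lambda>s. 2 * s * ip mu (u 0) (L (v (2 * s)))) \<longlongrightarrow> 0) (at_right 0)"
  proof (rule Lim_null_comparison)
    let ?b = "\<lambda>s. sqrt (4 * (s * ip mu (L (v s)) (v s)) * (s * ip mu (L (u s)) (u s)))"
    have "(?b \<longlongrightarrow> sqrt (4 * 0 * 0)) (at_right 0)" by (intro tendsto_intros E u v)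
    then show "(?b \<longlongrightarrow> 0) (at_right 0)" by simp
    show "\<forall>\<^sub>F s in at_right 0. norm (2 * s * ip mu (u 0) (L (v (2 * s)))) \<le> ?b s"
      using ev
    proof eventually_elim
      case (elim s)
      have "(ip mu (L (v s)) (u s))\<^sup>2 \<le> ip mu (L (v s)) (v s) * ip mu (L (u s)) (u s)"
        using L_form_Cauchy_Schwarz[of "v s" "u s" 0] elim u v by (simp add: sol_D L_nonneg)
      then have "4 * s\<^sup>2 * (ip mu (L (v s)) (u s))\<^sup>2 \<le> 4 * s\<^sup>2 * (ip mu (L (v s)) (v s) * ip mu (L (u s)) (u s))"
        by (intro mult_left_mono) auto
      then have "(2 * s * ip mu (u 0) (L (v (2 * s))))\<^sup>2 \<le> 4 * (s * ip mu (L (v s)) (v s)) * (s * ip mu (L (u s)) (u s))"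
        using pair_shift_L_half[OF u v elim] elim u v
        by (simp add: ip_commute[of "u s"] sol_L2 sol_L_L2 power_mult_distrib algebra_simps power2_eq_square[of s])
      then show ?case by (metis real_norm_def real_sqrt_abs real_sqrt_le_mono)
    qed
  qed
  from tendsto_add[OF T[OF u v, of 2] this]
  show ?thesis by (simp add: primitive_def[abs_def])
qed

text \<open>The gap makes u decay exponentially, while \<open>sol_L_bound\<close> for v absorbs the
  factor s.\<close>

lemma primitive_at_top:
  assumes u: "sol u" and v: "sol v"
  shows "(primitive u v \<longlongrightarrow> 0) at_top"
proof (rule Lim_null_comparison)
  let ?N = "L2_norm mu (u 0) * L2_norm mu (v 0)"
  have "filterlim (\<lambda>s. - \<delta> * s) at_bot at_top"
    using \<delta>_pos by (intro filterlim_tendsto_neg_mult_at_bot[OF tendsto_const] filterlim_ident) auto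
  then have "((\<lambda>s. exp (- \<delta> * s)) \<longlongrightarrow> 0) at_top" by (rule filterlim_compose[OF exp_at_bot])
  \<comment> \<open>3 = 1 + 2: one for the plain pairing and two for the term with the factor 2 *
    s.\<close>
  then have "((\<lambda>s. exp (- \<delta> * s) * (3 * ?N)) \<longlongrightarrow> 0 * (3 * ?N)) at_top" by (intro tendsto_intros)
  then show "((\<lambda>s. exp (- \<delta> * s) * (3 * ?N)) \<longlongrightarrow> 0) at_top" by simp
  show "\<forall>\<^sub>F s in at_top. norm (primitive u v s) \<le> exp (- \<delta> * s) * (3 * ?N)"
    using eventually_gt_at_top[of 0]
  proof eventually_elim
    case (elim s)
    have us: "L2_norm mu (u s) \<le> exp (- \<delta> * s) * L2_norm mu (u 0)" using elim by (intro sol_decay0 u) auto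
    have 1: "ip mu (u 0) (v (2 * s)) = ip mu (u s) (v s)"
      using pair_shift[OF u v, of s "2 * s"] elim by simp
    have "\<bar>ip mu (u s) (v s)\<bar> \<le> L2_norm mu (u s) * L2_norm mu (v s)"
      using elim u v by (intro ip_Cauchy_Schwarz) (auto simp: sol_L2)
    also have "\<dots> \<le> (exp (- \<delta> * s) * L2_norm mu (u 0)) * L2_norm mu (v 0)"
      using elim us sol_mono[OF v order_refl, of s] by (intro mult_mono) auto
    finally have 2: "\<bar>ip mu (u s) (v s)\<bar> \<le> exp (- \<delta> * s) * ?N" by (simp add: algebra_simps)
    have "\<bar>ip mu (u s) (L (v s))\<bar> \<le> L2_norm mu (u s) * L2_norm mu (L (v s))"
      using elim u v by (intro ip_Cauchy_Schwarz) (auto simp: sol_L2 sol_L_L2)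
    then have "\<bar>s * ip mu (u s) (L (v s))\<bar> \<le> L2_norm mu (u s) * (s * L2_norm mu (L (v s)))"
      using elim mult_left_mono[of "\<bar>ip mu (u s) (L (v s))\<bar>" _ s] by (simp add: abs_mult algebra_simps)
    also have "\<dots> \<le> (exp (- \<delta> * s) * L2_norm mu (u 0)) * L2_norm mu (v 0)"
      using elim us sol_L_bound[OF v, of s] by (intro mult_mono) auto
    finally have 3: "\<bar>s * ip mu (u s) (L (v s))\<bar> \<le> exp (- \<delta> * s) * ?N" by (simp add: algebra_simps)
    show ?case using 2 3 unfolding primitive_def 1 pair_shift_L_half[OF u v elim] by simp
  qed
qed

text \<open>The integrand 4 * s * ip (L (u s)) (L (v s)) ds after the substitution s = t^m, ds = m *
  t^(m - 1) dt, so that t is the length scale of the square function.\<close>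

definition density :: "real \<Rightarrow> (real \<Rightarrow> 'a \<Rightarrow> complex) \<Rightarrow> (real \<Rightarrow> 'a \<Rightarrow> complex) \<Rightarrow> real \<Rightarrow> real" where
  "density m u v t = 4 * m * (t powr m)\<^sup>2 / t * ip mu (L (u (t powr m))) (L (v (t powr m)))"

lemma density_integral:
  assumes u: "sol u" and v: "sol v" and a: "0 < a" "a \<le> b"
  shows "integrable lborel (\<lambda>t. indicator {a..b} t *\<^sub>R density m u v t)"
    and "(\<integral>t. indicator {a..b} t *\<^sub>R density m u v t \<partial>lborel) = primitive u v (a powr m) - primitive u v (b powr m)"
proof -
  have "continuous_on {a..b} (\<lambda>t. ip mu (L (u (t powr m))) (L (v (t powr m))))"
    by (rule continuous_on_compose2[OF ip_L_L_continuous[OF u v]]) (use a in \<open>auto intro!: continuous_intros\<close>)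
  then have c: "continuous_on {a..b} (density m u v)"
    unfolding density_def using a by (intro continuous_intros) auto
  then show "integrable lborel (\<lambda>t. indicator {a..b} t *\<^sub>R density m u v t)"
    using borel_integrable_atLeastAtMost'[OF c] by (simp add: set_integrable_def)
  have "(\<integral>t. indicator {a..b} t *\<^sub>R density m u v t \<partial>lborel) = (- primitive u v (b powr m)) - (- primitive u v (a powr m))"
  proof (rule integral_FTC_atLeastAtMost[OF a(2) _ c])
    fix x assume x: "a \<le> x" "x \<le> b"
    then have x0: "0 < x" using a by simp
    have "((\<lambda>t. - primitive u v (t powr m)) has_real_derivative - ((- 4 * (x powr m) * ip mu (L (u (x powr m))) (L (v (x powr m)))) * (m * x powr (m - 1)))) (at x)"
      using x0 by (intro DERIV_minus DERIV_chain2[OF primitive_deriv[OF u v]] has_real_derivative_powr) auto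
    also have "- ((- 4 * (x powr m) * ip mu (L (u (x powr m))) (L (v (x powr m)))) * (m * x powr (m - 1))) = density m u v x"
      using x0 by (simp add: density_def powr_diff power2_eq_square)
    finally show "((\<lambda>t. - primitive u v (t powr m)) has_vector_derivative density m u v x) (at x within {a..b})"
      by (simp add: has_real_derivative_iff_has_vector_derivative has_vector_derivative_at_within)
  qed
  then show "(\<integral>t. indicator {a..b} t *\<^sub>R density m u v t \<partial>lborel) = primitive u v (a powr m) - primitive u v (b powr m)" by simp
qed

text \<open>The end points are m-th roots, so that the times \<open>a n powr m\<close> and
  \<open>b n powr m\<close> are 1 / (n + 1) and n + 1 and exhaust the half-line.\<close>

lemma primitive_limit:
  assumes u: "sol u" and v: "sol v" and m: "m > 0"
  defines "a \<equiv> \<lambda>n. (inverse (real (Suc n))) powr (1 / m)" and "b \<equiv> \<lambda>n. real (Suc n) powr (1 / m)"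
  shows "(\<lambda>n. primitive u v (a n powr m) - primitive u v (b n powr m)) \<longlonglongrightarrow> ip mu (u 0) (v 0)"
proof -
  have ab: "a n powr m = inverse (real (Suc n))" "b n powr m = real (Suc n)" for n
    using m by (auto simp: a_def b_def powr_powr)
  have "filterlim (\<lambda>n. inverse (real (Suc n))) (at_right 0) sequentially"
    using LIMSEQ_inverse_real_of_nat by (auto simp: filterlim_at intro!: always_eventually)
  then have 1: "(\<lambda>n. primitive u v (inverse (real (Suc n)))) \<longlonglongrightarrow> ip mu (u 0) (v 0)"
    by (rule filterlim_compose[OF primitive_at_0[OF u v]])
  have "filterlim (\<lambda>n. real (Suc n)) at_top sequentially"
    by (rule filterlim_compose[OF filterlim_real_sequentially filterlim_Suc])
  then have 2: "(\<lambda>n. primitive u v (real (Suc n))) \<longlonglongrightarrow> 0"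
    by (rule filterlim_compose[OF primitive_at_top[OF u v]])
  show ?thesis unfolding ab using tendsto_diff[OF 1 2] by simp
qed

text \<open>Taking absolute values on each compact interval before the limit is enough for duality
  and presupposes no integrability of \<open>density\<close> on the whole half-line.\<close>

lemma pairing_bound:
  assumes u: "sol u" and v: "sol v" and m: "m > 0"
  shows "ennreal \<bar>ip mu (u 0) (v 0)\<bar> \<le> (\<integral>\<^sup>+t. indicator {0<..} t * ennreal \<bar>density m u v t\<bar> \<partial>lborel)"
proof -
  define a where "a = (\<lambda>n. (inverse (real (Suc n))) powr (1 / m))"
  define b where "b = (\<lambda>n. real (Suc n) powr (1 / m))"
  have lim: "(\<lambda>n. ennreal \<bar>primitive u v (a n powr m) - primitive u v (b n powr m)\<bar>) \<longlonglongrightarrow> ennreal \<bar>ip mu (u 0) (v 0)\<bar>"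
    unfolding a_def b_def using primitive_limit[OF u v m] by (intro tendsto_ennrealI tendsto_rabs)
  show ?thesis
  proof (rule LIMSEQ_le_const2[OF lim], intro exI allI impI)
    fix n :: nat
    have "inverse (real (Suc n)) \<le> real (Suc n)" by (simp add: field_simps)
    then have ab: "0 < a n" "a n \<le> b n" unfolding a_def b_def using m by (auto intro!: powr_mono2)
    have "ennreal \<bar>primitive u v (a n powr m) - primitive u v (b n powr m)\<bar> 
        \<le> (\<integral>\<^sup>+t. ennreal (norm (indicator {a n..b n} t *\<^sub>R density m u v t)) \<partial>lborel)"
      using integral_norm_bound_ennreal[OF density_integral(1)[OF u v ab]] density_integral(2)[OF u v ab] by simp
    also have "\<dots> \<le> (\<integral>\<^sup>+t. indicator {0<..} t * ennreal \<bar>density m u v t\<bar> \<partial>lborel)"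
      using ab by (intro nn_integral_mono) (auto simp: indicator_def)
    finally show "ennreal \<bar>primitive u v (a n powr m) - primitive u v (b n powr m)\<bar> \<le> \<dots>" .
  qed
qed

text \<open>On the diagonal the density is non-negative, so Fatou's lemma along the exhausting
  intervals applies.\<close>

lemma square_bound:
  assumes u: "sol u" and m: "m > 0"
  shows "(\<integral>\<^sup>+t. indicator {0<..} t * ennreal (density m u u t) \<partial>lborel) \<le> ennreal ((L2_norm mu (u 0))\<^sup>2)"
proof -
  define a where "a = (\<lambda>n. (inverse (real (Suc n))) powr (1 / m))"
  define b where "b = (\<lambda>n. real (Suc n) powr (1 / m))"
  have lim: "(\<lambda>n. ennreal (primitive u u (a n powr m) - primitive u u (b n powr m))) \<longlonglongrightarrow> ennreal (ip mu (u 0) (u 0))"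
    unfolding a_def b_def using primitive_limit[OF u u m] by (intro tendsto_ennrealI)
  have pos: "0 \<le> density m u u t" if "t > 0" for t
    using that m ip_self[OF sol_L_L2[OF u], of "t powr m"] by (simp add: density_def)
  let ?f = "\<lambda>n t. ennreal (indicator {a n..b n} t *\<^sub>R density m u u t)"
  have ab: "0 < a n" "a n \<le> b n" for n
  proof -
    have "inverse (real (Suc n)) \<le> real (Suc n)" by (simp add: field_simps)
    then show "0 < a n" "a n \<le> b n" unfolding a_def b_def using m by (auto intro!: powr_mono2)
  qed
  have int: "(\<integral>\<^sup>+t. ?f n t \<partial>lborel) = ennreal (primitive u u (a n powr m) - primitive u u (b n powr m))" for n
    using ab[of n] pos density_integral[OF u u ab[of n], of m]
    by (subst nn_integral_eq_integral) (auto simp: indicator_def)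
  have meas: "?f n \<in> borel_measurable lborel" for n
    using density_integral(1)[OF u u ab[of n], of m] by auto
  have conv: "(\<lambda>n. ?f n t) \<longlonglongrightarrow> indicator {0<..} t * ennreal (density m u u t)" for t
  proof (cases "t > 0")
    case False
    then have "?f n t = 0" for n using ab(1)[of n] by (simp add: indicator_def)
    then show ?thesis using False by simp
  next
    case True
    then have tm: "t powr m > 0" by simp
    obtain N1 where N1: "inverse (real (Suc N1)) < t powr m" using reals_Archimedean[OF tm] by auto
    obtain N2 where N2: "t powr m < real N2" using reals_Archimedean2 by blast
    have "?f n t = indicator {0<..} t * ennreal (density m u u t)" if n: "n \<ge> max N1 N2" for n
    proof -
      have "inverse (real (Suc n)) \<le> inverse (real (Suc N1))" using n by (intro le_imp_inverse_le) auto
      then have "inverse (real (Suc n)) \<le> t powr m" using N1 by linarith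
      then have "a n \<le> (t powr m) powr (1 / m)" unfolding a_def using m by (intro powr_mono2) auto
      moreover have "(t powr m) powr (1 / m) \<le> b n" unfolding b_def using m n N2 by (intro powr_mono2) auto
      moreover have "(t powr m) powr (1 / m) = t" using m True by (simp add: powr_powr)
      ultimately show ?thesis using True by (simp add: indicator_def)
    qed
    then show ?thesis by (intro tendsto_eventually eventually_sequentiallyI[of "max N1 N2"])
  qed
  have "(\<integral>\<^sup>+t. indicator {0<..} t * ennreal (density m u u t) \<partial>lborel) = (\<integral>\<^sup>+t. liminf (\<lambda>n. ?f n t) \<partial>lborel)"
    by (intro nn_integral_cong lim_imp_Liminf[OF trivial_limit_sequentially conv, symmetric])
  also have "\<dots> \<le> liminf (\<lambda>n. \<integral>\<^sup>+t. ?f n t \<partial>lborel)" using meas by (rule nn_integral_liminf)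
  also have "\<dots> = ennreal (ip mu (u 0) (u 0))" unfolding int using lim by (intro lim_imp_Liminf) auto
  finally show ?thesis using ip_self[OF sol_L2[OF u order_refl]] by simp
qed

end

subsection \<open>Doubling spaces\<close>

definition dense_set :: "'b::metric_space set \<Rightarrow> bool" where
  "dense_set Q \<longleftrightarrow> (\<forall>x. \<forall>e>0. \<exists>q\<in>Q. dist q x < e)"

text \<open>Without separability the Borel sets of a product may exceed the product sigma-algebra.
  Countable dense sets write an open set as a countable union of products of balls.\<close>

lemma open_in_sets_borel_pair:
  fixes U :: "('b::metric_space \<times> 'c::metric_space) set" and Q1 :: "'b set" and Q2 :: "'c set"
  assumes Q1: "countable Q1" "dense_set Q1" and Q2: "countable Q2" "dense_set Q2" and U: "open U"
  shows "U \<in> sets (borel \<Otimes>\<^sub>M borel)"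
proof -
  let ?r = "\<lambda>n. inverse (real (Suc n))"
  let ?B = "\<lambda>(p :: 'b, q :: 'c, n :: nat). ball p (?r n) \<times> ball q (?r n)"
  define J where "J = {i \<in> Q1 \<times> Q2 \<times> (UNIV :: nat set). ?B i \<subseteq> U}"
  have cJ: "countable J" by (rule countable_subset[of _ "Q1 \<times> Q2 \<times> UNIV"]) (use Q1 Q2 in \<open>auto simp: J_def\<close>)
  have U_eq: "U = (\<Union>i\<in>J. ?B i)"
  proof
    show "U \<subseteq> (\<Union>i\<in>J. ?B i)"
    proof
      fix z assume "z \<in> U"
      obtain a b where z: "z = (a, b)" by (cases z)
      obtain S T where ST: "open S" "open T" "(a, b) \<in> S \<times> T" "S \<times> T \<subseteq> U"
        by (rule open_prod_elim[OF U \<open>z \<in> U\<close>]) (simp add: z)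
      obtain e1 where e1: "e1 > 0" "ball a e1 \<subseteq> S" using ST(1,3) unfolding open_contains_ball by blast
      obtain e2 where e2: "e2 > 0" "ball b e2 \<subseteq> T" using ST(2,3) unfolding open_contains_ball by blast
      \<comment> \<open>Half the smaller radius: a ball of radius \<open>?r n\<close> about a point
        within \<open>?r n\<close> of the old centre then stays inside.\<close>
      have "0 < min e1 e2 / 2" using e1 e2 by simp
      then obtain n where n: "?r n < min e1 e2 / 2" using reals_Archimedean by blast
      have r0: "0 < ?r n" by simp
      obtain p where p: "p \<in> Q1" "dist p a < ?r n" using Q1(2) r0 unfolding dense_set_def by blast
      obtain q where q: "q \<in> Q2" "dist q b < ?r n" using Q2(2) r0 unfolding dense_set_def by blast
      have "ball p (?r n) \<subseteq> ball a e1"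
      proof
        fix w assume "w \<in> ball p (?r n)"
        then show "w \<in> ball a e1" using p n dist_triangle[of a w p] by (simp add: dist_commute)
      qed
      moreover have "ball q (?r n) \<subseteq> ball b e2"
      proof
        fix w assume "w \<in> ball q (?r n)"
        then show "w \<in> ball b e2" using q n dist_triangle[of b w q] by (simp add: dist_commute)
      qed
      ultimately have "ball p (?r n) \<times> ball q (?r n) \<subseteq> S \<times> T" using e1(2) e2(2) by (intro Sigma_mono) blast+
      then have "?B (p, q, n) \<subseteq> U" using ST(4) by simp
      then have "(p, q, n) \<in> J" using p q by (simp add: J_def)
      moreover have "z \<in> ?B (p, q, n)" using z p q by simp
      ultimately show "z \<in> (\<Union>i\<in>J. ?B i)" by blast
    qed
  qed (auto simp: J_def)
  have m: "?B i \<in> sets (borel \<Otimes>\<^sub>M borel)" for i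
    by (cases i) (auto intro!: pair_measureI)
  show ?thesis unfolding U_eq by (rule sets.countable_UN'[OF cJ]) (use m in blast)
qed

lemma dense_set_real: "\<exists>Q :: real set. countable Q \<and> dense_set Q"
proof -
  obtain Q :: "real set" where Q: "countable Q" "\<And>X. open X \<Longrightarrow> X \<noteq> {} \<Longrightarrow> \<exists>d\<in>Q. d \<in> X"
    by (rule countable_dense_setE) blast
  have "dense_set Q" unfolding dense_set_def
  proof (intro allI impI)
    fix x e :: real assume "e > 0"
    then show "\<exists>q\<in>Q. dist q x < e" using Q(2)[of "ball x e"] by (auto simp: dist_commute)
  qed
  then show ?thesis using Q by blast
qed

lemma dense_set_Times:
  assumes "dense_set Q1" "dense_set Q2" shows "dense_set (Q1 \<times> Q2)"
  unfolding dense_set_def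
proof (intro allI impI)
  fix x :: "'a \<times> 'b" and e :: real assume "e > 0"
  then obtain p q where pq: "p \<in> Q1" "dist p (fst x) < e / 2" "q \<in> Q2" "dist q (snd x) < e / 2"
    using assms unfolding dense_set_def by (meson half_gt_zero)
  have "dist (p, q) x \<le> dist p (fst x) + dist q (snd x)"
    by (cases x) (simp add: dist_Pair_Pair sqrt_sum_squares_le_sum)
  then show "\<exists>q\<in>Q1 \<times> Q2. dist q x < e" using pq by (intro bexI[of _ "(p, q)"]) auto
qed

lemma ennreal_le_suminf: "f j \<le> (\<Sum>j. f j :: ennreal)"
  using sum_le_suminf[of f "{j}"] by simp

definition decay :: "nat \<Rightarrow> real \<Rightarrow> 'a::metric_space \<Rightarrow> 'a \<Rightarrow> real" where
  "decay M t x y = inverse ((1 + dist x y / t) ^ M)"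

lemma decay_nonneg [simp]: "0 < t \<Longrightarrow> 0 \<le> decay M t x y"
  by (simp add: decay_def)

lemma decay_pos: "0 < t \<Longrightarrow> 0 < decay M t x y"
  by (simp add: decay_def add_pos_nonneg)

lemma decay_commute: "decay M t x y = decay M t y x"
  by (simp add: decay_def dist_commute)

lemma decay_le_1: "0 < t \<Longrightarrow> decay M t x y \<le> 1"
  by (simp add: decay_def inverse_le_1_iff one_le_power)

lemma decay_add: "decay (M + N) t x y = decay M t x y * decay N t x y"
  by (simp add: decay_def power_add)

lemma decay_scale:
  assumes "0 < s" "s \<le> t" shows "decay M t x y \<le> (t / s) ^ M * decay M s x y"
proof -
  have "1 + dist x y / s \<le> (t / s) * (1 + dist x y / t)"
    using assms by (simp add: field_simps)
  then have "(1 + dist x y / s) ^ M \<le> (t / s) ^ M * (1 + dist x y / t) ^ M"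
    using assms by (subst power_mult_distrib[symmetric]) (intro power_mono, auto)
  moreover have "0 < (1 + dist x y / s) ^ M" "0 < (1 + dist x y / t) ^ M"
    using assms by (auto intro!: zero_less_power add_pos_nonneg)
  moreover define c where "c = (t / s) ^ M"
  ultimately show ?thesis unfolding decay_def c_def[symmetric] by (simp add: field_simps)
qed

section \<open>Volume comparison, nets, measurability and ball averages\<close>

locale doubling =
  fixes mu :: "'a::metric_space measure" and k :: nat and A :: real
  assumes space_mu [simp]: "space mu = UNIV" and sets_mu [measurable_cong]: "sets mu = sets borel"
    and A: "A \<ge> 1"
    and ball_pos: "r > 0 \<Longrightarrow> 0 < emeasure mu (ball x r)"
    and ball_fin: "emeasure mu (ball x r) < \<infinity>"
    and ball_double: "r > 0 \<Longrightarrow> \<alpha> \<ge> 1 \<Longrightarrow> measure mu (ball x (\<alpha> * r)) \<le> A * \<alpha> ^ k * measure mu (ball x r)"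
begin

abbreviation V :: "'a \<Rightarrow> real \<Rightarrow> real" where "V x r \<equiv> measure mu (ball x r)"

lemma sets_ball [simp, measurable]: "ball x r \<in> sets mu" by (simp add: sets_mu)

lemma emeasure_ball: "emeasure mu (ball x r) = ennreal (V x r)"
  using ball_fin[of x r] by (simp add: emeasure_eq_ennreal_measure top.not_eq_extremum)

lemma V_pos: "r > 0 \<Longrightarrow> 0 < V x r"
  using ball_pos[of r x] by (simp add: emeasure_ball)

lemma V_mono: "ball x r \<subseteq> ball y s \<Longrightarrow> V x r \<le> V y s"
  using emeasure_mono[of "ball x r" "ball y s" mu] by (simp add: emeasure_ball)

lemma V_mono_radius: "r \<le> s \<Longrightarrow> V x r \<le> V x s"
  by (intro V_mono subset_ball)

lemma V_scale: 
  assumes "0 < r" "r \<le> s" shows "V x s \<le> A * (s / r) ^ k * V x r"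
  using ball_double[of r "s / r" x] assms by simp

lemma V_compare:
  assumes "0 < t" shows "V y t \<le> A * (1 + dist x y / t) ^ k * V x t"
proof -
  have "ball y t \<subseteq> ball x (t + dist x y)"
  proof
    fix w assume "w \<in> ball y t"
    then show "w \<in> ball x (t + dist x y)" using dist_triangle[of x w y] by simp
  qed
  then have "V y t \<le> V x (t + dist x y)" by (rule V_mono)
  also have "\<dots> \<le> A * ((t + dist x y) / t) ^ k * V x t" using assms by (intro V_scale) auto
  also have "(t + dist x y) / t = 1 + dist x y / t" using assms by (simp add: field_simps)
  finally show ?thesis .
qed

lemma inverse_V_compare:
  assumes "0 < t" shows "1 / V x t \<le> A * (1 + dist x y / t) ^ k / V y t"
  using V_compare[OF assms, of y x] V_pos[OF assms, of x] V_pos[OF assms, of y] by (simp add: field_simps)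

lemma V_near:
  assumes "0 < t" "dist x y < t" shows "V y t \<le> A * 2 ^ k * V x t"
proof -
  have "(1 + dist x y / t) ^ k \<le> 2 ^ k" using assms by (intro power_mono) (auto simp: field_simps)
  then have "A * (1 + dist x y / t) ^ k * V x t \<le> A * 2 ^ k * V x t"
    using A by (intro mult_right_mono mult_left_mono) auto
  then show ?thesis using V_compare[OF assms(1), of y x] by linarith
qed

text \<open>Disjoint balls of equal radius inside a fixed ball have comparable measures, so a separated
  set of maximal cardinality exists, and it is a net.\<close>
lemma finite_net:
  fixes z :: 'a
  assumes "0 < e" "0 < R"
  obtains S where "finite S" "\<And>x. x \<in> ball z R \<Longrightarrow> \<exists>s\<in>S. dist s x < e"
proof -
  define F where "F S \<longleftrightarrow> finite S \<and> S \<subseteq> ball z R \<and> (\<forall>s\<in>S. \<forall>t\<in>S. s \<noteq> t \<longrightarrow> e \<le> dist s t)" for S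
  \<comment> \<open>The doubling constant from radius e / 2 to 2 * R + e; at the latter radius a
    ball about any point of \<open>ball z R\<close> contains
    \<open>ball z (R + e / 2)\<close>.\<close>
  define c where "c = A * ((2 * R + e) / (e / 2)) ^ k"
  have bound: "real (card S) \<le> c" if "F S" for S
  proof -
    have S: "finite S" "S \<subseteq> ball z R" using that by (auto simp: F_def)
    have V: "V z (R + e / 2) \<le> c * V s (e / 2)" if "s \<in> S" for s
    proof -
      have "ball z (R + e / 2) \<subseteq> ball s (2 * R + e)"
      proof
        fix w assume "w \<in> ball z (R + e / 2)"
        moreover have "dist z s < R" using that S by auto
        ultimately show "w \<in> ball s (2 * R + e)" using dist_triangle[of s w z] assms by (simp add: dist_commute)
      qed
      then have "V z (R + e / 2) \<le> V s (2 * R + e)" by (rule V_mono)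
      also have "\<dots> \<le> c * V s (e / 2)" unfolding c_def using assms by (intro V_scale) auto
      finally show ?thesis .
    qed
    have "real (card S) * V z (R + e / 2) = (\<Sum>s\<in>S. V z (R + e / 2))" by simp
    also have "\<dots> \<le> (\<Sum>s\<in>S. c * V s (e / 2))" by (intro sum_mono V)
    also have "\<dots> = c * measure mu (\<Union>s\<in>S. ball s (e / 2))"
    proof -
      have "disjoint_family_on (\<lambda>s. ball s (e / 2)) S"
        unfolding disjoint_family_on_def
      proof (intro ballI impI, rule ccontr)
        fix s t assume st: "s \<in> S" "t \<in> S" "s \<noteq> t" "ball s (e / 2) \<inter> ball t (e / 2) \<noteq> {}"
        then obtain w where "dist s w < e / 2" "dist t w < e / 2" by auto
        then have "dist s t < e" using dist_triangle2[of s t w] by simp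
        moreover have "e \<le> dist s t" using st that unfolding F_def by blast
        ultimately show False by simp
      qed
      then show ?thesis using S
        by (subst measure_finite_Union) (auto simp: sum_distrib_left emeasure_ball sets_mu)
    qed
    also have "\<dots> \<le> c * V z (R + e / 2)"
    proof (intro mult_left_mono)
      have "(\<Union>s\<in>S. ball s (e / 2)) \<subseteq> ball z (R + e / 2)"
      proof
        fix w assume "w \<in> (\<Union>s\<in>S. ball s (e / 2))"
        then obtain s where "s \<in> S" "dist s w < e / 2" by auto
        then show "w \<in> ball z (R + e / 2)" using S dist_triangle[of z w s] by force
      qed
      then show "measure mu (\<Union>s\<in>S. ball s (e / 2)) \<le> V z (R + e / 2)"
        by (intro measure_mono_fmeasurable) (auto simp: fmeasurable_def emeasure_ball sets_mu intro!: borel_open)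
      show "0 \<le> c" using A assms by (simp add: c_def)
    qed
    finally show ?thesis using V_pos[of "R + e / 2" z] assms by (simp add: mult_le_cancel_right)
  qed
  have "card S < Suc (nat \<lceil>c\<rceil>)" if "F S" for S using bound[OF that] by linarith
  moreover have "F {}" by (simp add: F_def)
  ultimately obtain S where S: "F S" "\<And>T. F T \<Longrightarrow> card T \<le> card S"
    using ex_has_greatest_nat[of F "{}" card "Suc (nat \<lceil>c\<rceil>)"] by blast
  show ?thesis
  proof (rule that)
    show "finite S" using S by (simp add: F_def)
    fix x assume x: "x \<in> ball z R"
    show "\<exists>s\<in>S. dist s x < e"
    proof (rule ccontr)
      assume "\<not> ?thesis"
      then have far: "\<And>s. s \<in> S \<Longrightarrow> e \<le> dist s x" by force
      then have "x \<notin> S" using assms by force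
      have "F (insert x S)" using S(1) x far by (auto simp: F_def dist_commute)
      then show False using S(2)[of "insert x S"] \<open>x \<notin> S\<close> \<open>F S\<close> by (simp add: F_def)
    qed
  qed
qed

lemma separable: "\<exists>Q :: 'a set. countable Q \<and> dense_set Q"
proof -
  fix z :: 'a
  have "\<exists>S. finite S \<and> (\<forall>x\<in>ball z (real (Suc i)). \<exists>s\<in>S. dist s x < inverse (real (Suc j)))" for i j
    using finite_net[of "inverse (real (Suc j))" "real (Suc i)" z] by (metis inverse_positive_iff_positive of_nat_0_less_iff zero_less_Suc)
  then obtain S where S: "\<And>i j. finite (S i j)" "\<And>i j x. x \<in> ball z (real (Suc i)) \<Longrightarrow> \<exists>s\<in>S i j. dist s x < inverse (real (Suc j))"
    by metis
  have "dense_set (\<Union>i j. S i j)" unfolding dense_set_def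
  proof (intro allI impI)
    fix x :: 'a and e :: real assume "0 < e"
    then obtain j where j: "inverse (real (Suc j)) < e" using reals_Archimedean by blast
    obtain i where "dist z x < real i" using reals_Archimedean2 by blast
    then have "x \<in> ball z (real (Suc i))" by simp
    from S(2)[OF this, of j] j show "\<exists>q\<in>\<Union>i j. S i j. dist q x < e" by force
  qed
  moreover have "countable (\<Union>i j. S i j)" using S(1) by (intro countable_UN) (auto intro: countable_finite)
  ultimately show ?thesis by blast
qed

lemma sigma_finite: "sigma_finite_measure mu"
proof
  fix z :: 'a
  have "\<Union> (range (\<lambda>n. ball z (real n))) = space mu" using reals_Archimedean2 by auto
  then show "\<exists>A. countable A \<and> A \<subseteq> sets mu \<and> \<Union> A = space mu \<and> (\<forall>a\<in>A. emeasure mu a \<noteq> \<infinity>)"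
    by (intro exI[of _ "range (\<lambda>n. ball z (real n))"]) (auto simp: emeasure_ball)
qed

sublocale sigma_finite_measure mu by (rule sigma_finite)
sublocale mm: pair_sigma_finite mu mu ..
sublocale lm: pair_sigma_finite lborel mu ..

lemma open_pair: "open U \<Longrightarrow> U \<in> sets (mu \<Otimes>\<^sub>M mu)"
  using separable open_in_sets_borel_pair[of _ _ U] sets_pair_measure_cong[OF sets_mu sets_mu] by blast

lemma open_real_pair: 
  fixes U :: "(real \<times> 'a) set"
  shows "open U \<Longrightarrow> U \<in> sets (lborel \<Otimes>\<^sub>M mu)"
  using separable dense_set_real open_in_sets_borel_pair[of _ _ U] sets_pair_measure_cong[OF sets_lborel sets_mu] by blast

lemma open_real_triple: 
  fixes U :: "((real \<times> 'a) \<times> 'a) set"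
  assumes U: "open U" shows "U \<in> sets ((lborel \<Otimes>\<^sub>M mu) \<Otimes>\<^sub>M mu)"
proof -
  obtain Q R where QR: "countable Q" "dense_set Q" "countable R" "dense_set (R :: real set)" "dense_set (Q :: 'a set)"
    using separable dense_set_real by blast
  have *: "U \<in> sets ((borel :: (real \<times> 'a) measure) \<Otimes>\<^sub>M borel)"
    by (rule open_in_sets_borel_pair[of "R \<times> Q" Q]) (use QR U in \<open>auto intro: dense_set_Times\<close>)
  have "sets (borel :: (real \<times> 'a) measure) \<subseteq> sets (lborel \<Otimes>\<^sub>M mu)"
    using sets.sigma_sets_subset[of "Collect open" "(lborel :: real measure) \<Otimes>\<^sub>M mu"] open_real_pair
    by (auto simp: borel_def[where 'a = "real \<times> 'a"] space_pair_measure)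
  moreover have "sets ((borel :: (real \<times> 'a) measure) \<Otimes>\<^sub>M borel) \<subseteq> sets ((lborel \<Otimes>\<^sub>M mu) \<Otimes>\<^sub>M mu)" if "sets (borel :: (real \<times> 'a) measure) \<subseteq> sets (lborel \<Otimes>\<^sub>M mu)"
    by (intro sets_pair_in_sets pair_measureI subsetD[OF that]) (simp_all add: sets_mu)
  ultimately show ?thesis using * by blast
qed

lemma measurable_dist: "(\<lambda>(x, y). dist x y) \<in> borel_measurable (mu \<Otimes>\<^sub>M mu)"
proof (rule borel_measurable_iff_greater[THEN iffD2], rule allI)
  fix a :: real
  have "{w \<in> space (mu \<Otimes>\<^sub>M mu). a < (case w of (x, y) \<Rightarrow> dist x y)} = {w. a < dist (fst w) (snd w)}"
    by (auto simp: space_pair_measure)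
  also have "\<dots> \<in> sets (mu \<Otimes>\<^sub>M mu)" by (intro open_pair open_Collect_less continuous_intros)
  finally show "{w \<in> space (mu \<Otimes>\<^sub>M mu). a < (case w of (x, y) \<Rightarrow> dist x y)} \<in> sets (mu \<Otimes>\<^sub>M mu)" .
qed

lemma measurable_dist' [measurable (raw)]:
  assumes "f \<in> measurable M mu" "g \<in> measurable M mu"
  shows "(\<lambda>x. dist (f x) (g x)) \<in> borel_measurable M"
  using measurable_compose[OF measurable_Pair[OF assms] measurable_dist] by simp

text \<open>The volume is the measure of a section of the open set dist x y < t in the triple
  product, which is why triples were treated above.\<close>

lemma measurable_emeasure_ball: "(\<lambda>(t, x). emeasure mu (ball x t)) \<in> borel_measurable (lborel \<Otimes>\<^sub>M mu)"
proof -
  have "open {w :: (real \<times> 'a) \<times> 'a. dist (snd (fst w)) (snd w) < fst (fst w)}"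
    by (intro open_Collect_less continuous_intros)
  from measurable_emeasure_Pair[OF open_real_triple[OF this]]
  show ?thesis by (simp add: vimage_def ball_def case_prod_beta')
qed

lemma measurable_V: "(\<lambda>(t, x). V x t) \<in> borel_measurable (lborel \<Otimes>\<^sub>M mu)"
  using borel_measurable_enn2real[OF measurable_emeasure_ball] by (simp add: case_prod_beta' measure_def)

lemma measurable_V' [measurable (raw)]:
  assumes "f \<in> measurable M mu" "g \<in> borel_measurable M"
  shows "(\<lambda>x. V (f x) (g x)) \<in> borel_measurable M"
proof -
  have "(\<lambda>x. (g x, f x)) \<in> measurable M (lborel \<Otimes>\<^sub>M mu)" using assms by (intro measurable_Pair) auto
  from measurable_compose[OF this measurable_V] show ?thesis by simp
qed

lemma measurable_decay [measurable (raw)]: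
  assumes "f \<in> measurable M mu" "g \<in> measurable M mu" "h \<in> borel_measurable M"
  shows "(\<lambda>x. decay n (h x) (f x) (g x)) \<in> borel_measurable M"
proof -
  note [measurable] = assms
  show ?thesis unfolding decay_def by measurable
qed

lemma measurable_indicator_ball [measurable (raw)]:
  assumes "f \<in> measurable M mu" "g \<in> measurable M mu" "h \<in> borel_measurable M"
  shows "(\<lambda>x. indicator (ball (f x) (h x)) (g x) :: ennreal) \<in> borel_measurable M"
proof -
  note [measurable] = assms
  have "(\<lambda>x. if dist (f x) (g x) < h x then 1 else (0 :: ennreal)) \<in> borel_measurable M" by measurable
  moreover have "(\<lambda>x. if dist (f x) (g x) < h x then 1 else (0 :: ennreal)) = (\<lambda>x. indicator (ball (f x) (h x)) (g x))"
    by (auto simp: indicator_def)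
  ultimately show ?thesis by simp
qed

text \<open>Sum over dyadic shells: the weight 2^(-j(k + 1)) beats the volume growth 2^((j + 1)k)
  and leaves a geometric series. One order beyond k therefore suffices.\<close>

lemma decay_integral:
  assumes t: "0 < t"
  shows "(\<integral>\<^sup>+y. ennreal (decay (k + 1) t x y) \<partial>mu) \<le> ennreal (A * 2 ^ (k + 1) * V x t)"
proof -
  let ?c = "\<lambda>j::nat. inverse (2 ^ (j * (k + 1))) :: real"
  let ?g = "\<lambda>j y. ennreal (?c j) * indicator (ball x (2 ^ (j + 1) * t)) y"
  have "(\<integral>\<^sup>+y. ennreal (decay (k + 1) t x y) \<partial>mu) \<le> (\<integral>\<^sup>+y. (\<Sum>j. ?g j y) \<partial>mu)"
  proof (intro nn_integral_mono)
    fix y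
    define s where "s = 1 + dist x y / t"
    have s: "1 \<le> s" using t by (simp add: s_def)
    have "\<exists>n. s < 2 ^ n" using real_arch_pow[of 2 s] by simp
    \<comment> \<open>Selects the shell: n = j + 1 with 2^j \<le> s < 2^(j + 1), where n is not 0
      because s \<ge> 1.\<close>
    define n where "n = (LEAST n. s < 2 ^ n)"
    have n: "s < 2 ^ n" unfolding n_def using \<open>\<exists>n. s < 2 ^ n\<close> by (rule LeastI_ex)
    then obtain j where j: "n = j + 1" using s by (cases n) auto
    have "\<not> s < 2 ^ j" using not_less_Least[of j "\<lambda>n. s < 2 ^ n"] j unfolding n_def by simp
    then have "2 ^ j \<le> s" by simp
    then have "(2 ^ j) ^ (k + 1) \<le> s ^ (k + 1)" by (intro power_mono) auto
    then have "2 ^ (j * (k + 1)) \<le> s ^ (k + 1)" by (simp only: power_mult)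
    then have "decay (k + 1) t x y \<le> ?c j" unfolding decay_def s_def[symmetric]
      by (intro le_imp_inverse_le) auto
    moreover have "dist x y < 2 ^ (j + 1) * t" using n t j by (simp add: s_def field_simps)
    ultimately have "ennreal (decay (k + 1) t x y) \<le> ?g j y" by (auto intro: ennreal_leI)
    also have "\<dots> \<le> (\<Sum>j. ?g j y)" by (rule ennreal_le_suminf)
    finally show "ennreal (decay (k + 1) t x y) \<le> (\<Sum>j. ?g j y)" .
  qed
  also have "\<dots> = (\<Sum>j. ennreal (?c j) * ennreal (V x (2 ^ (j + 1) * t)))"
    by (subst nn_integral_suminf) (auto simp: nn_integral_cmult emeasure_ball)
  also have "\<dots> \<le> (\<Sum>j. ennreal (A * 2 ^ k * V x t * (1 / 2) ^ j))"
  proof (intro suminf_le summableI)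
    fix j
    have "?c j * V x (2 ^ (j + 1) * t) \<le> ?c j * (A * (2 ^ (j + 1)) ^ k * V x t)"
      using t by (intro mult_left_mono ball_double one_le_power) auto
    also have "\<dots> = A * 2 ^ k * V x t * (1 / 2) ^ j"
      by (simp add: power_mult[symmetric] power_add power_mult_distrib field_simps power_divide) 
    finally show "ennreal (?c j) * ennreal (V x (2 ^ (j + 1) * t)) \<le> ennreal (A * 2 ^ k * V x t * (1 / 2) ^ j)"
      by (simp add: ennreal_mult''[symmetric] ennreal_leI)
  qed
  also have "\<dots> = ennreal (A * 2 ^ k * V x t * 2)"
  proof (rule suminf_ennreal_eq)
    show "(\<lambda>j. A * 2 ^ k * V x t * (1 / 2) ^ j) sums (A * 2 ^ k * V x t * 2)"
      using sums_mult[OF geometric_sums[of "1/2 :: real"], of "A * 2 ^ k * V x t"] by simp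
  qed (use A in auto)
  finally show ?thesis by (simp add: algebra_simps)
qed

text \<open>Each factor 1 / V x t is exchanged for 1 / V y t at the price of k orders of decay; the
  k + 1 orders left over are integrable. Applied with p = 1 and p = 2.\<close>

lemma decay_V_integral:
  assumes t: "0 < t"
  shows "(\<integral>\<^sup>+x. ennreal (decay (p * k + (k + 1)) t x y / V x t ^ p) \<partial>mu) \<le> ennreal (A ^ p * (A * 2 ^ (k + 1)) * V y t / V y t ^ p)"
proof -
  have "(\<integral>\<^sup>+x. ennreal (decay (p * k + (k + 1)) t x y / V x t ^ p) \<partial>mu)
     \<le> (\<integral>\<^sup>+x. ennreal (A ^ p / V y t ^ p) * ennreal (decay (k + 1) t y x) \<partial>mu)"
  proof (intro nn_integral_mono)
    fix x
    have pos: "0 < 1 + dist x y / t" using t by (intro add_pos_nonneg) auto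
    have "(1 / V x t) ^ p \<le> (A * (1 + dist x y / t) ^ k / V y t) ^ p"
      using inverse_V_compare[OF t, of x y] by (intro power_mono) auto
    then have "decay (p * k + (k + 1)) t x y * (1 / V x t) ^ p 
       \<le> decay (p * k + (k + 1)) t x y * (A * (1 + dist x y / t) ^ k / V y t) ^ p"
      using t by (intro mult_left_mono) auto
    also have "\<dots> = (decay (p * k) t x y * ((1 + dist x y / t) ^ k) ^ p) * (A ^ p / V y t ^ p * decay (k + 1) t y x)"
      unfolding decay_add by (simp add: decay_commute[of _ t y x] power_divide power_mult_distrib algebra_simps)
    also have "decay (p * k) t x y * ((1 + dist x y / t) ^ k) ^ p = 1"
      using pos by (simp add: decay_def power_mult[symmetric] mult.commute)
    finally show "ennreal (decay (p * k + (k + 1)) t x y / V x t ^ p) \<le> ennreal (A ^ p / V y t ^ p) * ennreal (decay (k + 1) t y x)"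
      using t A by (simp add: ennreal_mult[symmetric] power_one_over divide_inverse power_inverse ennreal_leI)
  qed
  also have "\<dots> = ennreal (A ^ p / V y t ^ p) * (\<integral>\<^sup>+x. ennreal (decay (k + 1) t y x) \<partial>mu)"
    by (intro nn_integral_cmult) measurable
  also have "\<dots> \<le> ennreal (A ^ p / V y t ^ p) * ennreal (A * 2 ^ (k + 1) * V y t)"
    by (intro mult_left_mono decay_integral t) auto
  also have "\<dots> = ennreal (A ^ p * (A * 2 ^ (k + 1)) * V y t / V y t ^ p)"
    using A by (subst ennreal_mult[symmetric]) (auto simp: algebra_simps)
  finally show ?thesis .
qed

text \<open>Tonelli's theorem and the symmetry of the relation dist x y < t.\<close>

lemma average_swap:
  assumes t: "0 < t" and F[measurable]: "F \<in> borel_measurable mu"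
  shows "(\<integral>\<^sup>+x. ennreal (1 / V x t) * (\<integral>\<^sup>+y. indicator (ball x t) y * F y \<partial>mu) \<partial>mu)
    = (\<integral>\<^sup>+y. F y * (\<integral>\<^sup>+x. ennreal (1 / V x t) * indicator (ball y t) x \<partial>mu) \<partial>mu)"
proof -
  have "(\<integral>\<^sup>+x. ennreal (1 / V x t) * (\<integral>\<^sup>+y. indicator (ball x t) y * F y \<partial>mu) \<partial>mu)
     = (\<integral>\<^sup>+x. (\<integral>\<^sup>+y. ennreal (1 / V x t) * (indicator (ball x t) y * F y) \<partial>mu) \<partial>mu)"
    by (intro nn_integral_cong nn_integral_cmult[symmetric]) measurable
  also have "\<dots> = (\<integral>\<^sup>+y. (\<integral>\<^sup>+x. ennreal (1 / V x t) * (indicator (ball x t) y * F y) \<partial>mu) \<partial>mu)"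
    by (intro mm.Fubini'[symmetric]) measurable
  also have "\<dots> = (\<integral>\<^sup>+y. F y * (\<integral>\<^sup>+x. ennreal (1 / V x t) * indicator (ball y t) x \<partial>mu) \<partial>mu)"
  proof (intro nn_integral_cong)
    fix y
    have "(\<integral>\<^sup>+x. ennreal (1 / V x t) * (indicator (ball x t) y * F y) \<partial>mu) = (\<integral>\<^sup>+x. F y * (ennreal (1 / V x t) * indicator (ball y t) x) \<partial>mu)"
      by (intro nn_integral_cong) (auto simp: indicator_def dist_commute mult.commute)
    then show "(\<integral>\<^sup>+x. ennreal (1 / V x t) * (indicator (ball x t) y * F y) \<partial>mu) = F y * (\<integral>\<^sup>+x. ennreal (1 / V x t) * indicator (ball y t) x \<partial>mu)"
      by (simp add: nn_integral_cmult)
  qed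
  finally show ?thesis .
qed

text \<open>Neighbouring balls of equal radius have comparable volumes, so 1 / V x t integrates over
  \<open>ball y t\<close> to a quantity comparable to 1. This and \<open>average_upper\<close> pass
  between local and global norms without a covering.\<close>

lemma average_lower:
  assumes t: "0 < t" and F [measurable]: "F \<in> borel_measurable mu"
  shows "(\<integral>\<^sup>+y. F y \<partial>mu) \<le> ennreal (A * 2 ^ k) * (\<integral>\<^sup>+x. ennreal (1 / V x t) * (\<integral>\<^sup>+y. indicator (ball x t) y * F y \<partial>mu) \<partial>mu)"
proof -
  have 1: "1 \<le> ennreal (A * 2 ^ k) * (\<integral>\<^sup>+x. ennreal (1 / V x t) * indicator (ball y t) x \<partial>mu)" for y
  proof -
    have "ennreal (1 / (A * 2 ^ k * V y t)) * emeasure mu (ball y t) = (\<integral>\<^sup>+x. ennreal (1 / (A * 2 ^ k * V y t)) * indicator (ball y t) x \<partial>mu)"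
      by (subst nn_integral_cmult_indicator) auto
    also have "\<dots> \<le> (\<integral>\<^sup>+x. ennreal (1 / V x t) * indicator (ball y t) x \<partial>mu)"
    proof (intro nn_integral_mono)
      fix x
      show "ennreal (1 / (A * 2 ^ k * V y t)) * indicator (ball y t) x \<le> ennreal (1 / V x t) * indicator (ball y t) x"
        using V_near[OF t, of y x] V_pos[OF t, of x] V_pos[OF t, of y] A
        by (auto simp: indicator_def intro!: ennreal_leI divide_left_mono)
    qed
    finally have "ennreal (A * 2 ^ k) * (ennreal (1 / (A * 2 ^ k * V y t)) * emeasure mu (ball y t)) \<le> ennreal (A * 2 ^ k) * (\<integral>\<^sup>+x. ennreal (1 / V x t) * indicator (ball y t) x \<partial>mu)"
      by (intro mult_left_mono) auto
    moreover have "ennreal (A * 2 ^ k) * (ennreal (1 / (A * 2 ^ k * V y t)) * emeasure mu (ball y t)) = 1"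
      using V_pos[OF t, of y] A by (simp add: emeasure_ball ennreal_mult[symmetric])
    ultimately show ?thesis by simp
  qed
  have "(\<integral>\<^sup>+y. F y \<partial>mu) \<le> (\<integral>\<^sup>+y. ennreal (A * 2 ^ k) * (F y * (\<integral>\<^sup>+x. ennreal (1 / V x t) * indicator (ball y t) x \<partial>mu)) \<partial>mu)"
    using mult_left_mono[OF 1, of "F _"] by (intro nn_integral_mono) (simp add: mult.left_commute)
  also have "\<dots> = ennreal (A * 2 ^ k) * (\<integral>\<^sup>+y. F y * (\<integral>\<^sup>+x. ennreal (1 / V x t) * indicator (ball y t) x \<partial>mu) \<partial>mu)"
    by (intro nn_integral_cmult) measurable
  finally show ?thesis unfolding average_swap[OF assms] .
qed

lemma average_upper:
  assumes t: "0 < t" and F: "F \<in> borel_measurable mu"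
  shows "(\<integral>\<^sup>+x. ennreal (1 / V x t) * (\<integral>\<^sup>+y. indicator (ball x t) y * F y \<partial>mu) \<partial>mu) \<le> ennreal (A * 2 ^ k) * (\<integral>\<^sup>+y. F y \<partial>mu)"
proof -
  have 1: "(\<integral>\<^sup>+x. ennreal (1 / V x t) * indicator (ball y t) x \<partial>mu) \<le> ennreal (A * 2 ^ k)" for y
  proof -
    have "(\<integral>\<^sup>+x. ennreal (1 / V x t) * indicator (ball y t) x \<partial>mu) \<le> (\<integral>\<^sup>+x. ennreal (A * 2 ^ k / V y t) * indicator (ball y t) x \<partial>mu)"
    proof (intro nn_integral_mono)
      fix x
      show "ennreal (1 / V x t) * indicator (ball y t) x \<le> ennreal (A * 2 ^ k / V y t) * indicator (ball y t) x"
        using V_near[OF t, of x y] V_pos[OF t, of x] V_pos[OF t, of y] A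
        by (auto simp: indicator_def dist_commute field_simps intro!: ennreal_leI)
    qed
    also have "\<dots> = ennreal (A * 2 ^ k / V y t) * emeasure mu (ball y t)"
      by (subst nn_integral_cmult_indicator) auto
    also have "\<dots> = ennreal (A * 2 ^ k)"
      using V_pos[OF t, of y] A by (simp add: emeasure_ball ennreal_mult[symmetric])
    finally show ?thesis .
  qed
  have "(\<integral>\<^sup>+y. F y * (\<integral>\<^sup>+x. ennreal (1 / V x t) * indicator (ball y t) x \<partial>mu) \<partial>mu) \<le> (\<integral>\<^sup>+y. F y * ennreal (A * 2 ^ k) \<partial>mu)"
    by (intro nn_integral_mono mult_left_mono 1) auto
  also have "\<dots> = ennreal (A * 2 ^ k) * (\<integral>\<^sup>+y. F y \<partial>mu)"
    using F by (simp add: nn_integral_multc mult.commute)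
  finally show ?thesis unfolding average_swap[OF assms] .
qed

end

text \<open>The exponent is rounded up to a natural number to match the polynomial weights, and the
  constant is raised to at least 1.\<close>

lemma doubling_mms_doubling:
  assumes "doubling_mms mu"
  shows "\<exists>k A. doubling mu k A"
proof -
  obtain n CD :: real where n: "n > 0" and 
    "\<forall>x r \<alpha>. r > 0 \<longrightarrow> \<alpha> \<ge> 1 \<longrightarrow> emeasure mu (ball x (\<alpha> * r)) \<le> ennreal (CD * \<alpha> powr n) * emeasure mu (ball x r)"
    using assms unfolding doubling_mms_def by blast
  then have D: "\<And>x r \<alpha>. r > 0 \<Longrightarrow> \<alpha> \<ge> 1 \<Longrightarrow> emeasure mu (ball x (\<alpha> * r)) \<le> ennreal (CD * \<alpha> powr n) * emeasure mu (ball x r)"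
    by blast
  have ball: "\<And>x r. r > 0 \<Longrightarrow> 0 < emeasure mu (ball x r) \<and> emeasure mu (ball x r) < \<infinity>"
    using assms by (auto simp: doubling_mms_def)
  define A where "A = max CD 1"
  define k where "k = nat \<lceil>n\<rceil>"
  have fin: "emeasure mu (ball x r) < \<infinity>" for x r
    using ball[of r x] by (cases "r > 0") (auto simp: not_less ball_empty)
  then have e: "emeasure mu (ball x r) = ennreal (measure mu (ball x r))" for x r
    by (simp add: emeasure_eq_ennreal_measure less_top)
  have "measure mu (ball x (\<alpha> * r)) \<le> A * \<alpha> ^ k * measure mu (ball x r)" if "r > 0" "\<alpha> \<ge> 1" for x r \<alpha>
  proof -
    have "\<alpha> powr n \<le> \<alpha> powr (real k)" using that n by (intro powr_mono) (auto simp: k_def)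
    then have *: "\<alpha> powr n \<le> \<alpha> ^ k" using that by (simp add: powr_realpow)
    have "CD * \<alpha> powr n \<le> A * \<alpha> powr n" by (intro mult_right_mono) (auto simp: A_def)
    also have "\<dots> \<le> A * \<alpha> ^ k" using * by (intro mult_left_mono) (auto simp: A_def)
    finally have "ennreal (CD * \<alpha> powr n) * emeasure mu (ball x r) \<le> ennreal (A * \<alpha> ^ k) * emeasure mu (ball x r)"
      by (intro mult_right_mono ennreal_leI) auto
    with D[OF that, of x] have "ennreal (measure mu (ball x (\<alpha> * r))) \<le> ennreal (A * \<alpha> ^ k * measure mu (ball x r))"
      unfolding e using that by (subst ennreal_mult) (auto simp: A_def intro: order_trans)
    then show ?thesis using that by (subst (asm) ennreal_le_iff) (auto simp: A_def)
  qed
  then have "doubling mu k A"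
    by unfold_locales (use assms ball fin in \<open>auto simp: doubling_mms_def A_def\<close>)
  then show ?thesis by blast
qed

subsection \<open>Off-diagonal estimates\<close>

lemma exp_le_poly:
  fixes c q s :: real
  assumes "0 < c" "1 \<le> q" "0 \<le> s"
  shows "exp (- c * s powr q) \<le> exp c * (1 + real (N + 1) / c) ^ N * inverse ((1 + s) ^ N)"
proof -
  \<comment> \<open>Reduces to a linear exponent at the cost of the factor
    \<open>exp c\<close>.\<close>
  have "s \<le> 1 + s powr q"
  proof (cases "s \<le> 1")
    case False
    then have "s powr 1 \<le> s powr q" using assms by (intro powr_mono) auto
    then show ?thesis using False by simp
  qed (simp add: add_increasing2)
  then have "c * s \<le> c * (1 + s powr q)" using assms by (intro mult_left_mono) auto
  then have 1: "exp (- c * s powr q) \<le> exp c * exp (- (c * s))"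
    unfolding exp_add[symmetric] by (simp add: algebra_simps)
  \<comment> \<open>Chosen so that N factors exp (c' * s) together cost at most exp (c * s); N + 1
    keeps the quotient meaningful for N = 0.\<close>
  define c' where "c' = c / real (N + 1)"
  have c': "0 < c'" "real N * c' \<le> c" using assms by (auto simp: c'_def field_simps)
  have "1 + s \<le> (1 + 1 / c') * (1 + c' * s)" using assms c' by (simp add: field_simps)
  also have "\<dots> \<le> (1 + 1 / c') * exp (c' * s)" using c' exp_ge_add_one_self[of "c' * s"] by (intro mult_left_mono) auto
  finally have "(1 + s) ^ N \<le> ((1 + 1 / c') * exp (c' * s)) ^ N" using assms by (intro power_mono) auto
  also have "\<dots> = (1 + 1 / c') ^ N * exp (real N * c' * s)"
    by (simp add: power_mult_distrib exp_of_nat_mult[symmetric] mult.assoc)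
  also have "\<dots> \<le> (1 + 1 / c') ^ N * exp (c * s)"
    using c' assms by (intro mult_left_mono) (auto intro!: mult_right_mono)
  finally have "(1 + s) ^ N \<le> (1 + real (N + 1) / c) ^ N * exp (c * s)" by (simp add: c'_def)
  then have "exp (- (c * s)) \<le> (1 + real (N + 1) / c) ^ N * inverse ((1 + s) ^ N)"
    using assms by (simp add: exp_minus divide_simps mult.commute)
  then have "exp c * exp (- (c * s)) \<le> exp c * ((1 + real (N + 1) / c) ^ N * inverse ((1 + s) ^ N))"
    by (intro mult_left_mono) auto
  from order_trans[OF 1 this] show ?thesis by (simp add: mult.assoc)
qed

lemma Lp_norm_2: 
  assumes "f \<in> L2 mu" shows "Lp_norm mu 2 f = ennreal (L2_norm mu f)"
proof -
  have "(\<integral>\<^sup>+ x. ennreal (cmod (f x) powr 2) \<partial>mu) = (\<integral>\<^sup>+ x. ennreal ((cmod (f x))\<^sup>2) \<partial>mu)" by simp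
  also have "\<dots> = ennreal ((L2_norm mu f)\<^sup>2)" by (rule nn_integral_L2[OF assms])
  finally show ?thesis by (simp add: Lp_norm_def enn_root_def powr_half_sqrt)
qed

lemma Lp_norm_1: 
  assumes "integrable mu f" shows "Lp_norm mu 1 f = ennreal (\<integral>x. cmod (f x) \<partial>mu)"
proof -
  have "(\<integral>\<^sup>+ x. ennreal (cmod (f x) powr 1) \<partial>mu) = ennreal (\<integral>x. cmod (f x) \<partial>mu)" 
    using assms by (simp add: nn_integral_eq_integral integrable_norm)
  moreover have "0 \<le> (\<integral>x. cmod (f x) \<partial>mu)" by simp
  ultimately show ?thesis by (simp add: Lp_norm_def enn_root_def)
qed

text \<open>The geometric mean of two bounds; it merges a spatially decaying bound with one decaying
  in time.\<close>

lemma sq_le_mult_imp_le: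
  fixes X :: real
  assumes "0 \<le> X" "X \<le> a" "X \<le> b" "a * b \<le> c\<^sup>2" "0 \<le> c"
  shows "X \<le> c"
proof -
  have "X * X \<le> a * b" using assms by (intro mult_mono) auto
  then have "X\<^sup>2 \<le> c\<^sup>2" using assms by (simp add: power2_eq_square)
  then show ?thesis by (rule power2_le_imp_le) (fact assms(5))
qed

locale heat_gge = gapped mu D L \<delta> + doubling mu k A
  for mu :: "'a::metric_space measure" and D :: "('a \<Rightarrow> complex) set" and L :: "('a \<Rightarrow> complex) \<Rightarrow> 'a \<Rightarrow> complex"
    and \<delta> :: real and k :: nat and A :: real +
  fixes m :: real and P :: "real \<Rightarrow> ('a \<Rightarrow> complex) \<Rightarrow> 'a \<Rightarrow> complex"
  assumes m: "m \<ge> 2"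
    and orbit: "f \<in> L2 mu \<Longrightarrow> sol (\<lambda>t. P t f)"
    and orbit_0: "f \<in> L2 mu \<Longrightarrow> AE x in mu. P 0 f x = f x"
    and gge: "GGE mu m 1 P"
begin

lemma orbit_L2: "f \<in> L2 mu \<Longrightarrow> 0 \<le> t \<Longrightarrow> P t f \<in> L2 mu" using orbit sol_L2 by blast
lemma orbit_L_L2: "f \<in> L2 mu \<Longrightarrow> 0 < t \<Longrightarrow> L (P t f) \<in> L2 mu" using orbit sol_L_L2 by blast

text \<open>GGE measures its input in \<open>L^1\<close>; on a ball of finite measure \<bar>f\<bar>
  \<le> 1 + \<bar>f\<bar>^2 provides integrability.\<close>

lemma L2_bounded_support_integrable:
  assumes f: "f \<in> L2 mu" and 0: "\<And>y. y \<notin> ball z t \<Longrightarrow> f y = 0"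
  shows "integrable mu f"
proof (rule Bochner_Integration.integrable_bound)
  show "integrable mu (\<lambda>y. indicator (ball z t) y + (cmod (f y))\<^sup>2 :: real)"
    using f by (intro Bochner_Integration.integrable_add) (auto simp: L2_iff emeasure_ball)
  show "AE y in mu. norm (f y) \<le> norm (indicator (ball z t) y + (cmod (f y))\<^sup>2 :: real)"
  proof (rule always_eventually, rule allI)
    fix y
    have "cmod (f y) \<le> 1 + (cmod (f y))\<^sup>2"
      using sum_squares_bound[of 1 "cmod (f y)"] norm_ge_zero[of "f y"] unfolding power_one mult_1_right by linarith
    then show "norm (f y) \<le> norm (indicator (ball z t) y + (cmod (f y))\<^sup>2 :: real)"
      using 0[of y] by (cases "y \<in> ball z t") (auto simp: indicator_def)
  qed
qed (use f in \<open>simp add: L2_measurable\<close>)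

text \<open>The form in which GGE is used: input living on a ball, Gaussian factor traded for a
  weight of any order N. The trade is possible because m / (m - 1) \<ge> 1.\<close>

lemma gge_decay:
  "\<exists>C>0. \<forall>x z t h. 0 < t \<longrightarrow> h \<in> L2 mu \<longrightarrow> (\<forall>y. y \<notin> ball z t \<longrightarrow> h y = 0) \<longrightarrow>
     L2_norm mu (\<lambda>y. indicator (ball x t) y * P (t powr m) h y) \<le> C * decay N t x z / sqrt (V x t) * (\<integral>y. cmod (h y) \<partial>mu)"
proof -
  obtain C c where C: "C > 0" "c > 0" and
    *: "\<forall>x y t f. t > 0 \<longrightarrow> f \<in> L2 mu \<longrightarrow>
          Lp_norm mu 2 (\<lambda>z. indicator (ball x t) z * P (t powr m) (\<lambda>w. indicator (ball y t) w * f w) z)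
          \<le> ennreal (C * (measure mu (ball x t)) powr (-(1 / 1 - 1 / 2)) * exp (- c * (dist x y / t) powr (m / (m - 1))))
            * Lp_norm mu 1 f"
    using gge unfolding GGE_def by blast
  define K where "K = exp c * (1 + real (N + 1) / c) ^ N"
  have K: "K > 0" using C by (auto simp: K_def intro!: mult_pos_pos zero_less_power add_pos_nonneg)
  show ?thesis
  proof (rule exI[of _ "C * K"], intro conjI allI impI)
    show "C * K > 0" using C K by simp
    fix x z t h assume t: "0 < t" and h: "h \<in> L2 mu" and supp: "\<forall>y. y \<notin> ball z t \<longrightarrow> h y = (0 :: complex)"
    let ?H = "\<integral>y. cmod (h y) \<partial>mu"
    have eq: "(\<lambda>w. indicator (ball z t) w * h w) = h" using supp by (auto simp: indicator_def fun_eq_iff)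
    have "integrable mu h" using L2_bounded_support_integrable[OF h, of z t] supp by blast
    note n1 = Lp_norm_1[OF this]
    have L: "(\<lambda>y. indicator (ball x t) y * P (t powr m) h y) \<in> L2 mu"
      using h by (intro L2_indicator orbit_L2) auto
    have "ennreal (L2_norm mu (\<lambda>y. indicator (ball x t) y * P (t powr m) h y))
      \<le> ennreal (C * V x t powr (-(1 / 1 - 1 / 2)) * exp (- c * (dist x z / t) powr (m / (m - 1)))) * ennreal ?H"
      using *[rule_format, OF t h, of x z] unfolding eq n1 Lp_norm_2[OF L] .
    then have "L2_norm mu (\<lambda>y. indicator (ball x t) y * P (t powr m) h y)
      \<le> C * V x t powr (-(1 / 1 - 1 / 2)) * exp (- c * (dist x z / t) powr (m / (m - 1))) * ?H"
      using C by (subst (asm) ennreal_mult[symmetric]) auto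
    also have "V x t powr (-(1 / 1 - 1 / 2)) = 1 / sqrt (V x t)"
      using V_pos[OF t, of x] powr_minus[of "V x t" "1 / 2"] powr_half_sqrt[of "V x t"] by (simp add: inverse_eq_divide)
    also have "C * (1 / sqrt (V x t)) * exp (- c * (dist x z / t) powr (m / (m - 1))) * ?H
       \<le> C * (1 / sqrt (V x t)) * (K * decay N t x z) * ?H"
      unfolding K_def decay_def using C m t V_pos[OF t, of x] by (intro mult_right_mono mult_left_mono exp_le_poly) auto
    finally show "L2_norm mu (\<lambda>y. indicator (ball x t) y * P (t powr m) h y) \<le> C * K * decay N t x z / sqrt (V x t) * ?H"
      by simp
  qed
qed

text \<open>Averaging the squared local bounds over x removes the outer localization. Squaring gives
  one factor 1 / V x t and averaging a second, hence the order \<open>2 * k + (k + 1)\<close> and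
  \<open>decay_V_integral\<close> with p = 2.\<close>

lemma gge_global:
  "\<exists>C>0. \<forall>z t h. 0 < t \<longrightarrow> h \<in> L2 mu \<longrightarrow> (\<forall>y. y \<notin> ball z t \<longrightarrow> h y = 0) \<longrightarrow>
     L2_norm mu (P (t powr m) h) \<le> C / sqrt (V z t) * (\<integral>y. cmod (h y) \<partial>mu)"
proof -
  let ?N = "2 * k + (k + 1)"
  obtain C where C: "C > 0" and *: "\<And>x z t h. 0 < t \<Longrightarrow> h \<in> L2 mu \<Longrightarrow> (\<forall>y. y \<notin> ball z t \<longrightarrow> h y = 0) \<Longrightarrow>
     L2_norm mu (\<lambda>y. indicator (ball x t) y * P (t powr m) h y) \<le> C * decay ?N t x z / sqrt (V x t) * (\<integral>y. cmod (h y) \<partial>mu)"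
    using gge_decay[of ?N] by blast
  define K where "K = (A * 2 ^ k) * C\<^sup>2 * (A\<^sup>2 * (A * 2 ^ (k + 1)))"
  have K: "K > 0" using A C by (simp add: K_def)
  show ?thesis
  proof (rule exI[of _ "sqrt K"], intro conjI allI impI)
    show "sqrt K > 0" using K by simp
    fix z t h assume t: "0 < t" and h: "h \<in> L2 mu" and supp: "\<forall>y. y \<notin> ball z t \<longrightarrow> h y = (0 :: complex)"
    define H where "H = (\<integral>y. cmod (h y) \<partial>mu)"
    let ?u = "P (t powr m) h"
    have u: "?u \<in> L2 mu" using h by (intro orbit_L2) auto
    have H: "H \<ge> 0" by (simp add: H_def)
    note [measurable] = L2_measurable[OF u]
    have "ennreal ((L2_norm mu ?u)\<^sup>2) \<le> ennreal (A * 2 ^ k) * (\<integral>\<^sup>+x. ennreal (1 / V x t) * (\<integral>\<^sup>+y. indicator (ball x t) y * ennreal ((cmod (?u y))\<^sup>2) \<partial>mu) \<partial>mu)"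
      unfolding nn_integral_L2[OF u, symmetric] by (intro average_lower t) measurable
    also have "\<dots> \<le> ennreal (A * 2 ^ k) * (\<integral>\<^sup>+x. ennreal (C\<^sup>2 * H\<^sup>2) * ennreal (decay ?N t x z / V x t ^ 2) \<partial>mu)"
    proof (intro mult_left_mono nn_integral_mono)
      fix x
      let ?v = "\<lambda>y. indicator (ball x t) y * ?u y"
      have v: "?v \<in> L2 mu" using u by (intro L2_indicator) auto
      have Vx: "V x t > 0" using t by (rule V_pos)
      have "(\<integral>\<^sup>+y. indicator (ball x t) y * ennreal ((cmod (?u y))\<^sup>2) \<partial>mu) = (\<integral>\<^sup>+y. ennreal ((cmod (?v y))\<^sup>2) \<partial>mu)"
        by (intro nn_integral_cong) (auto simp: indicator_def)
      also have "\<dots> = ennreal ((L2_norm mu ?v)\<^sup>2)" by (rule nn_integral_L2[OF v])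
      also have "\<dots> \<le> ennreal ((C * decay ?N t x z / sqrt (V x t) * H)\<^sup>2)"
        unfolding H_def by (intro ennreal_leI power_mono *[OF t h supp]) auto
      also have "(C * decay ?N t x z / sqrt (V x t) * H)\<^sup>2 = C\<^sup>2 * H\<^sup>2 * (decay ?N t x z)\<^sup>2 / V x t"
        using Vx by (simp add: power_mult_distrib power_divide)
      also have "\<dots> \<le> C\<^sup>2 * H\<^sup>2 * decay ?N t x z / V x t"
      proof -
        have "(decay ?N t x z)\<^sup>2 \<le> decay ?N t x z"
          using decay_le_1[OF t, of ?N x z] t by (simp add: power2_eq_square mult_left_le)
        then show ?thesis using Vx by (intro divide_right_mono mult_left_mono) auto
      qed
      finally have "(\<integral>\<^sup>+y. indicator (ball x t) y * ennreal ((cmod (?u y))\<^sup>2) \<partial>mu) \<le> ennreal (C\<^sup>2 * H\<^sup>2 * decay ?N t x z / V x t)"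
        by (simp add: ennreal_leI)
      then have "ennreal (1 / V x t) * (\<integral>\<^sup>+y. indicator (ball x t) y * ennreal ((cmod (?u y))\<^sup>2) \<partial>mu)
         \<le> ennreal (1 / V x t) * ennreal (C\<^sup>2 * H\<^sup>2 * decay ?N t x z / V x t)"
        by (rule mult_left_mono) auto
      also have "\<dots> = ennreal (C\<^sup>2 * H\<^sup>2) * ennreal (decay ?N t x z / V x t ^ 2)"
        using Vx t by (simp add: ennreal_mult[symmetric] power2_eq_square)
      finally show "ennreal (1 / V x t) * (\<integral>\<^sup>+y. indicator (ball x t) y * ennreal ((cmod (?u y))\<^sup>2) \<partial>mu) \<le> \<dots>" .
    qed auto
    also have "\<dots> = ennreal (A * 2 ^ k) * (ennreal (C\<^sup>2 * H\<^sup>2) * (\<integral>\<^sup>+x. ennreal (decay ?N t x z / V x t ^ 2) \<partial>mu))"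
      by (subst nn_integral_cmult) auto
    also have "\<dots> \<le> ennreal (A * 2 ^ k) * (ennreal (C\<^sup>2 * H\<^sup>2) * ennreal (A ^ 2 * (A * 2 ^ (k + 1)) * V z t / V z t ^ 2))"
      by (intro mult_left_mono decay_V_integral t) auto
    also have "\<dots> = ennreal (K * H\<^sup>2 / V z t)"
      using A V_pos[OF t, of z] by (simp add: ennreal_mult[symmetric] K_def power2_eq_square[of "V z t"] mult_ac)
    finally have "(L2_norm mu ?u)\<^sup>2 \<le> K * H\<^sup>2 / V z t" using K H by (subst (asm) ennreal_le_iff) auto
    also have "\<dots> = (sqrt K / sqrt (V z t) * H)\<^sup>2" using K V_pos[OF t, of z] by (simp add: power_mult_distrib power_divide)
    finally show "L2_norm mu ?u \<le> sqrt K / sqrt (V z t) * (\<integral>y. cmod (h y) \<partial>mu)"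
      unfolding H_def by (rule power2_le_imp_le) (use K in auto)
  qed
qed

text \<open>For \<open>h\<close> living on a ball of radius \<open>t / 4\<close> the orbit decays both off the diagonal and
  exponentially in time; the geometric mean of the two bounds is fed into the interpolation
  inequality with an increment that is itself polynomially small off the diagonal.\<close>
lemma localized_derivative_bound:
  "\<exists>C>0. \<forall>x z t h. 0 < t \<longrightarrow> h \<in> L2 mu \<longrightarrow> (\<forall>y. y \<notin> ball z (t / 4) \<longrightarrow> h y = 0) \<longrightarrow>
     t powr m * L2_norm mu (\<lambda>y. indicator (ball x t) y * L (P (t powr m) h) y)
       \<le> C * exp (- (\<delta> / 16) * t powr m) * decay M t x z / sqrt (V x t) * (\<integral>y. cmod (h y) \<partial>mu)"
proof -
  \<comment> \<open>The orders are found backwards, with S = 1 + dist x z / t and step h0 = T / S^J.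
    The global term h0 * S^k needs J = M + k; the local term S^(-J2) / h0 needs J2 = J + M; and the
    geometric mean of S^k and S^(-N) is S^(-J2) when N = k + 2 * J2.\<close>
  define J where "J = M + k"
  define J2 where "J2 = J + M"
  define N where "N = k + 2 * J2"
  obtain C1 where C1: "C1 > 0" and gd: "\<And>x z t h. 0 < t \<Longrightarrow> h \<in> L2 mu \<Longrightarrow> (\<forall>y. y \<notin> ball z t \<longrightarrow> h y = 0) \<Longrightarrow>
     L2_norm mu (\<lambda>y. indicator (ball x t) y * P (t powr m) h y) \<le> C1 * decay N t x z / sqrt (V x t) * (\<integral>y. cmod (h y) \<partial>mu)"
    using gge_decay[of N] by blast
  obtain C2 where C2: "C2 > 0" and gg: "\<And>z t h. 0 < t \<Longrightarrow> h \<in> L2 mu \<Longrightarrow> (\<forall>y. y \<notin> ball z t \<longrightarrow> h y = 0) \<Longrightarrow>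
     L2_norm mu (P (t powr m) h) \<le> C2 / sqrt (V z t) * (\<integral>y. cmod (h y) \<partial>mu)"
    using gge_global by blast
  define C3 where "C3 = C2 * A * 2 ^ k"
  define C4 where "C4 = C1 * 2 ^ N + C3"
  have C3: "C3 > 0" using C2 A by (simp add: C3_def)
  have C4: "C4 > 0" using C1 C3 by (simp add: C4_def add_pos_pos)
  show ?thesis
  proof (rule exI[of _ "2 * C4 + 8 * C3"], intro conjI allI impI)
    show "2 * C4 + 8 * C3 > 0" using C3 C4 by simp
    fix x z t h assume t: "0 < t" and h: "h \<in> L2 mu" and supp: "\<forall>y. y \<notin> ball z (t / 4) \<longrightarrow> h y = (0 :: complex)"
    define T where "T = t powr m"
    define S where "S = 1 + dist x z / t"
    define H where "H = (\<integral>y. cmod (h y) \<partial>mu)"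
    define Q where "Q = H / sqrt (V x t)"
    define u where "u = (\<lambda>s. P s h)"
    have u: "sol u" using orbit[OF h] by (simp add: u_def)
    have T: "0 < T" using t by (simp add: T_def)
    have S: "1 \<le> S" using t by (simp add: S_def)
    have H: "0 \<le> H" by (simp add: H_def)
    have Vx: "0 < V x t" using t by (rule V_pos)
    have Q: "0 \<le> Q" using H Vx by (simp add: Q_def)
    \<comment> \<open>This is where m \<ge> 2 yields 4^m \<ge> 16.\<close>
    have rho: "(t / 4) powr m \<le> T / 16"
    proof -
      have "(4::real) powr 2 \<le> 4 powr m" using m by (intro powr_mono) auto
      then have "T / 4 powr m \<le> T / 4 powr 2" using T by (intro divide_left_mono) auto
      then show ?thesis using t by (simp add: T_def powr_divide)
    qed
    \<comment> \<open>\<open>gge_global\<close> at radius t / 4 needs the time (t / 4)^m, at most T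
      / 16. From there until s \<ge> T / 4 at least T / 8 remains, which gives the rate \<delta> /
      8.\<close>
    have b: "L2_norm mu (u s) \<le> C3 * exp (- (\<delta> / 8) * T) * S ^ k * Q" if s: "T / 4 \<le> s" for s
    proof -
      have "L2_norm mu (u s) \<le> exp (- \<delta> * (s - (t / 4) powr m)) * L2_norm mu (u ((t / 4) powr m))"
        using rho s T by (intro sol_decay u) auto
      also have "\<dots> \<le> exp (- (\<delta> / 8) * T) * (C2 / sqrt (V z (t / 4)) * H)"
      proof (rule mult_mono)
        have "T / 8 \<le> s - (t / 4) powr m" using rho s T by linarith
        then have "\<delta> * (T / 8) \<le> \<delta> * (s - (t / 4) powr m)" using \<delta>_pos by (intro mult_left_mono) auto
        then show "exp (- \<delta> * (s - (t / 4) powr m)) \<le> exp (- (\<delta> / 8) * T)" by simp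
        show "L2_norm mu (u ((t / 4) powr m)) \<le> C2 / sqrt (V z (t / 4)) * H"
          unfolding u_def H_def using t by (intro gg h supp) auto
      qed auto
      also have "C2 / sqrt (V z (t / 4)) * H \<le> C3 * S ^ k * Q"
      proof -
        have "V z t \<le> A * 4 ^ k * V z (t / 4)" using V_scale[of "t / 4" t z] t by simp
        moreover have "V x t \<le> A * S ^ k * V z t" using V_compare[OF t, of x z] by (simp add: S_def dist_commute)
        ultimately have "V x t \<le> A * S ^ k * (A * 4 ^ k * V z (t / 4))"
          using A S by (elim order_trans) (intro mult_left_mono, auto)
        \<comment> \<open>A perfect square is arranged for the square root that follows; S^(k / 2)
          is rounded up to S^k, which the free order N can afford.\<close>
        also have "\<dots> \<le> (A * 2 ^ k * S ^ k)\<^sup>2 * V z (t / 4)"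
        proof -
          have "S ^ k \<le> (S ^ k)\<^sup>2" using S by (simp add: power2_eq_square mult_le_cancel_left1 one_le_power)
          moreover have "(2 ^ k)\<^sup>2 = (4 :: real) ^ k" by (simp add: power2_eq_square power_mult_distrib[symmetric])
          ultimately have "A * S ^ k * (A * 4 ^ k) \<le> (A * 2 ^ k * S ^ k)\<^sup>2"
            using A by (simp add: power_mult_distrib power2_eq_square[of A] mult_ac)
          from mult_right_mono[OF this, of "V z (t / 4)"] show ?thesis by (simp add: mult_ac)
        qed
        finally have "sqrt (V x t) \<le> A * 2 ^ k * S ^ k * sqrt (V z (t / 4))"
          using A S real_sqrt_le_mono by (fastforce simp: real_sqrt_mult)
        moreover have "0 < sqrt (V z (t / 4))" "0 < sqrt (V x t)" using t by (auto intro!: V_pos)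
        ultimately have "1 / sqrt (V z (t / 4)) \<le> A * 2 ^ k * S ^ k / sqrt (V x t)" by (simp add: field_simps)
        then have "(C2 * H) * (1 / sqrt (V z (t / 4))) \<le> (C2 * H) * (A * 2 ^ k * S ^ k / sqrt (V x t))"
          using C2 H by (intro mult_left_mono) auto
        then show ?thesis by (simp add: C3_def Q_def mult_ac)
      qed
      finally show ?thesis by (simp add: mult_ac)
    qed
    have a: "L2_norm mu (\<lambda>y. indicator (ball x t) y * u s y) \<le> C4 * Q * exp (- (\<delta> / 16) * T) / S ^ J2" if s: "T \<le> s" "s \<le> 2 * T" for s
    \<comment> \<open>The two bounds are the global one \<open>b\<close>, growing like S^k but
      decaying in T, and the off-diagonal one. Their geometric mean halves the rate \<delta> / 8 to
      \<delta> / 16.\<close>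
    proof (rule sq_le_mult_imp_le)
      \<comment> \<open>The length scale belonging to the time s. It lies between t and 2 * t, so
        returning to scale t costs at most 2^N.\<close>
      define r where "r = s powr (1 / m)"
      have rm: "r powr m = s" using s T m by (simp add: r_def powr_powr)
      have "T powr (1 / m) = t" using t m by (simp add: T_def powr_powr)
      then have r1: "t \<le> r" unfolding r_def using powr_mono2[of "1 / m" T s] s T m by simp
      have "r \<le> (2 * T) powr (1 / m)" unfolding r_def using s T m by (intro powr_mono2) auto
      also have "\<dots> = 2 powr (1 / m) * t" using \<open>T powr (1 / m) = t\<close> T by (simp add: powr_mult)
      also have "\<dots> \<le> 2 powr 1 * t" using t m by (intro mult_right_mono powr_mono) auto
      finally have r2: "r \<le> 2 * t" by simp
      have r0: "0 < r" using r1 t by simp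
      have uL: "u s \<in> L2 mu" using s T by (intro sol_L2 u) auto
      show "L2_norm mu (\<lambda>y. indicator (ball x t) y * u s y) \<le> C3 * exp (- (\<delta> / 8) * T) * S ^ k * Q"
        by (rule order_trans[OF L2_norm_indicator_le_self[OF uL sets_ball] b]) (use s T in auto)
      have "L2_norm mu (\<lambda>y. indicator (ball x t) y * u s y) \<le> L2_norm mu (\<lambda>y. indicator (ball x r) y * u s y)"
        using r1 by (intro L2_norm_indicator_le uL subset_ball) auto
      also have "\<dots> \<le> C1 * decay N r x z / sqrt (V x r) * H"
        unfolding u_def H_def rm[symmetric] using supp r1 t r0 by (intro gd h) auto
      also have "\<dots> \<le> C1 * (2 ^ N * decay N t x z) / sqrt (V x t) * H"
      proof -
        have "decay N r x z \<le> (r / t) ^ N * decay N t x z" using t r1 by (rule decay_scale)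
        also have "\<dots> \<le> 2 ^ N * decay N t x z" using t r2 r0 by (intro mult_right_mono power_mono) (auto simp: field_simps)
        finally show ?thesis using C1 H Vx V_mono_radius[OF r1, of x] r0 t
          by (intro mult_right_mono frac_le mult_left_mono) (auto simp: less_imp_le[OF decay_pos])
      qed
      also have "\<dots> = C1 * 2 ^ N / S ^ N * Q" by (simp add: decay_def S_def Q_def divide_inverse)
      finally show "L2_norm mu (\<lambda>y. indicator (ball x t) y * u s y) \<le> C1 * 2 ^ N / S ^ N * Q" .
      have e1: "S ^ k / S ^ N = 1 / (S ^ J2)\<^sup>2" using S by (simp add: N_def power_add power_mult[symmetric] mult.commute)
      have e2: "exp (- (\<delta> / 8) * T) = (exp (- (\<delta> / 16) * T))\<^sup>2" by (simp add: exp_double[symmetric])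
      have "C3 * exp (- (\<delta> / 8) * T) * S ^ k * Q * (C1 * 2 ^ N / S ^ N * Q) = (C3 * (C1 * 2 ^ N)) * (Q\<^sup>2 * exp (- (\<delta> / 8) * T) * (S ^ k / S ^ N))"
        by (simp add: power2_eq_square mult_ac)
      also have "\<dots> = (C3 * (C1 * 2 ^ N)) * (Q * exp (- (\<delta> / 16) * T) / S ^ J2)\<^sup>2"
        unfolding e1 e2 by (simp add: power_divide power_mult_distrib)
      also have "\<dots> \<le> C4\<^sup>2 * (Q * exp (- (\<delta> / 16) * T) / S ^ J2)\<^sup>2"
        using C1 C3 by (intro mult_right_mono) (auto simp: C4_def power2_sum add_increasing)
      finally show "C3 * exp (- (\<delta> / 8) * T) * S ^ k * Q * (C1 * 2 ^ N / S ^ N * Q) \<le> (C4 * Q * exp (- (\<delta> / 16) * T) / S ^ J2)\<^sup>2"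
        by (simp add: power_divide power_mult_distrib mult_ac)
      show "0 \<le> C4 * Q * exp (- (\<delta> / 16) * T) / S ^ J2" using C4 Q S by auto
    qed simp
    \<comment> \<open>The step equalizes the powers of S in both terms, and h0 \<le> T keeps T + h0
      in the range where \<open>a\<close> holds.\<close>
    define h0 where "h0 = T / S ^ J"
    have h0: "0 < h0" "h0 \<le> T" using T S by (auto simp: h0_def divide_le_eq mult_le_cancel_left1 one_le_power)
    let ?X = "L2_norm mu (\<lambda>y. indicator (ball x t) y * L (u T) y)"
    have "?X \<le> (L2_norm mu (\<lambda>y. indicator (ball x t) y * u (T + h0) y) + L2_norm mu (\<lambda>y. indicator (ball x t) y * u T y)) / h0
     + 8 * h0 / T\<^sup>2 * L2_norm mu (u (T / 4))"
      by (rule sol_local_derivative[OF u T h0(1)]) simp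
    also have "\<dots> \<le> (C4 * Q * exp (- (\<delta> / 16) * T) / S ^ J2 + C4 * Q * exp (- (\<delta> / 16) * T) / S ^ J2) / h0
     + 8 * h0 / T\<^sup>2 * (C3 * exp (- (\<delta> / 16) * T) * S ^ k * Q)"
    proof (intro add_mono divide_right_mono mult_left_mono a)
      have "exp (- (\<delta> / 8) * T) \<le> exp (- (\<delta> / 16) * T)" using \<delta>_pos T by simp
      then have "C3 * exp (- (\<delta> / 8) * T) * S ^ k * Q \<le> C3 * exp (- (\<delta> / 16) * T) * S ^ k * Q"
        using C3 S Q by (intro mult_right_mono mult_left_mono) auto
      then show "L2_norm mu (u (T / 4)) \<le> C3 * exp (- (\<delta> / 16) * T) * S ^ k * Q"
        using b[of "T / 4"] by linarith
    qed (use h0 T in auto)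
    also have "\<dots> = (2 * C4 + 8 * C3) * Q * exp (- (\<delta> / 16) * T) / S ^ M / T"
      using S T by (simp add: h0_def J2_def J_def power_add field_simps power2_eq_square)
    finally have "T * ?X \<le> (2 * C4 + 8 * C3) * Q * exp (- (\<delta> / 16) * T) / S ^ M"
      by (simp only: pos_le_divide_eq[OF T] mult.commute[of T])
    also have "\<dots> = (2 * C4 + 8 * C3) * exp (- (\<delta> / 16) * T) * decay M t x z / sqrt (V x t) * H"
      by (simp add: Q_def decay_def S_def inverse_eq_divide mult_ac)
    finally show "t powr m * L2_norm mu (\<lambda>y. indicator (ball x t) y * L (P (t powr m) h) y)
       \<le> (2 * C4 + 8 * C3) * exp (- (\<delta> / 16) * t powr m) * decay M t x z / sqrt (V x t) * (\<integral>y. cmod (h y) \<partial>mu)"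
      by (simp add: T_def u_def H_def)
  qed
qed

text \<open>Additivity comes from uniqueness of orbits: both sides start from the same function
  almost everywhere.\<close>

lemma L_orbit_add:
  assumes f: "f \<in> L2 mu" and g: "g \<in> L2 mu" and t: "0 < t"
  shows "AE x in mu. L (P t (\<lambda>y. f y + g y)) x = L (P t f) x + L (P t g) x"
proof -
  have "AE x in mu. L (P t (\<lambda>y. f y + g y)) x = L (\<lambda>x. P t f x + P t g x) x"
  proof (rule sol_unique_L[OF orbit[OF L2_add[OF f g]] sol_add[OF orbit[OF f] orbit[OF g]] _ t])
    show "AE x in mu. P 0 (\<lambda>y. f y + g y) x = P 0 f x + P 0 g x"
      using orbit_0[OF f] orbit_0[OF g] orbit_0[OF L2_add[OF f g]] by eventually_elim simp
  qed
  moreover have "AE x in mu. L (\<lambda>x. P t f x + P t g x) x = L (P t f) x + L (P t g) x"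
    using f g t by (intro L_add sol_D[OF orbit])
  ultimately show ?thesis by eventually_elim simp
qed

lemma L_orbit_diff:
  assumes f: "f \<in> L2 mu" and g: "g \<in> L2 mu" and t: "0 < t"
  shows "AE x in mu. L (P t (\<lambda>y. f y - g y)) x = L (P t f) x - L (P t g) x"
  using L_orbit_add[OF L2_diff[OF f g] g t] by eventually_elim simp

lemma L_orbit_bound:
  assumes f: "f \<in> L2 mu" and t: "0 < t"
  shows "L2_norm mu (L (P t f)) \<le> L2_norm mu f / t"
  using sol_L_bound[OF orbit[OF f] t] L2_norm_cong_AE[OF orbit_0[OF f]] t by (simp add: field_simps)

text \<open>Stated in \<open>ennreal\<close> since for small M the weighted integral of an
  \<open>L^2\<close> function may diverge.\<close>

lemma off_diagonal_estimate:
  "\<exists>C>0. \<forall>x t f. 0 < t \<longrightarrow> f \<in> L2 mu \<longrightarrow>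
     ennreal (t powr m * L2_norm mu (\<lambda>y. indicator (ball x t) y * L (P (t powr m) f) y))
       \<le> ennreal (C * exp (- (\<delta> / 16) * t powr m) / sqrt (V x t)) * (\<integral>\<^sup>+y. ennreal (decay M t x y * cmod (f y)) \<partial>mu)"
proof -
  obtain C where C: "C > 0" and loc: "\<And>x z t h. 0 < t \<Longrightarrow> h \<in> L2 mu \<Longrightarrow> (\<forall>y. y \<notin> ball z (t / 4) \<longrightarrow> h y = 0) \<Longrightarrow>
     t powr m * L2_norm mu (\<lambda>y. indicator (ball x t) y * L (P (t powr m) h) y)
       \<le> C * exp (- (\<delta> / 16) * t powr m) * decay M t x z / sqrt (V x t) * (\<integral>y. cmod (h y) \<partial>mu)"
    using localized_derivative_bound[of M] by blast
  obtain Q :: "'a set" where Q: "countable Q" "dense_set Q" using separable by blast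
  have "Q \<noteq> {}" using Q(2) unfolding dense_set_def using zero_less_one by blast
  define q where "q = from_nat_into Q"
  have q: "range q = Q" unfolding q_def using Q \<open>Q \<noteq> {}\<close> by (simp add: range_from_nat_into)
  show ?thesis
  \<comment> \<open>2^M pays for moving the weight from the centre \<open>q j\<close> to a point y
    of the piece: dist (q j) y < t / 4 gives 1 + dist x y / t \<le> 2 * (1 + dist x (q j) /
    t).\<close>
  proof (rule exI[of _ "C * 2 ^ M"], intro conjI allI impI)
    show "C * 2 ^ M > 0" using C by simp
    fix x :: 'a and t :: real and f assume t: "0 < t" and f: "f \<in> L2 mu"
    let ?T = "t powr m"
    have T: "0 < ?T" using t by simp
    define c where "c = C * 2 ^ M * exp (- (\<delta> / 16) * ?T) / sqrt (V x t)"
    have c: "0 \<le> c" using C by (simp add: c_def)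
    \<comment> \<open>Disjoint pieces of balls about a dense sequence; by density they cover the
      space.\<close>
    define U where "U = disjointed (\<lambda>j. ball (q j) (t / 4))"
    define W where "W n = (\<Union>j<n. U j)" for n :: nat
    have "range U \<subseteq> sets mu" unfolding U_def by (intro sets.range_disjointed_sets) auto
    then have U: "U j \<in> sets mu" "U j \<subseteq> ball (q j) (t / 4)" for j
      unfolding U_def using disjointed_subset[of "\<lambda>j. ball (q j) (t / 4)" j] by blast+
    have W: "W n \<in> sets mu" for n unfolding W_def using U by auto
    have disj: "disjoint_family U" unfolding U_def by (rule disjoint_family_disjointed)
    have cover: "\<exists>j. y \<in> U j" for y
    proof -
      obtain p where p: "p \<in> Q" "dist p y < t / 4" using Q(2) t unfolding dense_set_def by (meson divide_pos_pos zero_less_numeral)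
      then obtain j where "p = q j" using q by blast
      then have "y \<in> (\<Union>j. ball (q j) (t / 4))" using p by auto
      then have "y \<in> (\<Union>j. U j)" unfolding U_def UN_disjointed_eq .
      then show ?thesis by blast
    qed
    define X where "X g = L2_norm mu (\<lambda>y. indicator (ball x t) y * L (P ?T g) y)" for g
    define F where "F g = (\<integral>\<^sup>+y. ennreal (decay M t x y * cmod (g y)) \<partial>mu)" for g :: "'a \<Rightarrow> complex"
    have LI: "(\<lambda>y. indicator (ball x t) y * L (P ?T g) y) \<in> L2 mu" if "g \<in> L2 mu" for g
      using that T by (intro L2_indicator orbit_L_L2) auto
    have X_add: "X (\<lambda>y. g y + h y) \<le> X g + X h" if "g \<in> L2 mu" "h \<in> L2 mu" for g h
    proof -
      have "X (\<lambda>y. g y + h y) = L2_norm mu (\<lambda>y. indicator (ball x t) y * L (P ?T g) y + indicator (ball x t) y * L (P ?T h) y)"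
        unfolding X_def using L_orbit_add[OF that T] by (intro L2_norm_cong_AE) (auto simp: algebra_simps)
      also have "\<dots> \<le> X g + X h" unfolding X_def using that by (intro L2_norm_triangle LI)
      finally show ?thesis .
    qed
    have one: "ennreal (?T * X (\<lambda>y. indicator (U j) y * f y)) \<le> ennreal c * F (\<lambda>y. indicator (U j) y * f y)" for j
    proof -
      let ?h = "\<lambda>y. indicator (U j) y * f y"
      have h: "?h \<in> L2 mu" using f U by (intro L2_indicator)
      have supp: "\<forall>y. y \<notin> ball (q j) (t / 4) \<longrightarrow> ?h y = 0" using U(2)[of j] by (auto simp: indicator_def)
      note [measurable] = L2_measurable[OF h]
      have int: "integrable mu ?h" using L2_bounded_support_integrable[OF h, of "q j" "t / 4"] supp by blast
      have "?T * X ?h \<le> C * exp (- (\<delta> / 16) * ?T) * decay M t x (q j) / sqrt (V x t) * (\<integral>y. cmod (?h y) \<partial>mu)"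
        unfolding X_def by (rule loc[OF t h supp])
      also have "\<dots> = (c / 2 ^ M) * (decay M t x (q j) * (\<integral>y. cmod (?h y) \<partial>mu))"
        by (simp add: c_def)
      finally have "ennreal (?T * X ?h) \<le> ennreal (c / 2 ^ M) * (ennreal (decay M t x (q j)) * ennreal (\<integral>y. cmod (?h y) \<partial>mu))"
        using c t by (simp add: ennreal_mult[symmetric] ennreal_leI)
      also have "ennreal (\<integral>y. cmod (?h y) \<partial>mu) = (\<integral>\<^sup>+y. ennreal (cmod (?h y)) \<partial>mu)"
        using int by (intro nn_integral_eq_integral[symmetric] integrable_norm) auto
      also have "ennreal (decay M t x (q j)) * \<dots> = (\<integral>\<^sup>+y. ennreal (decay M t x (q j)) * ennreal (cmod (?h y)) \<partial>mu)"
        by (intro nn_integral_cmult[symmetric]) measurable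
      also have "\<dots> \<le> (\<integral>\<^sup>+y. ennreal (2 ^ M) * ennreal (decay M t x y * cmod (?h y)) \<partial>mu)"
      proof (intro nn_integral_mono)
        fix y
        show "ennreal (decay M t x (q j)) * ennreal (cmod (?h y)) \<le> ennreal (2 ^ M) * ennreal (decay M t x y * cmod (?h y))"
        proof (cases "y \<in> U j")
          case True
          then have "dist (q j) y < t / 4" using U(2)[of j] by auto
          then have "dist x y \<le> dist x (q j) + t / 4" using dist_triangle[of x y "q j"] by simp
          then have "dist x y / t \<le> (dist x (q j) + t / 4) / t" using t by (intro divide_right_mono) auto
          also have "\<dots> = dist x (q j) / t + 1 / 4" using t by (simp add: add_divide_distrib)
          finally have "1 + dist x y / t \<le> 2 * (1 + dist x (q j) / t)"
            using divide_nonneg_pos[OF zero_le_dist[of x "q j"] t] unfolding distrib_left by linarith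
          then have "(1 + dist x y / t) ^ M \<le> (2 * (1 + dist x (q j) / t)) ^ M" using t by (intro power_mono) auto
          then have "decay M t x (q j) \<le> 2 ^ M * decay M t x y"
            using t unfolding decay_def power_mult_distrib
            by (simp add: divide_inverse[symmetric] inverse_eq_divide pos_divide_le_eq pos_le_divide_eq add_pos_nonneg)
          then have "decay M t x (q j) * cmod (?h y) \<le> 2 ^ M * decay M t x y * cmod (?h y)" by (rule mult_right_mono) simp
          then show ?thesis using t by (simp add: ennreal_mult[symmetric] ennreal_leI mult.assoc)
        qed simp
      qed
      also have "\<dots> = ennreal (2 ^ M) * F ?h"
        unfolding F_def by (intro nn_integral_cmult) measurable
      also have "ennreal (c / 2 ^ M) * (ennreal (2 ^ M) * F ?h) = ennreal c * F ?h"
        using c by (simp add: mult.assoc[symmetric] ennreal_mult[symmetric])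
      finally show ?thesis by (simp add: mult_left_mono)
    qed
    have W_Suc: "indicator (W (Suc n)) y = indicator (W n) y + (indicator (U n) y :: 'b :: semiring_1)" for n y
    proof -
      have "U j \<inter> U n = {}" if "j < n" for j using disjoint_family_onD[OF disj, of j n] that by simp
      then have "W n \<inter> U n = {}" unfolding W_def by blast
      moreover have "W (Suc n) = W n \<union> U n" by (simp add: W_def lessThan_Suc Un_commute)
      ultimately show ?thesis by (auto simp: indicator_def)
    qed
    have partial: "ennreal (?T * X (\<lambda>y. indicator (W n) y * f y)) \<le> ennreal c * F (\<lambda>y. indicator (W n) y * f y)" for n
    proof (induction n)
      case 0
      have "L2_norm mu (L (P ?T (\<lambda>x. 0))) \<le> 0" using L_orbit_bound[OF L2_zero T] by (simp add: L2_norm_def)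
      then have "X (\<lambda>y. 0) \<le> 0" 
        unfolding X_def using L2_norm_indicator_le_self[OF orbit_L_L2[OF L2_zero T] sets_ball] by (meson order_trans)
      then show ?case using T by (simp add: W_def mult_nonneg_nonpos ennreal_neg)
    next
      case (Suc n)
      have eq: "(\<lambda>y. indicator (W (Suc n)) y * f y) = (\<lambda>y. indicator (W n) y * f y + indicator (U n) y * f y)"
        by (simp add: W_Suc distrib_right)
      have I: "(\<lambda>y. indicator (W n) y * f y) \<in> L2 mu" "(\<lambda>y. indicator (U n) y * f y) \<in> L2 mu"
        using f U W by (auto intro!: L2_indicator)
      note [measurable] = I[THEN L2_measurable]
      have "?T * X (\<lambda>y. indicator (W (Suc n)) y * f y) \<le> ?T * X (\<lambda>y. indicator (W n) y * f y) + ?T * X (\<lambda>y. indicator (U n) y * f y)"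
        unfolding eq distrib_left[symmetric] using T by (intro mult_left_mono X_add I) auto
      then have "ennreal (?T * X (\<lambda>y. indicator (W (Suc n)) y * f y)) \<le> ennreal (?T * X (\<lambda>y. indicator (W n) y * f y)) + ennreal (?T * X (\<lambda>y. indicator (U n) y * f y))"
        using T by (subst ennreal_plus[symmetric]) (auto simp: X_def simp del: ennreal_plus intro!: ennreal_leI)
      also have "\<dots> \<le> ennreal c * F (\<lambda>y. indicator (W n) y * f y) + ennreal c * F (\<lambda>y. indicator (U n) y * f y)"
        by (intro add_mono Suc one)
      also have "\<dots> = ennreal c * (F (\<lambda>y. indicator (W n) y * f y) + F (\<lambda>y. indicator (U n) y * f y))"
        by (simp add: distrib_left)
      also have "F (\<lambda>y. indicator (W n) y * f y) + F (\<lambda>y. indicator (U n) y * f y) = F (\<lambda>y. indicator (W (Suc n)) y * f y)"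
        unfolding F_def
      proof (subst nn_integral_add[symmetric])
        show "(\<integral>\<^sup>+ y. ennreal (decay M t x y * cmod (indicator (W n) y * f y)) + ennreal (decay M t x y * cmod (indicator (U n) y * f y)) \<partial>mu) =
              (\<integral>\<^sup>+ y. ennreal (decay M t x y * cmod (indicator (W (Suc n)) y * f y)) \<partial>mu)"
        proof (intro nn_integral_cong)
          fix y
          have "indicator (W (Suc n)) y = indicator (W n) y + (indicator (U n) y :: real)" by (rule W_Suc)
          then show "ennreal (decay M t x y * cmod (indicator (W n) y * f y)) + ennreal (decay M t x y * cmod (indicator (U n) y * f y)) =
              ennreal (decay M t x y * cmod (indicator (W (Suc n)) y * f y))"
            by (cases "y \<in> W n"; cases "y \<in> U n"; cases "y \<in> W (Suc n)") auto
        qed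
      qed measurable
      finally show ?case .
    qed
    have lim0: "(\<lambda>n. L2_norm mu (\<lambda>y. f y - indicator (W n) y * f y)) \<longlonglongrightarrow> 0"
    proof -
      have fn: "(\<lambda>y. f y - indicator (W n) y * f y) \<in> L2 mu" for n
        using f W by (intro L2_diff L2_indicator)
      have "(\<lambda>n. \<integral>y. (cmod (f y - indicator (W n) y * f y))\<^sup>2 \<partial>mu) \<longlonglongrightarrow> (\<integral>y. 0 \<partial>mu)"
      proof (rule integral_dominated_convergence)
        show "integrable mu (\<lambda>y. (cmod (f y))\<^sup>2)" using f by (simp add: L2_iff)
        show "AE y in mu. (\<lambda>n. (cmod (f y - indicator (W n) y * f y))\<^sup>2) \<longlonglongrightarrow> 0"
        proof (rule always_eventually, rule allI)
          fix y
          obtain j where "y \<in> U j" using cover by blast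
          then have "y \<in> W n" if "n \<ge> Suc j" for n using that by (auto simp: W_def)
          then have "(cmod (f y - indicator (W n) y * f y))\<^sup>2 = 0" if "n \<ge> Suc j" for n using that by simp
          then show "(\<lambda>n. (cmod (f y - indicator (W n) y * f y))\<^sup>2) \<longlonglongrightarrow> 0"
            by (intro tendsto_eventually eventually_sequentiallyI[of "Suc j"])
        qed
        show "AE y in mu. norm ((cmod (f y - indicator (W n) y * f y))\<^sup>2) \<le> (cmod (f y))\<^sup>2" for n
          by (rule always_eventually) (auto simp: indicator_def)
      qed (use fn in \<open>auto simp: L2_iff\<close>)
      then have "(\<lambda>n. sqrt (\<integral>y. (cmod (f y - indicator (W n) y * f y))\<^sup>2 \<partial>mu)) \<longlonglongrightarrow> sqrt 0"
        by (intro tendsto_real_sqrt) simp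
      then show ?thesis by (simp add: L2_norm_eq[OF fn])
    qed
    \<comment> \<open>Passage from finitely many pieces to f: f -> \<open>L (P ?T f)\<close> is
      bounded on \<open>L^2\<close> by \<open>L_orbit_bound\<close>, and the truncations to
      \<open>W n\<close> converge to f in \<open>L^2\<close>.\<close>
    have lim: "(\<lambda>n. ?T * X (\<lambda>y. indicator (W n) y * f y)) \<longlonglongrightarrow> ?T * X f"
    proof (rule LIM_zero_cancel, rule Lim_null_comparison[OF _ lim0], rule always_eventually, rule allI)
      fix n
      let ?g = "\<lambda>y. indicator (W n) y * f y"
      have g: "?g \<in> L2 mu" using f W by (intro L2_indicator)
      have "\<bar>X f - X ?g\<bar> \<le> L2_norm mu (\<lambda>y. indicator (ball x t) y * L (P ?T f) y - indicator (ball x t) y * L (P ?T ?g) y)"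
        unfolding X_def by (intro L2_norm_abs_diff LI f g)
      also have "\<dots> = L2_norm mu (\<lambda>y. indicator (ball x t) y * L (P ?T (\<lambda>y. f y - ?g y)) y)"
      proof (rule L2_norm_cong_AE)
        show "AE y in mu. indicator (ball x t) y * L (P ?T f) y - indicator (ball x t) y * L (P ?T ?g) y = indicator (ball x t) y * L (P ?T (\<lambda>y. f y - ?g y)) y"
          using L_orbit_diff[OF f g T] by eventually_elim (simp add: right_diff_distrib)
      qed
      also have "\<dots> \<le> L2_norm mu (L (P ?T (\<lambda>y. f y - ?g y)))"
        by (intro L2_norm_indicator_le_self orbit_L_L2 L2_diff f g T) auto
      also have "\<dots> \<le> L2_norm mu (\<lambda>y. f y - ?g y) / ?T" by (intro L_orbit_bound L2_diff f g T)
      finally have "?T * \<bar>X f - X ?g\<bar> \<le> L2_norm mu (\<lambda>y. f y - ?g y)" using T by (simp add: field_simps)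
      moreover have "norm (?T * X ?g - ?T * X f) = ?T * \<bar>X f - X ?g\<bar>"
        using T by (simp add: right_diff_distrib[symmetric] abs_mult abs_minus_commute)
      ultimately show "norm (?T * X ?g - ?T * X f) \<le> L2_norm mu (\<lambda>y. f y - ?g y)" by simp
    qed
    have "ennreal (?T * X f) \<le> ennreal c * F f"
    proof (rule LIMSEQ_le_const2[OF tendsto_ennrealI[OF lim]], intro exI allI impI)
      fix n
      have "F (\<lambda>y. indicator (W n) y * f y) \<le> F f" unfolding F_def
        using t by (intro nn_integral_mono ennreal_leI mult_left_mono) (auto simp: indicator_def)
      then show "ennreal (?T * X (\<lambda>y. indicator (W n) y * f y)) \<le> ennreal c * F f"
        using partial[of n] by (meson mult_left_mono order_trans zero_le)
    qed
    then show "ennreal (t powr m * L2_norm mu (\<lambda>y. indicator (ball x t) y * L (P (t powr m) f) y))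
       \<le> ennreal (C * 2 ^ M * exp (- (\<delta> / 16) * t powr m) / sqrt (V x t)) * (\<integral>\<^sup>+y. ennreal (decay M t x y * cmod (f y)) \<partial>mu)"
      by (simp add: X_def F_def c_def)
  qed
qed

end

subsection \<open>Square functions\<close>

lemma ennreal_square_le_imp_le:
  assumes "(a :: ennreal)\<^sup>2 \<le> b\<^sup>2" shows "a \<le> b"
proof (cases b)
  case (real s)
  then have "a\<^sup>2 < \<infinity>" using assms by (metis ennreal_power ennreal_less_top infinity_ennreal_def le_less_trans)
  then obtain r where r: "a = ennreal r" "0 \<le> r" by (cases a) (auto simp: power2_eq_square ennreal_top_mult)
  then have "r\<^sup>2 \<le> s\<^sup>2" using assms real by (simp add: ennreal_power)
  then have "r \<le> s" by (rule power2_le_imp_le) (use real in auto)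
  then show ?thesis using r real by (simp add: ennreal_leI)
qed simp

lemma enn_root_square: "(enn_root 2 X)\<^sup>2 = X"
proof (cases X)
  case (real r)
  have "(r powr (1 / 2))\<^sup>2 = r" using real by (simp add: powr_half_sqrt)
  then show ?thesis using real by (simp add: enn_root_def ennreal_power)
qed (simp add: enn_root_def power2_eq_square ennreal_top_mult)

lemma enn_root_le_iff: "enn_root 2 X \<le> Y \<longleftrightarrow> X \<le> Y\<^sup>2"
proof
  assume "enn_root 2 X \<le> Y"
  then have "(enn_root 2 X)\<^sup>2 \<le> Y\<^sup>2" by (intro power_mono) auto
  then show "X \<le> Y\<^sup>2" by (simp add: enn_root_square)
next
  assume "X \<le> Y\<^sup>2"
  then show "enn_root 2 X \<le> Y" by (auto intro: ennreal_square_le_imp_le simp: enn_root_square)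
qed

lemma enn_root_mono: "X \<le> Y \<Longrightarrow> enn_root 2 X \<le> enn_root 2 Y"
  by (simp add: enn_root_le_iff enn_root_square)

lemma enn_root_add_le: "enn_root 2 (X + Y) \<le> enn_root 2 X + enn_root 2 Y"
  unfolding enn_root_le_iff by (simp add: power2_sum enn_root_square)

lemma measurable_enn_root [measurable (raw)]:
  assumes [measurable]: "f \<in> borel_measurable M"
  shows "(\<lambda>x. enn_root 2 (f x)) \<in> borel_measurable M"
  unfolding enn_root_def by measurable

section \<open>Conical square functions and their measurability\<close>

context heat_gge
begin

text \<open>The root mean square of T * L e^(-TL) f over \<open>ball x t\<close>, where T = t^m; the
  square function is its \<open>L^2\<close> norm with respect to dt / t.\<close>

definition area :: "('a \<Rightarrow> complex) \<Rightarrow> real \<Rightarrow> 'a \<Rightarrow> real" where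
  "area f t x = t powr m * L2_norm mu (\<lambda>y. indicator (ball x t) y * L (P (t powr m) f) y) / sqrt (V x t)"

text \<open>The density of the square of the square function with respect to Lebesgue measure in \<open>t\<close>.\<close>
definition sqd :: "('a \<Rightarrow> complex) \<Rightarrow> real \<Rightarrow> 'a \<Rightarrow> ennreal" where
  "sqd f t x = indicator {0<..} t * ennreal ((area f t x)\<^sup>2 / t)"

lemma area_nonneg: "0 \<le> area f t x"
  by (simp add: area_def)

lemma indicator_ball_L2:
  "f \<in> L2 mu \<Longrightarrow> 0 < t \<Longrightarrow> (\<lambda>y. indicator (ball x r) y * L (P t f) y) \<in> L2 mu"
  by (intro L2_indicator orbit_L_L2) auto

lemma area_square:
  assumes f: "f \<in> L2 mu" and t: "0 < t"
  shows "(\<integral>\<^sup>+ y. indicator (ball x t) y * ennreal ((cmod (complex_of_real (t powr m) * L (P (t powr m) f) y)) ^ 2) \<partial>mu)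
     / emeasure mu (ball x t) = ennreal ((area f t x)\<^sup>2)"
proof -
  let ?w = "\<lambda>y. indicator (ball x t) y * L (P (t powr m) f) y"
  have w: "?w \<in> L2 mu" using f t by (intro indicator_ball_L2) auto
  note [measurable] = L2_measurable[OF w]
  have "(\<integral>\<^sup>+ y. indicator (ball x t) y * ennreal ((cmod (complex_of_real (t powr m) * L (P (t powr m) f) y)) ^ 2) \<partial>mu)
     = (\<integral>\<^sup>+ y. ennreal ((t powr m)\<^sup>2) * ennreal ((cmod (?w y))\<^sup>2) \<partial>mu)"
    by (intro nn_integral_cong) (auto simp: indicator_def norm_mult power_mult_distrib ennreal_mult)
  also have "\<dots> = ennreal ((t powr m)\<^sup>2) * (\<integral>\<^sup>+ y. ennreal ((cmod (?w y))\<^sup>2) \<partial>mu)"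
    by (intro nn_integral_cmult) measurable
  also have "\<dots> = ennreal ((t powr m * L2_norm mu ?w)\<^sup>2)"
    by (simp add: nn_integral_L2[OF w] ennreal_mult[symmetric] power_mult_distrib)
  finally show ?thesis
    using V_pos[OF t, of x] by (simp add: emeasure_ball divide_ennreal area_def power_divide)
qed

lemma sq_fun_on_eq:
  assumes f: "f \<in> L2 mu" and I: "I \<subseteq> {0<..}"
  shows "sq_fun_on I mu m L P f x = enn_root 2 (\<integral>\<^sup>+t. indicator I t * sqd f t x \<partial>lborel)"
proof -
  have "indicator I t * ((\<integral>\<^sup>+ y. indicator (ball x t) y * ennreal ((cmod (complex_of_real (t powr m) * L (P (t powr m) f) y)) ^ 2) \<partial>mu)
     / emeasure mu (ball x t)) / ennreal t = indicator I t * sqd f t x" for t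
  proof (cases "t \<in> I")
    case True
    then have "0 < t" using I by auto
    then show ?thesis using True area_square[OF f, of t x] by (simp add: sqd_def divide_ennreal)
  qed simp
  then show ?thesis by (simp add: sq_fun_on_def)
qed

text \<open>Representatives of \<open>L (P s f)\<close> need not depend measurably on \<open>s\<close>, so joint measurability is
  obtained from lower semicontinuity of the local norms.\<close>
lemma L2_norm_ball_lsc:
  assumes f: "f \<in> L2 mu"
  shows "closed {(t, x). t \<le> 0 \<or> L2_norm mu (\<lambda>y. indicator (ball x t) y * L (P (t powr m) f) y) \<le> a}"
  unfolding closed_sequential_limits
proof (intro allI impI)
  fix z :: "nat \<Rightarrow> real \<times> 'a" and l
  let ?N = "\<lambda>t x. L2_norm mu (\<lambda>y. indicator (ball x t) y * L (P (t powr m) f) y)"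
  assume "(\<forall>n. z n \<in> {(t, x). t \<le> 0 \<or> ?N t x \<le> a}) \<and> z \<longlonglongrightarrow> l"
  then have z: "\<And>n. fst (z n) \<le> 0 \<or> ?N (fst (z n)) (snd (z n)) \<le> a" and lim: "z \<longlonglongrightarrow> l" 
    by (auto simp: case_prod_beta')
  obtain t x where l: "l = (t, x)" by (cases l)
  have limt: "(\<lambda>n. fst (z n)) \<longlonglongrightarrow> t" and limx: "(\<lambda>n. snd (z n)) \<longlonglongrightarrow> x"
    using tendsto_fst[OF lim] tendsto_snd[OF lim] l by auto
  show "l \<in> {(t, x). t \<le> 0 \<or> ?N t x \<le> a}"
  proof (cases "t \<le> 0")
    case False
    then have t: "0 < t" by simp
    define w where "w s = L (P (s powr m) f)" for s
    have wL: "w s \<in> L2 mu" if "0 < s" for s using that f by (simp add: w_def orbit_L_L2)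
    have ev: "\<forall>\<^sub>F n in sequentially. 0 < fst (z n)" using order_tendstoD(1)[OF limt t] .
    have "continuous (at (t powr m)) (\<lambda>s. L2_norm mu (\<lambda>y. L (P s f) y - L (P (t powr m) f) y))"
      using sol_L_tendsto[OF orbit[OF f], of "t powr m"] t by (simp add: continuous_within L2_norm_def[of mu "\<lambda>y. 0"])
    moreover have "(\<lambda>n. fst (z n) powr m) \<longlonglongrightarrow> t powr m" using t by (intro tendsto_powr limt tendsto_const) auto
    ultimately have "(\<lambda>n. L2_norm mu (\<lambda>y. L (P (fst (z n) powr m) f) y - L (P (t powr m) f) y)) \<longlonglongrightarrow> L2_norm mu (\<lambda>y. L (P (t powr m) f) y - L (P (t powr m) f) y)"
      by (rule isCont_tendsto_compose)
    then have e: "(\<lambda>n. L2_norm mu (\<lambda>y. w (fst (z n)) y - w t y)) \<longlonglongrightarrow> 0"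
      by (simp add: w_def L2_norm_def[of mu "\<lambda>y. 0"])
    let ?d = "\<lambda>n. L2_norm mu (\<lambda>y. w (fst (z n)) y - w t y)"
    let ?F = "\<lambda>n y. ennreal ((cmod (indicator (ball (snd (z n)) (fst (z n))) y * w t y))\<^sup>2)"
    note [measurable] = L2_measurable[OF wL[OF t]]
    have wI: "(\<lambda>y. indicator (ball p r) y * w s y) \<in> L2 mu" if "0 < s" for p r s 
      using wL[OF that] by (intro L2_indicator) auto
    have "0 \<le> a"
    proof -
      obtain n where "0 < fst (z n)" using ev unfolding eventually_sequentially by blast
      then have "?N (fst (z n)) (snd (z n)) \<le> a" using z[of n] by simp
      then show ?thesis by (rule order_trans[OF L2_norm_nonneg])
    qed
    \<comment> \<open>Replaces the function at time \<open>fst (z n)\<close> by the one at the limit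
      time t, so that only the ball still varies; the error \<open>?d n\<close> tends to 0.\<close>
    have bound: "\<forall>\<^sub>F n in sequentially. (\<integral>\<^sup>+y. ?F n y \<partial>mu) \<le> ennreal ((a + ?d n)\<^sup>2)"
      using ev
    proof eventually_elim
      case (elim n)
      let ?B = "ball (snd (z n)) (fst (z n))"
      have "L2_norm mu (\<lambda>y. indicator ?B y * w t y) \<le> L2_norm mu (\<lambda>y. indicator ?B y * w (fst (z n)) y)
         + L2_norm mu (\<lambda>y. indicator ?B y * w t y - indicator ?B y * w (fst (z n)) y)"
        by (intro L2_norm_le_add_diff wI elim t)
      also have "L2_norm mu (\<lambda>y. indicator ?B y * w (fst (z n)) y) \<le> a" using z[of n] elim by (simp add: w_def)
      also have "L2_norm mu (\<lambda>y. indicator ?B y * w t y - indicator ?B y * w (fst (z n)) y) = L2_norm mu (\<lambda>y. indicator ?B y * (w t y - w (fst (z n)) y))"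
        by (simp add: right_diff_distrib)
      also have "\<dots> \<le> L2_norm mu (\<lambda>y. w t y - w (fst (z n)) y)"
        by (intro L2_norm_indicator_le_self L2_diff wL elim t) auto
      also have "\<dots> = ?d n" by (rule L2_norm_diff_commute)
      finally have "(L2_norm mu (\<lambda>y. indicator ?B y * w t y))\<^sup>2 \<le> (a + ?d n)\<^sup>2" by (intro power_mono) auto
      then show ?case unfolding nn_integral_L2[OF wI[OF t]] by (rule ennreal_leI)
    qed
    have "ennreal ((?N t x)\<^sup>2) = (\<integral>\<^sup>+y. ennreal ((cmod (indicator (ball x t) y * w t y))\<^sup>2) \<partial>mu)"
      unfolding w_def by (rule nn_integral_L2[symmetric]) (use wI[OF t] in \<open>simp add: w_def\<close>)
    also have "\<dots> \<le> (\<integral>\<^sup>+y. liminf (\<lambda>n. ?F n y) \<partial>mu)"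
    \<comment> \<open>Lying in an open ball is an open condition on centre and radius: a point of
      the limit ball lies in all late balls, and other points contribute 0 on the left.\<close>
    proof (intro nn_integral_mono)
      fix y
      show "ennreal ((cmod (indicator (ball x t) y * w t y))\<^sup>2) \<le> liminf (\<lambda>n. ?F n y)"
      proof (cases "dist x y < t")
        case True
        have "(\<lambda>n. fst (z n) - dist (snd (z n)) y) \<longlonglongrightarrow> t - dist x y" by (intro tendsto_intros limt limx)
        from order_tendstoD(1)[OF this, of 0] True
        have "\<forall>\<^sub>F n in sequentially. dist (snd (z n)) y < fst (z n)" by simp
        then have "\<forall>\<^sub>F n in sequentially. ennreal ((cmod (indicator (ball x t) y * w t y))\<^sup>2) \<le> ?F n y"
          by eventually_elim (use True in \<open>simp add: indicator_def\<close>)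
        then show ?thesis by (rule Liminf_bounded)
      qed simp
    qed
    also have "\<dots> \<le> liminf (\<lambda>n. \<integral>\<^sup>+y. ?F n y \<partial>mu)" by (intro nn_integral_liminf) measurable
    also have "\<dots> \<le> liminf (\<lambda>n. ennreal ((a + ?d n)\<^sup>2))" by (intro Liminf_mono bound)
    also have "\<dots> = ennreal ((a + 0)\<^sup>2)"
      by (intro lim_imp_Liminf tendsto_ennrealI tendsto_intros e) auto
    finally have "(?N t x)\<^sup>2 \<le> a\<^sup>2" using \<open>0 \<le> a\<close> by (simp add: ennreal_le_iff)
    then have "?N t x \<le> a" using \<open>0 \<le> a\<close> by (rule power2_le_imp_le)
    then show ?thesis using l by simp
  qed (use l in simp)
qed

lemma measurable_sqd:
  assumes f: "f \<in> L2 mu"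
  shows "(\<lambda>(t, x). sqd f t x) \<in> borel_measurable (lborel \<Otimes>\<^sub>M mu)"
proof -
  let ?N = "\<lambda>t x. L2_norm mu (\<lambda>y. indicator (ball x t) y * L (P (t powr m) f) y)"
  \<comment> \<open>The extension by 0 to t \<le> 0 makes each superlevel set at a level a \<ge> 0
    the complement of a closed set of \<open>L2_norm_ball_lsc\<close>.\<close>
  define G where "G = (\<lambda>z. if fst z > 0 then ?N (fst z) (snd z) else 0)"
  have "G \<in> borel_measurable (lborel \<Otimes>\<^sub>M mu)"
  proof (rule borel_measurable_iff_greater[THEN iffD2], rule allI)
    fix a :: real
    show "{z \<in> space (lborel \<Otimes>\<^sub>M mu). a < G z} \<in> sets (lborel \<Otimes>\<^sub>M mu)"
    proof (cases "a < 0")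
      case True
      then have "{z \<in> space (lborel \<Otimes>\<^sub>M mu). a < G z} = space (lborel \<Otimes>\<^sub>M mu)"
        by (auto simp: G_def intro: less_le_trans)
      then show ?thesis by (simp only: sets.top)
    next
      case False
      then have "{z \<in> space (lborel \<Otimes>\<^sub>M mu). a < G z} = - {(t, x). t \<le> 0 \<or> ?N t x \<le> a}"
        by (auto simp: G_def space_pair_measure)
      also have "\<dots> \<in> sets (lborel \<Otimes>\<^sub>M mu)"
        using L2_norm_ball_lsc[OF f, of a] by (intro open_real_pair) (simp add: open_Compl)
      finally show ?thesis .
    qed
  qed
  note [measurable] = this
  have "(\<lambda>z. indicator {0<..} (fst z) * ennreal ((fst z powr m * G z / sqrt (V (snd z) (fst z)))\<^sup>2 / fst z)) \<in> borel_measurable (lborel \<Otimes>\<^sub>M mu)"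
    by measurable
  also have "(\<lambda>z. indicator {0<..} (fst z) * ennreal ((fst z powr m * G z / sqrt (V (snd z) (fst z)))\<^sup>2 / fst z)) = (\<lambda>(t, x). sqd f t x)"
    by (auto simp: fun_eq_iff sqd_def area_def G_def indicator_def)
  finally show ?thesis .
qed

lemma measurable_sqd' [measurable (raw)]:
  assumes "f \<in> L2 mu" "g \<in> borel_measurable M" "h \<in> measurable M mu"
  shows "(\<lambda>z. sqd f (g z) (h z)) \<in> borel_measurable M"
proof -
  have "(\<lambda>z. (g z, h z)) \<in> measurable M (lborel \<Otimes>\<^sub>M mu)" using assms by (intro measurable_Pair) auto
  from measurable_compose[OF this measurable_sqd[OF assms(1)]] show ?thesis by simp
qed

lemma measurable_sq_integral:
  assumes [simp, intro]: "f \<in> L2 mu" and [measurable]: "I \<in> sets borel"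
  shows "(\<lambda>x. \<integral>\<^sup>+t. indicator I t * sqd f t x \<partial>lborel) \<in> borel_measurable mu"
  by (intro lborel.borel_measurable_nn_integral) measurable

section \<open>The scales t \<ge> 1 and the first inequality\<close>

lemma kernel_integral:
  "(\<integral>\<^sup>+x. ennreal (1 / V x 1) * (\<integral>\<^sup>+y. ennreal (decay (1 * k + (k + 1)) 1 x y * cmod (f y)) \<partial>mu) \<partial>mu)
     \<le> ennreal (A * (A * 2 ^ (k + 1))) * (\<integral>\<^sup>+y. ennreal (cmod (f y)) \<partial>mu)"
  if f [measurable]: "f \<in> borel_measurable mu" for f :: "'a \<Rightarrow> complex"
proof -
  let ?d = "\<lambda>x y. decay (1 * k + (k + 1)) 1 x y"
  have "(\<integral>\<^sup>+x. ennreal (1 / V x 1) * (\<integral>\<^sup>+y. ennreal (?d x y * cmod (f y)) \<partial>mu) \<partial>mu)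
     = (\<integral>\<^sup>+x. (\<integral>\<^sup>+y. ennreal (1 / V x 1) * ennreal (?d x y * cmod (f y)) \<partial>mu) \<partial>mu)"
    by (intro nn_integral_cong nn_integral_cmult[symmetric]) measurable
  also have "\<dots> = (\<integral>\<^sup>+y. (\<integral>\<^sup>+x. ennreal (1 / V x 1) * ennreal (?d x y * cmod (f y)) \<partial>mu) \<partial>mu)"
    by (intro mm.Fubini'[symmetric]) measurable
  also have "\<dots> = (\<integral>\<^sup>+y. (\<integral>\<^sup>+x. ennreal (cmod (f y)) * ennreal (?d x y / V x 1 ^ 1) \<partial>mu) \<partial>mu)"
    by (intro nn_integral_cong) (simp add: ennreal_mult[symmetric] mult.commute)
  also have "\<dots> = (\<integral>\<^sup>+y. ennreal (cmod (f y)) * (\<integral>\<^sup>+x. ennreal (?d x y / V x 1 ^ 1) \<partial>mu) \<partial>mu)"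
    by (intro nn_integral_cong nn_integral_cmult) measurable
  also have "\<dots> \<le> (\<integral>\<^sup>+y. ennreal (cmod (f y)) * ennreal (A * (A * 2 ^ (k + 1))) \<partial>mu)"
  proof (intro nn_integral_mono mult_left_mono)
    fix y
    have "(\<integral>\<^sup>+x. ennreal (?d x y / V x 1 ^ 1) \<partial>mu) \<le> ennreal (A ^ 1 * (A * 2 ^ (k + 1)) * V y 1 / V y 1 ^ 1)"
      by (rule decay_V_integral) simp
    also have "A ^ 1 * (A * 2 ^ (k + 1)) * V y 1 / V y 1 ^ 1 = A * (A * 2 ^ (k + 1))"
      using V_pos[of 1 y] by simp
    finally show "(\<integral>\<^sup>+x. ennreal (?d x y / V x 1 ^ 1) \<partial>mu) \<le> ennreal (A * (A * 2 ^ (k + 1)))" .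
  qed auto
  also have "\<dots> = ennreal (A * (A * 2 ^ (k + 1))) * (\<integral>\<^sup>+y. ennreal (cmod (f y)) \<partial>mu)"
    by (simp add: nn_integral_multc mult.commute)
  finally show ?thesis .
qed

lemma exp_integral:
  assumes "0 < (e :: real)"
  shows "(\<integral>\<^sup>+t. ennreal (exp (- e * t)) * indicator {1..} t \<partial>lborel) \<le> ennreal (1 / e)"
proof -
  have "(\<integral>\<^sup>+t. ennreal (exp (- e * t)) * indicator {1..} t \<partial>lborel) = ennreal (0 - (- exp (- e * 1) / e))"
  proof (rule nn_integral_FTC_atLeast)
    fix x show "((\<lambda>t. - exp (- e * t) / e) has_real_derivative exp (- e * x)) (at x)"
      using assms by (auto intro!: derivative_eq_intros)
  next
    have "filterlim (\<lambda>s. - e * s) at_bot at_top"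
      using assms by (intro filterlim_tendsto_neg_mult_at_bot[OF tendsto_const] filterlim_ident) auto
    then have "((\<lambda>s. exp (- e * s)) \<longlongrightarrow> 0) at_top" by (rule filterlim_compose[OF exp_at_bot])
    then have "((\<lambda>s. - exp (- e * s) / e) \<longlongrightarrow> - 0 / e) at_top" using assms by (intro tendsto_intros) auto
    then show "((\<lambda>s. - exp (- e * s) / e) \<longlongrightarrow> 0) at_top" by simp
  qed auto
  also have "\<dots> \<le> ennreal (1 / e)" using assms by (intro ennreal_leI) (auto simp: field_simps)
  finally show ?thesis .
qed

text \<open>For t \<ge> 1 everything is compared with scale 1: the volume only grows and the weight
  loses at most t^M, which the exponential factor absorbs. All scales are thus dominated by the
  single kernel of \<open>kernel_integral\<close>, bounded on \<open>L^1\<close>.\<close>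

lemma tail_bound:
  "\<exists>C>0. \<forall>f\<in>L2 mu. (\<integral>\<^sup>+x. enn_root 2 (\<integral>\<^sup>+t. indicator {1..} t * sqd f t x \<partial>lborel) \<partial>mu) \<le> ennreal C * L1_norm mu f"
proof -
  define M where "M = 1 * k + (k + 1)"
  obtain C where C: "C > 0" and od: "\<And>x t f. 0 < t \<Longrightarrow> f \<in> L2 mu \<Longrightarrow>
     ennreal (t powr m * L2_norm mu (\<lambda>y. indicator (ball x t) y * L (P (t powr m) f) y))
       \<le> ennreal (C * exp (- (\<delta> / 16) * t powr m) / sqrt (V x t)) * (\<integral>\<^sup>+y. ennreal (decay M t x y * cmod (f y)) \<partial>mu)"
    using off_diagonal_estimate[of M] by blast
  define e where "e = \<delta> / 16"
  have e: "0 < e" using \<delta>_pos by (simp add: e_def)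
  \<comment> \<open>Bounds exp (- e * t) * t^(2 * M). Squaring the area bound gives exp (- 2 * e *
    t): one half is spent on this power of t, the other makes the integral over t converge.\<close>
  define K where "K = exp e * (1 + real (2 * M + 1) / e) ^ (2 * M)"
  have K: "0 < K" using e by (auto simp: K_def intro!: mult_pos_pos zero_less_power add_pos_nonneg)
  \<comment> \<open>C^2 * K comes from the pointwise bound on the squared area and 1 / e from
    integrating exp (- e * t).\<close>
  define C' where "C' = sqrt (C\<^sup>2 * K / e)"
  have C': "0 < C'" using C K e by (simp add: C'_def)
  show ?thesis
  proof (rule exI[of _ "C' * (A * (A * 2 ^ (k + 1)))"], intro conjI ballI)
    show "0 < C' * (A * (A * 2 ^ (k + 1)))" using C' A by simp
    fix f assume f: "f \<in> L2 mu"
    note [measurable] = L2_measurable[OF f]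
    define I where "I x = (\<integral>\<^sup>+y. ennreal (decay M 1 x y * cmod (f y)) \<partial>mu)" for x
    have I_meas [measurable]: "I \<in> borel_measurable mu" unfolding I_def
      by (intro borel_measurable_nn_integral) measurable
    have pt: "enn_root 2 (\<integral>\<^sup>+t. indicator {1..} t * sqd f t x \<partial>lborel) \<le> ennreal C' * (ennreal (1 / V x 1) * I x)" for x
    proof -
      have V1: "0 < V x 1" by (rule V_pos) simp
      have "indicator {1..} t * sqd f t x \<le> ennreal (C\<^sup>2 * K) * (ennreal (1 / V x 1) * I x)\<^sup>2 * (ennreal (exp (- e * t)) * indicator {1..} t)" for t
      proof (cases "1 \<le> t")
        case True
        then have t: "0 < t" by simp
        have Vt: "V x 1 \<le> V x t" using True by (rule V_mono_radius)
        have It: "(\<integral>\<^sup>+y. ennreal (decay M t x y * cmod (f y)) \<partial>mu) \<le> ennreal (t ^ M) * I x"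
        proof -
          have "(\<integral>\<^sup>+y. ennreal (decay M t x y * cmod (f y)) \<partial>mu) \<le> (\<integral>\<^sup>+y. ennreal (t ^ M) * ennreal (decay M 1 x y * cmod (f y)) \<partial>mu)"
            using decay_scale[of 1 t M x] True
            by (intro nn_integral_mono) (auto simp: ennreal_mult[symmetric] mult.assoc[symmetric] intro!: ennreal_leI mult_right_mono)
          also have "\<dots> = ennreal (t ^ M) * I x" unfolding I_def by (intro nn_integral_cmult) measurable
          finally show ?thesis .
        qed
        have "ennreal (area f t x) = ennreal (t powr m * L2_norm mu (\<lambda>y. indicator (ball x t) y * L (P (t powr m) f) y)) * ennreal (1 / sqrt (V x t))"
          by (simp add: area_def ennreal_mult[symmetric])
        also have "\<dots> \<le> ennreal (C * exp (- e * t powr m) / sqrt (V x t)) * (ennreal (t ^ M) * I x) * ennreal (1 / sqrt (V x t))"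
          using order_trans[OF od[OF t f, of x] mult_left_mono[OF It]] unfolding e_def by (intro mult_right_mono) simp_all
        also have "\<dots> = ennreal (C * exp (- e * t powr m) * t ^ M / V x t) * I x"
        proof -
          have "ennreal (C * exp (- e * t powr m) * t ^ M / V x t) = ennreal (C * exp (- e * t powr m) / sqrt (V x t)) * ennreal (t ^ M) * ennreal (1 / sqrt (V x t))"
            using C t by (simp add: ennreal_mult[symmetric])
          then show ?thesis by (simp add: mult_ac)
        qed
        also have "\<dots> \<le> ennreal (C * exp (- e * t) * t ^ M * (1 / V x 1)) * I x"
        proof (intro mult_right_mono ennreal_leI)
          have "t powr 1 \<le> t powr m" using True m by (intro powr_mono) auto
          then have "exp (- e * t powr m) \<le> exp (- e * t)" using e t by simp
          then have "C * exp (- e * t powr m) * t ^ M * (1 / V x t) \<le> C * exp (- e * t) * t ^ M * (1 / V x 1)"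
            using C t V1 Vt by (intro mult_mono divide_left_mono) auto
          then show "C * exp (- e * t powr m) * t ^ M / V x t \<le> C * exp (- e * t) * t ^ M * (1 / V x 1)" by simp
        qed auto
        also have "\<dots> = ennreal (C * exp (- e * t) * t ^ M) * (ennreal (1 / V x 1) * I x)"
          using C t by (subst ennreal_mult) (auto simp: mult.assoc)
        finally have "(ennreal (area f t x))\<^sup>2 \<le> (ennreal (C * exp (- e * t) * t ^ M) * (ennreal (1 / V x 1) * I x))\<^sup>2"
          by (intro power_mono) auto
        also have "\<dots> = ennreal ((C * exp (- e * t) * t ^ M)\<^sup>2) * (ennreal (1 / V x 1) * I x)\<^sup>2"
          using C t by (simp add: power_mult_distrib ennreal_power)
        also have "\<dots> \<le> ennreal (C\<^sup>2 * K * exp (- e * t)) * (ennreal (1 / V x 1) * I x)\<^sup>2"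
        proof (intro mult_right_mono ennreal_leI)
          have "exp (- e * t powr 1) \<le> K * inverse ((1 + t) ^ (2 * M))"
            unfolding K_def using e t by (intro exp_le_poly) auto
          also have "\<dots> \<le> K * inverse (t ^ (2 * M))"
            using K t by (intro mult_left_mono le_imp_inverse_le power_mono) auto
          finally have "exp (- e * t) * t ^ (2 * M) \<le> K" using t by (simp add: field_simps)
          then have "C\<^sup>2 * exp (- e * t) * (exp (- e * t) * t ^ (2 * M)) \<le> C\<^sup>2 * exp (- e * t) * K"
            by (intro mult_left_mono) auto
          then show "(C * exp (- e * t) * t ^ M)\<^sup>2 \<le> C\<^sup>2 * K * exp (- e * t)"
            by (simp add: power_mult_distrib power_mult[symmetric] power2_eq_square[of "exp _"] mult_ac)
        qed auto
        finally have 1: "(ennreal (area f t x))\<^sup>2 \<le> ennreal (C\<^sup>2 * K * exp (- e * t)) * (ennreal (1 / V x 1) * I x)\<^sup>2" .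
        have "(area f t x)\<^sup>2 / t \<le> (area f t x)\<^sup>2" using True by (simp add: divide_le_eq mult_le_cancel_left1)
        then have "sqd f t x \<le> (ennreal (area f t x))\<^sup>2" using t by (simp add: sqd_def ennreal_power area_nonneg ennreal_leI)
        also note 1
        also have "ennreal (C\<^sup>2 * K * exp (- e * t)) * (ennreal (1 / V x 1) * I x)\<^sup>2 = ennreal (C\<^sup>2 * K) * (ennreal (1 / V x 1) * I x)\<^sup>2 * ennreal (exp (- e * t))"
          using C K by (subst ennreal_mult) (auto simp: mult_ac)
        finally show ?thesis using True by simp
      qed simp
      then have "(\<integral>\<^sup>+t. indicator {1..} t * sqd f t x \<partial>lborel)
         \<le> (\<integral>\<^sup>+t. ennreal (C\<^sup>2 * K) * (ennreal (1 / V x 1) * I x)\<^sup>2 * (ennreal (exp (- e * t)) * indicator {1..} t) \<partial>lborel)"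
        by (intro nn_integral_mono)
      also have "\<dots> = ennreal (C\<^sup>2 * K) * (ennreal (1 / V x 1) * I x)\<^sup>2 * (\<integral>\<^sup>+t. ennreal (exp (- e * t)) * indicator {1..} t \<partial>lborel)"
        by (intro nn_integral_cmult) measurable
      also have "\<dots> \<le> ennreal (C\<^sup>2 * K) * (ennreal (1 / V x 1) * I x)\<^sup>2 * ennreal (1 / e)"
        by (intro mult_left_mono exp_integral e) auto
      also have "\<dots> = (ennreal (C\<^sup>2 * K) * ennreal (1 / e)) * (ennreal (1 / V x 1) * I x)\<^sup>2" by (simp add: mult_ac)
      also have "ennreal (C\<^sup>2 * K) * ennreal (1 / e) = (ennreal C')\<^sup>2"
        using C K e by (simp add: C'_def ennreal_power ennreal_mult[symmetric])
      finally show ?thesis unfolding enn_root_le_iff by (simp add: power_mult_distrib)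
    qed
    have "(\<integral>\<^sup>+x. enn_root 2 (\<integral>\<^sup>+t. indicator {1..} t * sqd f t x \<partial>lborel) \<partial>mu) \<le> (\<integral>\<^sup>+x. ennreal C' * (ennreal (1 / V x 1) * I x) \<partial>mu)"
      by (intro nn_integral_mono pt)
    also have "\<dots> = ennreal C' * (\<integral>\<^sup>+x. ennreal (1 / V x 1) * I x \<partial>mu)"
      by (intro nn_integral_cmult) measurable
    also have "\<dots> \<le> ennreal C' * (ennreal (A * (A * 2 ^ (k + 1))) * (\<integral>\<^sup>+y. ennreal (cmod (f y)) \<partial>mu))"
      unfolding I_def M_def by (intro mult_left_mono kernel_integral) auto
    also have "\<dots> = ennreal (C' * (A * (A * 2 ^ (k + 1)))) * L1_norm mu f"
      using C' A by (simp add: L1_norm_def mult.assoc[symmetric] ennreal_mult[symmetric])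
    finally show "(\<integral>\<^sup>+x. enn_root 2 (\<integral>\<^sup>+t. indicator {1..} t * sqd f t x \<partial>lborel) \<partial>mu) \<le> \<dots>" .
  qed
qed

text \<open>The scales are split at t = 1, and the square root is subadditive.\<close>

lemma sq_fun_le_local:
  "\<exists>C>0. \<forall>f\<in>L2 mu. (\<integral>\<^sup>+ x. sq_fun mu m L P f x \<partial>mu) \<le> ennreal C * ((\<integral>\<^sup>+ x. sq_fun_loc mu m L P f x \<partial>mu) + L1_norm mu f)"
proof -
  obtain C where C: "C > 0" and tail: "\<And>f. f \<in> L2 mu \<Longrightarrow> (\<integral>\<^sup>+x. enn_root 2 (\<integral>\<^sup>+t. indicator {1..} t * sqd f t x \<partial>lborel) \<partial>mu) \<le> ennreal C * L1_norm mu f"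
    using tail_bound by blast
  show ?thesis
  proof (rule exI[of _ "max C 1"], intro conjI ballI)
    show "max C 1 > 0" by simp
    fix f assume f: "f \<in> L2 mu"
    note [measurable] = measurable_sq_integral[OF f]
    let ?S = "\<lambda>I x. enn_root 2 (\<integral>\<^sup>+t. indicator I t * sqd f t x \<partial>lborel)"
    have meas: "?S I \<in> borel_measurable mu" if "I \<in> sets borel" for I
      by (intro measurable_enn_root measurable_sq_integral f that)
    have "(\<integral>\<^sup>+ x. sq_fun mu m L P f x \<partial>mu) \<le> (\<integral>\<^sup>+ x. ?S {0<..<1} x + ?S {1..} x \<partial>mu)"
    proof (intro nn_integral_mono)
      fix x
      have "(\<integral>\<^sup>+t. indicator {0<..} t * sqd f t x \<partial>lborel) = (\<integral>\<^sup>+t. indicator {0<..<1} t * sqd f t x + indicator {1..} t * sqd f t x \<partial>lborel)"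
        by (intro nn_integral_cong) (auto simp: indicator_def)
      also have "\<dots> = (\<integral>\<^sup>+t. indicator {0<..<1} t * sqd f t x \<partial>lborel) + (\<integral>\<^sup>+t. indicator {1..} t * sqd f t x \<partial>lborel)"
        using f by (intro nn_integral_add) measurable
      finally show "sq_fun mu m L P f x \<le> ?S {0<..<1} x + ?S {1..} x"
        using sq_fun_on_eq[OF f, of "{0<..}" x] by (simp add: enn_root_add_le)
    qed
    also have "\<dots> = (\<integral>\<^sup>+ x. ?S {0<..<1} x \<partial>mu) + (\<integral>\<^sup>+ x. ?S {1..} x \<partial>mu)"
      by (intro nn_integral_add meas) auto
    also have "(\<integral>\<^sup>+ x. ?S {0<..<1} x \<partial>mu) = (\<integral>\<^sup>+ x. sq_fun_loc mu m L P f x \<partial>mu)"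
      by (intro nn_integral_cong sq_fun_on_eq[OF f, symmetric]) auto
    also have "(\<integral>\<^sup>+ x. ?S {1..} x \<partial>mu) \<le> ennreal C * L1_norm mu f" by (rule tail[OF f])
    also have "(\<integral>\<^sup>+ x. sq_fun_loc mu m L P f x \<partial>mu) + ennreal C * L1_norm mu f \<le> ennreal (max C 1) * (\<integral>\<^sup>+ x. sq_fun_loc mu m L P f x \<partial>mu) + ennreal (max C 1) * L1_norm mu f"
      using mult_right_mono[of 1 "ennreal (max C 1)" "\<integral>\<^sup>+ x. sq_fun_loc mu m L P f x \<partial>mu"]
      by (intro add_mono mult_right_mono ennreal_leI) auto
    also have "\<dots> = ennreal (max C 1) * ((\<integral>\<^sup>+ x. sq_fun_loc mu m L P f x \<partial>mu) + L1_norm mu f)" by (simp add: distrib_left)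
    finally show "(\<integral>\<^sup>+ x. sq_fun mu m L P f x \<partial>mu) \<le> \<dots>" by simp
  qed
qed

lemma sq_fun_loc_le: "(\<integral>\<^sup>+ x. sq_fun_loc mu m L P f x \<partial>mu) \<le> (\<integral>\<^sup>+ x. sq_fun mu m L P f x \<partial>mu)"
  unfolding sq_fun_on_def
  by (intro nn_integral_mono enn_root_mono divide_right_mono_ennreal mult_right_mono) (auto simp: indicator_def)

end

subsection \<open>The lower bound for the square function\<close>

lemma ennreal_two_mult_le: "2 * (a * b) \<le> a\<^sup>2 + (b :: ennreal)\<^sup>2"
proof (cases "a = \<infinity> \<or> b = \<infinity>")
  case True
  then show ?thesis by (auto simp: power2_eq_square ennreal_top_mult)
next
  case False
  then obtain r s where rs: "a = ennreal r" "0 \<le> r" "b = ennreal s" "0 \<le> s"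
    by (cases a; cases b) auto
  have "2 * (a * b) = ennreal (2 * r * s)" using rs by (simp add: ennreal_mult mult.assoc)
  also have "\<dots> \<le> ennreal (r\<^sup>2 + s\<^sup>2)" by (intro ennreal_leI sum_squares_bound)
  also have "\<dots> = a\<^sup>2 + b\<^sup>2" using rs by (simp add: ennreal_power)
  finally show ?thesis .
qed

lemma ennreal_two_mult_add: "0 \<le> a \<Longrightarrow> 0 \<le> b \<Longrightarrow> ennreal (2 * a + 2 * b) = 2 * ennreal a + 2 * ennreal b"
  by (simp add: ennreal_mult)

text \<open>Normalize both factors and integrate the pointwise inequality between product and
  squares. Vanishing and infinite norms are separated because they cannot be normalized.\<close>

lemma nn_integral_Cauchy_Schwarz:
  assumes [measurable]: "f \<in> borel_measurable M" "g \<in> borel_measurable M"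
  shows "(\<integral>\<^sup>+x. f x * g x \<partial>M) \<le> enn_root 2 (\<integral>\<^sup>+x. (f x)\<^sup>2 \<partial>M) * enn_root 2 (\<integral>\<^sup>+x. (g x)\<^sup>2 \<partial>M)"
proof -
  let ?X = "enn_root 2 (\<integral>\<^sup>+x. (f x)\<^sup>2 \<partial>M)" and ?Y = "enn_root 2 (\<integral>\<^sup>+x. (g x)\<^sup>2 \<partial>M)"
  have X: "(\<integral>\<^sup>+x. (f x)\<^sup>2 \<partial>M) = ?X\<^sup>2" and Y: "(\<integral>\<^sup>+x. (g x)\<^sup>2 \<partial>M) = ?Y\<^sup>2" by (simp_all add: enn_root_square)
  have zero: "(\<integral>\<^sup>+x. h x * k x \<partial>M) = 0" if "(\<integral>\<^sup>+x. (h x)\<^sup>2 \<partial>M) = 0" and [measurable]: "h \<in> borel_measurable M" for h k :: "'a \<Rightarrow> ennreal"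
  proof -
    have "AE x in M. (h x)\<^sup>2 = 0" using that by (subst (asm) nn_integral_0_iff_AE) auto
    then have "AE x in M. h x * k x = 0" by eventually_elim simp
    then have "(\<integral>\<^sup>+x. h x * k x \<partial>M) = (\<integral>\<^sup>+x. 0 \<partial>M)" by (rule nn_integral_cong_AE)
    then show ?thesis by simp
  qed
  consider "?X = 0" | "?Y = 0" | "?X \<noteq> 0" "?Y \<noteq> 0" "?X = \<infinity> \<or> ?Y = \<infinity>" | "?X \<noteq> 0" "?Y \<noteq> 0" "?X \<noteq> \<infinity>" "?Y \<noteq> \<infinity>" by blast
  then show ?thesis
  proof cases
    case 1
    then show ?thesis using zero[of f g] X by simp
  next
    case 2
    then show ?thesis using zero[of g f] Y by (simp add: mult.commute)
  next
    case 3
    then show ?thesis by (auto simp: ennreal_top_mult ennreal_mult_top)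
  next
    case 4
    then obtain x y where x: "?X = ennreal x" "0 < x" and y: "?Y = ennreal y" "0 < y"
      by (cases ?X; cases ?Y) (auto simp: less_le)
    have X': "(\<integral>\<^sup>+x. (f x)\<^sup>2 \<partial>M) = (ennreal x)\<^sup>2" using X unfolding x(1) .
    have Y': "(\<integral>\<^sup>+x. (g x)\<^sup>2 \<partial>M) = (ennreal y)\<^sup>2" using Y unfolding y(1) .
    have "ennreal 2 * (\<integral>\<^sup>+x. f x * g x \<partial>M) = (\<integral>\<^sup>+x. ennreal 2 * (f x * g x) \<partial>M)"
      by (intro nn_integral_cmult[symmetric]) measurable
    also have "\<dots> \<le> (\<integral>\<^sup>+z. ennreal (x * y) * ((ennreal (1 / x) * f z)\<^sup>2 + (ennreal (1 / y) * g z)\<^sup>2) \<partial>M)"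
    proof (intro nn_integral_mono)
      fix z
      have "ennreal (x * y) * (ennreal (1 / x) * ennreal (1 / y)) = 1"
        using x y by (simp add: ennreal_mult[symmetric])
      then have "ennreal 2 * (f z * g z) = (ennreal (x * y) * (ennreal (1 / x) * ennreal (1 / y))) * (2 * (f z * g z))" by simp
      also have "\<dots> = ennreal (x * y) * (2 * ((ennreal (1 / x) * f z) * (ennreal (1 / y) * g z)))" by (simp add: mult_ac)
      also have "\<dots> \<le> ennreal (x * y) * ((ennreal (1 / x) * f z)\<^sup>2 + (ennreal (1 / y) * g z)\<^sup>2)"
        by (intro mult_left_mono ennreal_two_mult_le) auto
      finally show "ennreal 2 * (f z * g z) \<le> \<dots>" .
    qed
    also have "\<dots> = ennreal (x * y) * ((ennreal (1 / x))\<^sup>2 * (\<integral>\<^sup>+z. (f z)\<^sup>2 \<partial>M) + (ennreal (1 / y))\<^sup>2 * (\<integral>\<^sup>+z. (g z)\<^sup>2 \<partial>M))"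
      by (subst nn_integral_cmult, simp, subst nn_integral_add, simp, simp) (simp add: power_mult_distrib nn_integral_cmult)
    also have "(ennreal (1 / x))\<^sup>2 * (\<integral>\<^sup>+z. (f z)\<^sup>2 \<partial>M) = 1"
      unfolding X' using x by (simp add: ennreal_power ennreal_mult[symmetric] power_divide)
    also have "(ennreal (1 / y))\<^sup>2 * (\<integral>\<^sup>+z. (g z)\<^sup>2 \<partial>M) = 1"
      unfolding Y' using y by (simp add: ennreal_power ennreal_mult[symmetric] power_divide)
    also have "ennreal (x * y) * (1 + 1) = ennreal 2 * (?X * ?Y)"
      unfolding x y using x y by (simp add: ennreal_mult mult.commute)
    finally show ?thesis by (subst (asm) ennreal_mult_le_mult_iff) auto
  qed
qed

text \<open>Serves the stopping time: \<open>T\<close> is the set of scales kept at one point. Up to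
  a possible maximum it is covered by initial segments with countably many end points, any finitely
  many of which lie below one element of \<open>T\<close>.\<close>

lemma nn_integral_initial_segments:
  fixes h :: "real \<Rightarrow> ennreal"
  assumes h [measurable]: "h \<in> borel_measurable lborel"
    and T: "\<And>t. t \<in> T \<Longrightarrow> (\<integral>\<^sup>+s. indicator {..<t} s * h s \<partial>lborel) \<le> c"
  shows "(\<integral>\<^sup>+s. indicator T s * h s \<partial>lborel) \<le> c"
proof -
  define Q where "Q = {q \<in> \<rat>. \<exists>t\<in>T. q \<le> t}"
  have Qc: "countable Q" unfolding Q_def using countable_rat by (rule countable_subset[rotated]) auto
  \<comment> \<open>Only a maximum of \<open>T\<close> can escape all \<open>{..<t}\<close> with t
    in \<open>T\<close>, and a single point is a null set.\<close>
  have max_null: "AE s in lborel. s \<in> T \<longrightarrow> (\<exists>t\<in>T. s < t)"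
  proof (cases "\<exists>s\<in>T. \<forall>t\<in>T. t \<le> s")
    case True
    then obtain s where s: "s \<in> T" "\<forall>t\<in>T. t \<le> s" by blast
    have "AE x in lborel. x \<noteq> s" by (rule AE_lborel_singleton)
    then show ?thesis by (rule AE_mp) (rule AE_I2, use s in force)
  next
    case False
    then show ?thesis by (intro always_eventually) force
  qed
  show ?thesis
  proof (cases "Q = {}")
    case True
    have "\<not> t \<in> T" for t
    proof
      assume "t \<in> T"
      obtain q where "q \<in> \<rat>" "q < t" using Rats_dense_in_real[of "t - 1" t] by auto
      then show False using True \<open>t \<in> T\<close> by (force simp: Q_def)
    qed
    then show ?thesis by simp
  next
    case False
    define q where "q = from_nat_into Q"
    have q: "range q = Q" unfolding q_def using Qc False by (simp add: range_from_nat_into)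
    define S where "S n = (\<Union>i\<le>n. {..<q i})" for n :: nat
    have inc: "incseq (\<lambda>n s. indicator (S n) s * h s)"
      by (auto simp: incseq_def le_fun_def S_def indicator_def intro!: mult_right_mono)
    have bound: "(\<integral>\<^sup>+s. indicator (S n) s * h s \<partial>lborel) \<le> c" for n
    proof -
      \<comment> \<open>The largest of the first end points lies below some element of
        \<open>T\<close>, whose initial segment contains all of \<open>S n\<close>.\<close>
      define p where "p = Max (q ` {..n})"
      have "p \<in> q ` {..n}" unfolding p_def by (intro Max_in) auto
      then have "p \<in> Q" using q by auto
      then obtain t where t: "t \<in> T" "p \<le> t" by (auto simp: Q_def)
      have "S n \<subseteq> {..<t}"
      proof
        fix s assume "s \<in> S n"
        then obtain i where i: "i \<le> n" "s < q i" by (auto simp: S_def)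
        then have "q i \<le> p" unfolding p_def by (intro Max_ge) auto
        then show "s \<in> {..<t}" using i t by simp
      qed
      then have "(\<integral>\<^sup>+s. indicator (S n) s * h s \<partial>lborel) \<le> (\<integral>\<^sup>+s. indicator {..<t} s * h s \<partial>lborel)"
        by (intro nn_integral_mono mult_right_mono) (auto simp: indicator_def)
      then show ?thesis using T[OF t(1)] by (rule order_trans)
    qed
    have "(\<integral>\<^sup>+s. indicator T s * h s \<partial>lborel) \<le> (\<integral>\<^sup>+s. (SUP n. indicator (S n) s * h s) \<partial>lborel)"
    proof (rule nn_integral_mono_AE)
      show "AE s in lborel. indicator T s * h s \<le> (SUP n. indicator (S n) s * h s)"
        using max_null
      proof eventually_elim
        case (elim s)
        show ?case
        proof (cases "s \<in> T")
          case True
          then obtain t where t: "t \<in> T" "s < t" using elim by blast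
          obtain p where p: "p \<in> \<rat>" "s < p" "p < t" using Rats_dense_in_real[OF t(2)] by auto
          then have "p \<in> Q" using t by (auto simp: Q_def intro!: bexI[of _ t])
          then obtain i where "p = q i" using q by auto
          then have "s \<in> S i" using p by (auto simp: S_def)
          then have "indicator T s * h s \<le> indicator (S i) s * h s" by (simp add: indicator_def)
          also have "\<dots> \<le> (SUP n. indicator (S n) s * h s)" by (intro SUP_upper) auto
          finally show ?thesis .
        qed simp
      qed
    qed
    also have "\<dots> = (SUP n. \<integral>\<^sup>+s. indicator (S n) s * h s \<partial>lborel)"
      using inc by (intro nn_integral_monotone_convergence_SUP) (auto simp: S_def)
    also have "\<dots> \<le> c" using bound by (intro SUP_least)
    finally show ?thesis .
  qed
qed

lemma ennreal_abs_ip_le: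
  assumes f: "f \<in> L2 mu" and g: "g \<in> L2 mu"
  shows "ennreal \<bar>ip mu f g\<bar> \<le> (\<integral>\<^sup>+x. ennreal (cmod (f x) * cmod (g x)) \<partial>mu)"
proof -
  have "\<bar>ip mu f g\<bar> \<le> cmod (L2_inner mu f g)" unfolding ip_def by (rule abs_Re_le_cmod)
  then have "ennreal \<bar>ip mu f g\<bar> \<le> ennreal (norm (\<integral>x. f x * cnj (g x) \<partial>mu))" by (simp add: L2_inner_def ennreal_leI)
  also have "\<dots> \<le> (\<integral>\<^sup>+x. ennreal (norm (f x * cnj (g x))) \<partial>mu)"
    by (intro integral_norm_bound_ennreal integrable_L2_mult f g)
  finally show ?thesis by (simp add: norm_mult)
qed

lemma nn_integral_indicator_mult_le:
  assumes f: "f \<in> L2 mu" and g: "g \<in> L2 mu" and B: "B \<in> sets mu"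
  shows "(\<integral>\<^sup>+x. indicator B x * ennreal (cmod (f x) * cmod (g x)) \<partial>mu)
    \<le> ennreal (L2_norm mu (\<lambda>x. indicator B x * f x) * L2_norm mu (\<lambda>x. indicator B x * g x))"
proof -
  let ?f = "\<lambda>x. indicator B x * f x" and ?g = "\<lambda>x. indicator B x * g x"
  have fg: "?f \<in> L2 mu" "?g \<in> L2 mu" using f g B by (auto intro: L2_indicator)
  note [measurable] = fg[THEN L2_measurable]
  have "(\<integral>\<^sup>+x. indicator B x * ennreal (cmod (f x) * cmod (g x)) \<partial>mu) = (\<integral>\<^sup>+x. ennreal (cmod (?f x)) * ennreal (cmod (?g x)) \<partial>mu)"
    by (intro nn_integral_cong) (auto simp: indicator_def ennreal_mult)
  also have "\<dots> \<le> enn_root 2 (\<integral>\<^sup>+x. (ennreal (cmod (?f x)))\<^sup>2 \<partial>mu) * enn_root 2 (\<integral>\<^sup>+x. (ennreal (cmod (?g x)))\<^sup>2 \<partial>mu)"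
    by (intro nn_integral_Cauchy_Schwarz) measurable
  also have "(\<integral>\<^sup>+x. (ennreal (cmod (?f x)))\<^sup>2 \<partial>mu) = ennreal ((L2_norm mu ?f)\<^sup>2)"
    using nn_integral_L2[OF fg(1)] by (simp add: ennreal_power)
  also have "(\<integral>\<^sup>+x. (ennreal (cmod (?g x)))\<^sup>2 \<partial>mu) = ennreal ((L2_norm mu ?g)\<^sup>2)"
    using nn_integral_L2[OF fg(2)] by (simp add: ennreal_power)
  finally show ?thesis by (simp add: enn_root_def powr_half_sqrt ennreal_mult)
qed

section \<open>The \<open>L^2\<close> bound and the Carleson bound\<close>

context heat_gge
begin

text \<open>\<open>average_upper\<close> removes the ball average. What is left is the diagonal
  density, whose normalizing factor 4 * m is divided out.\<close>

lemma area_square_integral: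
  assumes g: "g \<in> L2 mu" and t: "0 < t"
  shows "(\<integral>\<^sup>+x. sqd g t x \<partial>mu) \<le> ennreal (A * 2 ^ k / (4 * m)) * ennreal (density m (\<lambda>s. P s g) (\<lambda>s. P s g) t)"
proof -
  let ?w = "L (P (t powr m) g)"
  have w: "?w \<in> L2 mu" using g t by (intro orbit_L_L2) auto
  note [measurable] = L2_measurable[OF w]
  let ?c = "(t powr m)\<^sup>2 / t"
  have "(\<integral>\<^sup>+x. sqd g t x \<partial>mu) = (\<integral>\<^sup>+x. ennreal ?c * (ennreal (1 / V x t) * (\<integral>\<^sup>+y. indicator (ball x t) y * ennreal ((cmod (?w y))\<^sup>2) \<partial>mu)) \<partial>mu)"
  proof (intro nn_integral_cong)
    fix x
    have wI: "(\<lambda>y. indicator (ball x t) y * ?w y) \<in> L2 mu" using w by (intro L2_indicator) auto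
    have "(\<integral>\<^sup>+y. indicator (ball x t) y * ennreal ((cmod (?w y))\<^sup>2) \<partial>mu) = (\<integral>\<^sup>+y. ennreal ((cmod (indicator (ball x t) y * ?w y))\<^sup>2) \<partial>mu)"
      by (intro nn_integral_cong) (auto simp: indicator_def)
    also have "\<dots> = ennreal ((L2_norm mu (\<lambda>y. indicator (ball x t) y * ?w y))\<^sup>2)" by (rule nn_integral_L2[OF wI])
    finally show "sqd g t x = ennreal ?c * (ennreal (1 / V x t) * (\<integral>\<^sup>+y. indicator (ball x t) y * ennreal ((cmod (?w y))\<^sup>2) \<partial>mu))"
      using t V_pos[OF t, of x] by (simp add: sqd_def area_def ennreal_mult[symmetric] power_divide power_mult_distrib mult_ac)
  qed
  also have "\<dots> = ennreal ?c * (\<integral>\<^sup>+x. ennreal (1 / V x t) * (\<integral>\<^sup>+y. indicator (ball x t) y * ennreal ((cmod (?w y))\<^sup>2) \<partial>mu) \<partial>mu)"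
    by (intro nn_integral_cmult borel_measurable_times borel_measurable_nn_integral) measurable
  also have "\<dots> \<le> ennreal ?c * (ennreal (A * 2 ^ k) * (\<integral>\<^sup>+y. ennreal ((cmod (?w y))\<^sup>2) \<partial>mu))"
    by (intro mult_left_mono average_upper t) auto
  also have "\<dots> = ennreal (A * 2 ^ k / (4 * m)) * ennreal (density m (\<lambda>s. P s g) (\<lambda>s. P s g) t)"
    using A m t by (simp add: nn_integral_L2[OF w] density_def ip_self[OF w] ennreal_mult[symmetric])
  finally show ?thesis .
qed

lemma square_function_L2_bound:
  assumes g: "g \<in> L2 mu"
  shows "(\<integral>\<^sup>+x. (\<integral>\<^sup>+t. sqd g t x \<partial>lborel) \<partial>mu) \<le> ennreal (A * 2 ^ k / (4 * m) * (L2_norm mu g)\<^sup>2)"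
proof -
  let ?d = "density m (\<lambda>s. P s g) (\<lambda>s. P s g)"
  have "(\<integral>\<^sup>+x. (\<integral>\<^sup>+t. sqd g t x \<partial>lborel) \<partial>mu) = (\<integral>\<^sup>+t. (\<integral>\<^sup>+x. sqd g t x \<partial>mu) \<partial>lborel)"
    using measurable_sqd[OF g] by (intro lm.Fubini')
  also have "\<dots> \<le> (\<integral>\<^sup>+t. ennreal (A * 2 ^ k / (4 * m)) * (indicator {0<..} t * ennreal (?d t)) \<partial>lborel)"
  proof (intro nn_integral_mono)
    fix t :: real
    show "(\<integral>\<^sup>+x. sqd g t x \<partial>mu) \<le> ennreal (A * 2 ^ k / (4 * m)) * (indicator {0<..} t * ennreal (?d t))"
    proof (cases "0 < t")
      case True then show ?thesis using area_square_integral[OF g True] by simp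
    next
      case False then show ?thesis by (simp add: sqd_def)
    qed
  qed
  also have "\<dots> = ennreal (A * 2 ^ k / (4 * m)) * (\<integral>\<^sup>+t. indicator {0<..} t * ennreal (?d t) \<partial>lborel)"
  proof (intro nn_integral_cmult)
    have "continuous_on {0<..} (\<lambda>t. ip mu (L (P (t powr m) g)) (L (P (t powr m) g)))"
      by (rule continuous_on_compose2[OF ip_L_L_continuous[OF orbit[OF g] orbit[OF g]]]) (auto intro!: continuous_intros)
    then have "continuous_on {0<..} ?d" unfolding density_def by (intro continuous_intros) auto
    then have "(\<lambda>t. indicator {0<..} t *\<^sub>R ?d t) \<in> borel_measurable borel"
      by (intro borel_measurable_continuous_on_indicator) auto
    then have "(\<lambda>t. ennreal (indicator {0<..} t *\<^sub>R ?d t)) \<in> borel_measurable lborel" by simp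
    also have "(\<lambda>t. ennreal (indicator {0<..} t *\<^sub>R ?d t)) = (\<lambda>t. indicator {0<..} t * ennreal (?d t))"
      by (auto simp: indicator_def)
    finally show "(\<lambda>t. indicator {0<..} t * ennreal (?d t)) \<in> borel_measurable lborel" .
  qed
  also have "\<dots> \<le> ennreal (A * 2 ^ k / (4 * m)) * ennreal ((L2_norm mu (P 0 g))\<^sup>2)"
    using m by (intro mult_left_mono square_bound orbit g) auto
  also have "\<dots> = ennreal (A * 2 ^ k / (4 * m) * (L2_norm mu g)\<^sup>2)"
    using A m L2_norm_cong_AE[OF orbit_0[OF g]] by (simp add: ennreal_mult[symmetric])
  finally show ?thesis .
qed

lemma sqd_add:
  assumes f: "f \<in> L2 mu" and g: "g \<in> L2 mu"
  shows "sqd (\<lambda>y. f y + g y) t x \<le> 2 * sqd f t x + 2 * sqd g t x"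
proof (cases "0 < t")
  case t: True
  then have T: "0 < t powr m" by simp
  let ?N = "\<lambda>h. L2_norm mu (\<lambda>y. indicator (ball x t) y * L (P (t powr m) h) y)"
  have "?N (\<lambda>y. f y + g y) = L2_norm mu (\<lambda>y. indicator (ball x t) y * L (P (t powr m) f) y + indicator (ball x t) y * L (P (t powr m) g) y)"
  proof (rule L2_norm_cong_AE)
    show "AE y in mu. indicator (ball x t) y * L (P (t powr m) (\<lambda>y. f y + g y)) y = indicator (ball x t) y * L (P (t powr m) f) y + indicator (ball x t) y * L (P (t powr m) g) y"
      using L_orbit_add[OF f g T] by eventually_elim (simp add: distrib_left)
  qed
  also have "\<dots> \<le> ?N f + ?N g" by (intro L2_norm_triangle indicator_ball_L2 f g T)
  finally have "t powr m * ?N (\<lambda>y. f y + g y) / sqrt (V x t) \<le> t powr m * (?N f + ?N g) / sqrt (V x t)"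
    by (intro divide_right_mono mult_left_mono) auto
  then have "area (\<lambda>y. f y + g y) t x \<le> area f t x + area g t x"
    by (simp add: area_def add_divide_distrib distrib_left)
  then have "(area (\<lambda>y. f y + g y) t x)\<^sup>2 \<le> (area f t x + area g t x)\<^sup>2"
    by (intro power_mono area_nonneg)
  also have "\<dots> \<le> 2 * (area f t x)\<^sup>2 + 2 * (area g t x)\<^sup>2"
    using sum_squares_bound[of "area f t x" "area g t x"] by (simp add: power2_sum)
  finally have "(area (\<lambda>y. f y + g y) t x)\<^sup>2 / t \<le> (2 * (area f t x)\<^sup>2 + 2 * (area g t x)\<^sup>2) / t"
    using t by (intro divide_right_mono) auto
  then have "ennreal ((area (\<lambda>y. f y + g y) t x)\<^sup>2 / t) \<le> ennreal (2 * ((area f t x)\<^sup>2 / t) + 2 * ((area g t x)\<^sup>2 / t))"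
    by (intro ennreal_leI) (simp add: add_divide_distrib)
  also have "\<dots> = 2 * ennreal ((area f t x)\<^sup>2 / t) + 2 * ennreal ((area g t x)\<^sup>2 / t)"
    using t by (intro ennreal_two_mult_add) auto
  finally show ?thesis using t by (simp add: sqd_def)
qed (simp add: sqd_def)

text \<open>One order of decay beyond the k + 1 integrable ones gives the area a factor t / r, as g
  lives at distance at least r. Squared and divided by t this is t / r^2, below 1 / r, so the
  integral over t < r stays bounded.\<close>

lemma sqd_far:
  "\<exists>C>0. \<forall>g x t r. g \<in> L2 mu \<longrightarrow> (\<forall>y. cmod (g y) \<le> 1) \<longrightarrow> (\<forall>y. dist x y < r \<longrightarrow> g y = 0) \<longrightarrow> 0 < t \<longrightarrow> t < r \<longrightarrow>
     sqd g t x \<le> ennreal (C / r)"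
proof -
  obtain C where C: "C > 0" and od: "\<And>x t f. 0 < t \<Longrightarrow> f \<in> L2 mu \<Longrightarrow>
     ennreal (t powr m * L2_norm mu (\<lambda>y. indicator (ball x t) y * L (P (t powr m) f) y))
       \<le> ennreal (C * exp (- (\<delta> / 16) * t powr m) / sqrt (V x t)) * (\<integral>\<^sup>+y. ennreal (decay ((k + 1) + 1) t x y * cmod (f y)) \<partial>mu)"
    using off_diagonal_estimate[of "(k + 1) + 1"] by blast
  define B where "B = C * (A * 2 ^ (k + 1))"
  have B: "0 < B" using C A by (simp add: B_def)
  show ?thesis
  proof (rule exI[of _ "B\<^sup>2"], intro conjI allI impI)
    show "0 < B\<^sup>2" using B by simp
    fix g :: "'a \<Rightarrow> complex" and x :: 'a and t r :: real
    assume g: "g \<in> L2 mu" and g1: "\<forall>y. cmod (g y) \<le> 1" and g0: "\<forall>y. dist x y < r \<longrightarrow> g y = 0" and t: "0 < t" "t < r"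
    have Vx: "0 < V x t" using t by (intro V_pos)
    note [measurable] = L2_measurable[OF g]
    have "(\<integral>\<^sup>+y. ennreal (decay ((k + 1) + 1) t x y * cmod (g y)) \<partial>mu) \<le> (\<integral>\<^sup>+y. ennreal (t / r) * ennreal (decay (k + 1) t x y) \<partial>mu)"
    proof (intro nn_integral_mono)
      fix y
      have "decay ((k + 1) + 1) t x y * cmod (g y) \<le> t / r * decay (k + 1) t x y"
      proof (cases "dist x y < r")
        case True
        then show ?thesis using g0 t by simp
      next
        case False
        then have "r / t \<le> 1 + dist x y / t" using t by (simp add: field_simps)
        then have "inverse (1 + dist x y / t) \<le> inverse (r / t)" using t by (intro le_imp_inverse_le) auto
        then have d1: "decay 1 t x y \<le> t / r" by (simp add: decay_def)
        have "decay ((k + 1) + 1) t x y * cmod (g y) \<le> decay ((k + 1) + 1) t x y * 1"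
          using g1 t by (intro mult_left_mono) auto
        also have "\<dots> = decay 1 t x y * decay (k + 1) t x y" unfolding decay_add[of "k + 1" 1] by simp
        also have "\<dots> \<le> t / r * decay (k + 1) t x y" using d1 t by (intro mult_right_mono) auto
        finally show ?thesis .
      qed
      then show "ennreal (decay ((k + 1) + 1) t x y * cmod (g y)) \<le> ennreal (t / r) * ennreal (decay (k + 1) t x y)"
        using t by (simp add: ennreal_mult[symmetric] ennreal_leI)
    qed
    also have "\<dots> = ennreal (t / r) * (\<integral>\<^sup>+y. ennreal (decay (k + 1) t x y) \<partial>mu)"
      by (intro nn_integral_cmult) measurable
    also have "\<dots> \<le> ennreal (t / r) * ennreal (A * 2 ^ (k + 1) * V x t)"
      using t by (intro mult_left_mono decay_integral) auto
    finally have I: "(\<integral>\<^sup>+y. ennreal (decay ((k + 1) + 1) t x y * cmod (g y)) \<partial>mu) \<le> ennreal (t / r * (A * 2 ^ (k + 1) * V x t))"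
      using t A by (subst ennreal_mult) auto
    have "ennreal (t powr m * L2_norm mu (\<lambda>y. indicator (ball x t) y * L (P (t powr m) g) y))
       \<le> ennreal (C / sqrt (V x t)) * ennreal (t / r * (A * 2 ^ (k + 1) * V x t))"
    proof (rule order_trans[OF od[OF t(1) g]], intro mult_mono I ennreal_leI divide_right_mono)
      have "exp (- (\<delta> / 16) * t powr m) \<le> 1" using \<delta>_pos by simp
      then show "C * exp (- (\<delta> / 16) * t powr m) \<le> C" using C by simp
    qed auto
    also have "\<dots> = ennreal (B * (t / r) * (V x t / sqrt (V x t)))"
      using C t A by (simp add: ennreal_mult[symmetric] B_def mult_ac)
    finally have "t powr m * L2_norm mu (\<lambda>y. indicator (ball x t) y * L (P (t powr m) g) y) \<le> B * (t / r) * (V x t / sqrt (V x t))"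
      using B t by (subst (asm) ennreal_le_iff) auto
    then have "area g t x \<le> B * (t / r) * (V x t / sqrt (V x t)) / sqrt (V x t)"
      unfolding area_def by (intro divide_right_mono) auto
    also have "\<dots> = B * (t / r)" using Vx by (simp add: real_div_sqrt)
    finally have "(area g t x)\<^sup>2 \<le> (B * (t / r))\<^sup>2" by (intro power_mono area_nonneg)
    then have "(area g t x)\<^sup>2 / t \<le> (B * (t / r))\<^sup>2 / t" using t by (intro divide_right_mono) auto
    also have "\<dots> = B\<^sup>2 / r * (t / r)" using t by (simp add: power2_eq_square field_simps)
    also have "\<dots> \<le> B\<^sup>2 / r * 1" using t B by (intro mult_left_mono) auto
    finally show "sqd g t x \<le> ennreal (B\<^sup>2 / r)" using t by (simp add: sqd_def ennreal_leI)
  qed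
qed

text \<open>Split g at the enlarged ball: the near part has squared norm at most a multiple of V z r
  and is covered by the \<open>L^2\<close> bound, the far part by \<open>sqd_far\<close>.\<close>

lemma Carleson_bound:
  "\<exists>K>0. \<forall>g z r. g \<in> L2 mu \<longrightarrow> (\<forall>y. cmod (g y) \<le> 1) \<longrightarrow> 0 < r \<longrightarrow>
     (\<integral>\<^sup>+x. indicator (ball z r) x * (\<integral>\<^sup>+s. indicator {..<r} s * sqd g s x \<partial>lborel) \<partial>mu) \<le> ennreal (K * V z r)"
proof -
  obtain C where C: "C > 0" and far: "\<And>g x t r. g \<in> L2 mu \<Longrightarrow> (\<forall>y. cmod (g y) \<le> 1) \<Longrightarrow> (\<forall>y. dist x y < r \<longrightarrow> g y = 0) \<Longrightarrow> 0 < t \<Longrightarrow> t < r \<Longrightarrow>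
     sqd g t x \<le> ennreal (C / r)"
    using sqd_far by blast
  define K1 where "K1 = A * 2 ^ k / (4 * m) * (A * 3 ^ k)"
  have K1: "0 < K1" using A m by (simp add: K1_def)
  show ?thesis
  proof (rule exI[of _ "2 * K1 + 2 * C"], intro conjI allI impI)
    show "0 < 2 * K1 + 2 * C" using K1 C by simp
    fix g :: "'a \<Rightarrow> complex" and z :: 'a and r :: real
    assume g: "g \<in> L2 mu" and g1: "\<forall>y. cmod (g y) \<le> 1" and r: "0 < r"
    \<comment> \<open>For x in \<open>ball z r\<close> the ball of radius r about x lies in
      \<open>ball z (3 * r)\<close>, so the far part vanishes within r of x.\<close>
    define h where "h = (\<lambda>y. indicator (ball z (3 * r)) y * g y)"
    define h' where "h' = (\<lambda>y. g y - h y)"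
    have h: "h \<in> L2 mu" unfolding h_def using g by (intro L2_indicator) auto
    have h': "h' \<in> L2 mu" unfolding h'_def using g h by (intro L2_diff)
    have sum: "(\<lambda>y. h y + h' y) = g" by (simp add: h'_def)
    have Nh: "(L2_norm mu h)\<^sup>2 \<le> A * 3 ^ k * V z r"
    proof -
      have "ennreal ((L2_norm mu h)\<^sup>2) = (\<integral>\<^sup>+y. ennreal ((cmod (h y))\<^sup>2) \<partial>mu)" by (rule nn_integral_L2[OF h, symmetric])
      also have "\<dots> \<le> (\<integral>\<^sup>+y. indicator (ball z (3 * r)) y \<partial>mu)"
        using g1 by (intro nn_integral_mono) (auto simp: h_def indicator_def power_le_one)
      also have "\<dots> = ennreal (V z (3 * r))" by (simp add: emeasure_ball)
      finally have "(L2_norm mu h)\<^sup>2 \<le> V z (3 * r)" by (subst (asm) ennreal_le_iff) auto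
      also have "\<dots> \<le> A * 3 ^ k * V z r" using V_scale[of r "3 * r" z] r by simp
      finally show ?thesis .
    qed
    have inner: "(\<integral>\<^sup>+s. indicator {..<r} s * sqd g s x \<partial>lborel) \<le> 2 * (\<integral>\<^sup>+s. sqd h s x \<partial>lborel) + ennreal (2 * C)" if x: "x \<in> ball z r" for x
    proof -
      have "(\<integral>\<^sup>+s. indicator {..<r} s * sqd g s x \<partial>lborel) \<le> (\<integral>\<^sup>+s. 2 * sqd h s x + ennreal (2 * C / r) * indicator {0<..<r} s \<partial>lborel)"
      proof (intro nn_integral_mono)
        fix s :: real
        show "indicator {..<r} s * sqd g s x \<le> 2 * sqd h s x + ennreal (2 * C / r) * indicator {0<..<r} s"
        proof (cases "0 < s \<and> s < r")
          case True
          have "sqd g s x \<le> 2 * sqd h s x + 2 * sqd h' s x" using sqd_add[OF h h', of s x] unfolding sum .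
          also have "sqd h' s x \<le> ennreal (C / r)"
          proof (rule far[OF h'])
            show "\<forall>y. cmod (h' y) \<le> 1" using g1 by (auto simp: h'_def h_def indicator_def)
            show "\<forall>y. dist x y < r \<longrightarrow> h' y = 0"
            proof (intro allI impI)
              fix y assume "dist x y < r"
              then have "y \<in> ball z (3 * r)" using x dist_triangle[of z y x] r by simp
              then show "h' y = 0" by (simp add: h'_def h_def)
            qed
          qed (use True in auto)
          finally show ?thesis using True C r by (simp add: ennreal_mult[symmetric] mult_left_mono add_left_mono ennreal_mult'' divide_simps flip: ennreal_numeral)
        next
          case False
          then show ?thesis by (auto simp: sqd_def indicator_def)
        qed
      qed
      also have "\<dots> = (\<integral>\<^sup>+s. 2 * sqd h s x \<partial>lborel) + (\<integral>\<^sup>+s. ennreal (2 * C / r) * indicator {0<..<r} s \<partial>lborel)"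
        using h by (intro nn_integral_add) measurable
      also have "(\<integral>\<^sup>+s. 2 * sqd h s x \<partial>lborel) = 2 * (\<integral>\<^sup>+s. sqd h s x \<partial>lborel)"
        using h by (intro nn_integral_cmult) measurable
      also have "(\<integral>\<^sup>+s. ennreal (2 * C / r) * indicator {0<..<r} s \<partial>lborel) = ennreal (2 * C)"
        using r C by (simp add: nn_integral_cmult_indicator ennreal_mult[symmetric])
      finally show ?thesis .
    qed
    have "(\<integral>\<^sup>+x. indicator (ball z r) x * (\<integral>\<^sup>+s. indicator {..<r} s * sqd g s x \<partial>lborel) \<partial>mu)
      \<le> (\<integral>\<^sup>+x. 2 * (\<integral>\<^sup>+s. sqd h s x \<partial>lborel) + ennreal (2 * C) * indicator (ball z r) x \<partial>mu)"
    proof (intro nn_integral_mono)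
      fix x
      show "indicator (ball z r) x * (\<integral>\<^sup>+s. indicator {..<r} s * sqd g s x \<partial>lborel) \<le> 2 * (\<integral>\<^sup>+s. sqd h s x \<partial>lborel) + ennreal (2 * C) * indicator (ball z r) x"
        using inner[of x] by (cases "x \<in> ball z r") auto
    qed
    also have "\<dots> = (\<integral>\<^sup>+x. 2 * (\<integral>\<^sup>+s. sqd h s x \<partial>lborel) \<partial>mu) + (\<integral>\<^sup>+x. ennreal (2 * C) * indicator (ball z r) x \<partial>mu)"
      using measurable_sq_integral[OF h, of UNIV] by (intro nn_integral_add) auto
    also have "(\<integral>\<^sup>+x. 2 * (\<integral>\<^sup>+s. sqd h s x \<partial>lborel) \<partial>mu) = 2 * (\<integral>\<^sup>+x. (\<integral>\<^sup>+s. sqd h s x \<partial>lborel) \<partial>mu)"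
      using measurable_sq_integral[OF h, of UNIV] by (intro nn_integral_cmult) auto
    also have "\<dots> \<le> 2 * ennreal (K1 * V z r)"
    proof (intro mult_left_mono order_trans[OF square_function_L2_bound[OF h]] ennreal_leI)
      have "A * 2 ^ k / (4 * m) * (L2_norm mu h)\<^sup>2 \<le> A * 2 ^ k / (4 * m) * (A * 3 ^ k * V z r)"
        using Nh A m by (intro mult_left_mono) auto
      then show "A * 2 ^ k / (4 * m) * (L2_norm mu h)\<^sup>2 \<le> K1 * V z r" by (simp add: K1_def)
    qed auto
    also have "(\<integral>\<^sup>+x. ennreal (2 * C) * indicator (ball z r) x \<partial>mu) = ennreal (2 * C * V z r)"
      using C by (simp add: nn_integral_cmult_indicator emeasure_ball ennreal_mult)
    also have "2 * ennreal (K1 * V z r) + ennreal (2 * C * V z r) = ennreal (2 * (K1 * V z r) + 2 * C * V z r)"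
      using K1 C by (simp add: ennreal_mult)
    also have "2 * (K1 * V z r) + 2 * C * V z r = (2 * K1 + 2 * C) * V z r" by (simp add: algebra_simps)
    finally show "(\<integral>\<^sup>+x. indicator (ball z r) x * (\<integral>\<^sup>+s. indicator {..<r} s * sqd g s x \<partial>lborel) \<partial>mu) \<le> ennreal ((2 * K1 + 2 * C) * V z r)" 
      by (simp add: add_right_mono)
  qed
qed

end

section \<open>Stopping time and duality\<close>

context heat_gge
begin

text \<open>The scales below the stopping time of the point \<open>x\<close> are the \<open>t\<close> with \<open>x \<in> good g K t\<close>.\<close>
definition good :: "('a \<Rightarrow> complex) \<Rightarrow> real \<Rightarrow> real \<Rightarrow> 'a set" where
  "good g K t = {x. (\<integral>\<^sup>+s. indicator {..<t} s * sqd g s x \<partial>lborel) \<le> ennreal (2 * K)}"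

lemma measurable_good:
  assumes g: "g \<in> L2 mu"
  shows "{z \<in> space (lborel \<Otimes>\<^sub>M mu). snd z \<in> good g K (fst z)} \<in> sets (lborel \<Otimes>\<^sub>M mu)"
proof -
  have "(\<lambda>z. \<integral>\<^sup>+s. (if s < fst z then sqd g s (snd z) else 0) \<partial>lborel) \<in> borel_measurable (lborel \<Otimes>\<^sub>M mu)"
    using g by (intro lborel.borel_measurable_nn_integral) measurable
  then have "{z \<in> space (lborel \<Otimes>\<^sub>M mu). (\<integral>\<^sup>+s. (if s < fst z then sqd g s (snd z) else 0) \<partial>lborel) \<le> ennreal (2 * K)} \<in> sets (lborel \<Otimes>\<^sub>M mu)"
    by measurable
  moreover have "(\<integral>\<^sup>+s. (if s < fst z then sqd g s (snd z) else 0) \<partial>lborel) = (\<integral>\<^sup>+s. indicator {..<fst z} s * sqd g s (snd z) \<partial>lborel)" for z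
    by (intro nn_integral_cong) (auto simp: indicator_def)
  ultimately show ?thesis by (simp add: good_def)
qed

lemma measurable_indicator_good:
  assumes g: "g \<in> L2 mu"
  shows "(\<lambda>(t, x). indicator (good g K t) x :: ennreal) \<in> borel_measurable (lborel \<Otimes>\<^sub>M mu)"
proof -
  have "(\<lambda>z. indicator {z \<in> space (lborel \<Otimes>\<^sub>M mu). snd z \<in> good g K (fst z)} z :: ennreal) \<in> borel_measurable (lborel \<Otimes>\<^sub>M mu)"
    using measurable_good[OF g] by (rule borel_measurable_indicator)
  also have "?this \<longleftrightarrow> ?thesis"
    by (intro measurable_cong) (auto simp: indicator_def space_pair_measure)
  finally show ?thesis .
qed

lemma measurable_indicator_good' [measurable (raw)]:
  assumes "g \<in> L2 mu" "p \<in> borel_measurable M" "q \<in> measurable M mu"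
  shows "(\<lambda>z. indicator (good g K (p z)) (q z) :: ennreal) \<in> borel_measurable M"
proof -
  have "(\<lambda>z. (p z, q z)) \<in> measurable M (lborel \<Otimes>\<^sub>M mu)" using assms by (intro measurable_Pair) auto
  from measurable_compose[OF this measurable_indicator_good[OF assms(1)]] show ?thesis by simp
qed

lemma good_sets:
  assumes g: "g \<in> L2 mu" shows "good g K t \<in> sets mu"
proof -
  have "(\<lambda>x. (t, x)) \<in> measurable mu (lborel \<Otimes>\<^sub>M mu)" by measurable
  from measurable_sets[OF this measurable_good[OF g]]
  show ?thesis by (simp add: vimage_def space_pair_measure)
qed

text \<open>Chebyshev's inequality and the Carleson bound: at each scale, a good point is found with
  probability at least one half in every ball.\<close>
lemma good_ample:
  assumes g: "g \<in> L2 mu" and K: "0 < K" and t: "0 < t"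
    and car: "(\<integral>\<^sup>+x. indicator (ball z t) x * (\<integral>\<^sup>+s. indicator {..<t} s * sqd g s x \<partial>lborel) \<partial>mu) \<le> ennreal (K * V z t)"
  shows "ennreal (V z t / 2) \<le> emeasure mu (ball z t \<inter> good g K t)"
proof -
  let ?a = "\<lambda>x. \<integral>\<^sup>+s. indicator {..<t} s * sqd g s x \<partial>lborel"
  have a: "?a \<in> borel_measurable mu" by (rule measurable_sq_integral[OF g]) simp
  have G: "good g K t \<in> sets mu" by (rule good_sets[OF g])
  have "emeasure mu (ball z t - good g K t) \<le> emeasure mu ({x \<in> space mu. 1 \<le> ennreal (1 / (2 * K)) * ?a x} \<inter> ball z t)"
  proof (rule emeasure_mono)
    show "ball z t - good g K t \<subseteq> {x \<in> space mu. 1 \<le> ennreal (1 / (2 * K)) * ?a x} \<inter> ball z t"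
    proof
      fix x assume x: "x \<in> ball z t - good g K t"
      then have "ennreal (2 * K) \<le> ?a x" by (auto simp: good_def)
      then have "ennreal (1 / (2 * K)) * ennreal (2 * K) \<le> ennreal (1 / (2 * K)) * ?a x" by (rule mult_left_mono) simp
      moreover have "ennreal (1 / (2 * K)) * ennreal (2 * K) = 1" using K by (subst ennreal_mult[symmetric]) auto
      ultimately show "x \<in> {x \<in> space mu. 1 \<le> ennreal (1 / (2 * K)) * ?a x} \<inter> ball z t" using x by simp
    qed
    have "{x \<in> space mu. 1 \<le> ennreal (1 / (2 * K)) * ?a x} \<in> sets mu" using a by measurable
    then show "{x \<in> space mu. 1 \<le> ennreal (1 / (2 * K)) * ?a x} \<inter> ball z t \<in> sets mu" by auto
  qed
  also have "{x \<in> space mu. 1 \<le> ennreal (1 / (2 * K)) * ?a x} \<inter> ball z t = {x \<in> ball z t. 1 \<le> ennreal (1 / (2 * K)) * ?a x}" by auto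
  also have "emeasure mu {x \<in> ball z t. 1 \<le> ennreal (1 / (2 * K)) * ?a x} \<le> ennreal (1 / (2 * K)) * (\<integral>\<^sup>+x. ?a x * indicator (ball z t) x \<partial>mu)"
    by (rule nn_integral_Markov_inequality) (use a in auto)
  also have "\<dots> \<le> ennreal (1 / (2 * K)) * ennreal (K * V z t)"
    using car by (intro mult_left_mono) (simp_all add: mult.commute)
  also have "\<dots> = ennreal (V z t / 2)" using K by (subst ennreal_mult[symmetric]) auto
  finally have "emeasure mu (ball z t - good g K t) \<le> ennreal (V z t / 2)" .
  moreover have "emeasure mu (ball z t) = emeasure mu (ball z t \<inter> good g K t) + emeasure mu (ball z t - good g K t)"
    using G by (subst plus_emeasure) (auto simp: Int_Diff_Un intro: sets.Int sets.Diff)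
  ultimately have le: "emeasure mu (ball z t) \<le> emeasure mu (ball z t \<inter> good g K t) + ennreal (V z t / 2)"
    by (simp add: add_left_mono)
  have fin: "emeasure mu (ball z t \<inter> good g K t) = ennreal (measure mu (ball z t \<inter> good g K t))"
    using emeasure_mono[of "ball z t \<inter> good g K t" "ball z t" mu] ball_fin[of z t]
    by (intro emeasure_eq_ennreal_measure) (auto simp: top_unique)
  have "V z t \<le> measure mu (ball z t \<inter> good g K t) + V z t / 2"
    using le unfolding fin emeasure_ball by (subst (asm) ennreal_plus[symmetric]) (auto simp del: ennreal_plus)
  then show ?thesis unfolding fin by (intro ennreal_leI) simp
qed

text \<open>Good points fill at least half of every ball, so the pairing over y is at most twice its
  average over the good x near y. Tonelli's theorem turns this into local pairings on balls about
  good x, to which Cauchy-Schwarz applies.\<close>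

lemma density_good_bound:
  assumes f: "f \<in> L2 mu" and g: "g \<in> L2 mu" and K: "0 < K" and t: "0 < t"
    and car: "\<And>z. (\<integral>\<^sup>+x. indicator (ball z t) x * (\<integral>\<^sup>+s. indicator {..<t} s * sqd g s x \<partial>lborel) \<partial>mu) \<le> ennreal (K * V z t)"
  shows "ennreal \<bar>density m (\<lambda>s. P s f) (\<lambda>s. P s g) t\<bar>
    \<le> ennreal (8 * m * (A * 2 ^ k)) * (\<integral>\<^sup>+x. indicator (good g K t) x * (enn_root 2 (sqd f t x) * enn_root 2 (sqd g t x)) \<partial>mu)"
proof -
  let ?T = "t powr m"
  define F where "F = L (P ?T f)"
  define G where "G = L (P ?T g)"
  let ?E = "good g K t"
  have F: "F \<in> L2 mu" and G: "G \<in> L2 mu" using f g t by (auto simp: F_def G_def intro!: orbit_L_L2)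
  note [measurable] = F[THEN L2_measurable] G[THEN L2_measurable] good_sets[OF g]
  define H where "H y = ennreal (cmod (F y) * cmod (G y))" for y
  have [measurable]: "H \<in> borel_measurable mu" unfolding H_def by measurable
  have "ennreal \<bar>ip mu F G\<bar> \<le> (\<integral>\<^sup>+y. H y \<partial>mu)" unfolding H_def by (rule ennreal_abs_ip_le[OF F G])
  \<comment> \<open>Inserts a factor of size at least 1 by \<open>good_ample\<close>; the measure in
    it becomes the integral over good x.\<close>
  also have "\<dots> \<le> (\<integral>\<^sup>+y. H y * (ennreal (2 / V y t) * emeasure mu (ball y t \<inter> ?E)) \<partial>mu)"
  proof (intro nn_integral_mono)
    fix y
    have "1 = ennreal (2 / V y t) * ennreal (V y t / 2)" using V_pos[OF t, of y] by (simp add: ennreal_mult[symmetric])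
    also have "\<dots> \<le> ennreal (2 / V y t) * emeasure mu (ball y t \<inter> ?E)"
      by (intro mult_left_mono good_ample g K t car) auto
    finally have "H y * 1 \<le> H y * (ennreal (2 / V y t) * emeasure mu (ball y t \<inter> ?E))" by (rule mult_left_mono) simp
    then show "H y \<le> \<dots>" by simp
  qed
  also have "\<dots> = (\<integral>\<^sup>+y. (\<integral>\<^sup>+x. H y * ennreal (2 / V y t) * (indicator (ball x t) y * indicator ?E x) \<partial>mu) \<partial>mu)"
  proof (intro nn_integral_cong)
    fix y
    have "emeasure mu (ball y t \<inter> ?E) = (\<integral>\<^sup>+x. indicator (ball y t \<inter> ?E) x \<partial>mu)" by simp
    also have "\<dots> = (\<integral>\<^sup>+x. indicator (ball x t) y * indicator ?E x \<partial>mu)"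
      by (intro nn_integral_cong) (auto simp: indicator_def dist_commute)
    finally show "H y * (ennreal (2 / V y t) * emeasure mu (ball y t \<inter> ?E)) = (\<integral>\<^sup>+x. H y * ennreal (2 / V y t) * (indicator (ball x t) y * indicator ?E x) \<partial>mu)"
      by (subst nn_integral_cmult) (auto simp: mult.assoc)
  qed
  also have "\<dots> = (\<integral>\<^sup>+x. (\<integral>\<^sup>+y. H y * ennreal (2 / V y t) * (indicator (ball x t) y * indicator ?E x) \<partial>mu) \<partial>mu)"
    by (intro mm.Fubini') measurable
  also have "\<dots> \<le> (\<integral>\<^sup>+x. indicator ?E x * ennreal (2 * (A * 2 ^ k) / V x t) * (\<integral>\<^sup>+y. indicator (ball x t) y * H y \<partial>mu) \<partial>mu)"
  proof (intro nn_integral_mono)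
    fix x
    have "(\<integral>\<^sup>+y. H y * ennreal (2 / V y t) * (indicator (ball x t) y * indicator ?E x) \<partial>mu)
      \<le> (\<integral>\<^sup>+y. indicator ?E x * ennreal (2 * (A * 2 ^ k) / V x t) * (indicator (ball x t) y * H y) \<partial>mu)"
    proof (intro nn_integral_mono)
      fix y
      show "H y * ennreal (2 / V y t) * (indicator (ball x t) y * indicator ?E x) \<le> indicator ?E x * ennreal (2 * (A * 2 ^ k) / V x t) * (indicator (ball x t) y * H y)"
      proof (cases "dist x y < t \<and> x \<in> ?E")
        case True
        have "2 / V y t \<le> 2 * (A * 2 ^ k) / V x t"
          using V_near[OF t, of y x] True V_pos[OF t, of x] V_pos[OF t, of y] by (simp add: dist_commute field_simps)
        then have "H y * ennreal (2 / V y t) \<le> H y * ennreal (2 * (A * 2 ^ k) / V x t)" by (intro mult_left_mono ennreal_leI) auto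
        then show ?thesis using True by (simp add: mult.commute)
      qed (auto simp: indicator_def)
    qed
    also have "\<dots> = indicator ?E x * ennreal (2 * (A * 2 ^ k) / V x t) * (\<integral>\<^sup>+y. indicator (ball x t) y * H y \<partial>mu)"
      by (intro nn_integral_cmult) measurable
    finally show "(\<integral>\<^sup>+y. H y * ennreal (2 / V y t) * (indicator (ball x t) y * indicator ?E x) \<partial>mu) \<le> \<dots>" .
  qed
  also have "\<dots> \<le> (\<integral>\<^sup>+x. ennreal (2 * (A * 2 ^ k) * (t / ?T\<^sup>2)) * (indicator ?E x * (enn_root 2 (sqd f t x) * enn_root 2 (sqd g t x))) \<partial>mu)"
  proof (intro nn_integral_mono)
    fix x
    let ?NF = "L2_norm mu (\<lambda>y. indicator (ball x t) y * F y)" and ?NG = "L2_norm mu (\<lambda>y. indicator (ball x t) y * G y)"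
    have Vx: "0 < V x t" using t by (rule V_pos)
    have root: "enn_root 2 (sqd h t x) = ennreal (area h t x / sqrt t)" for h
    proof -
      have "sqd h t x = ennreal ((area h t x / sqrt t)\<^sup>2)" using t by (simp add: sqd_def power_divide)
      then show ?thesis using t area_nonneg[of h t x] by (simp add: enn_root_def powr_half_sqrt)
    qed
    have "(\<integral>\<^sup>+y. indicator (ball x t) y * H y \<partial>mu) \<le> ennreal (?NF * ?NG)"
      unfolding H_def by (intro nn_integral_indicator_mult_le F G) auto
    then have "indicator ?E x * ennreal (2 * (A * 2 ^ k) / V x t) * (\<integral>\<^sup>+y. indicator (ball x t) y * H y \<partial>mu)
      \<le> indicator ?E x * ennreal (2 * (A * 2 ^ k) / V x t) * ennreal (?NF * ?NG)"
      by (rule mult_left_mono) simp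
    also have "\<dots> = indicator ?E x * ennreal (2 * (A * 2 ^ k) / V x t * (?NF * ?NG))"
      using A Vx by (simp add: ennreal_mult[symmetric] mult.assoc)
    also have "2 * (A * 2 ^ k) / V x t * (?NF * ?NG) = 2 * (A * 2 ^ k) * (t / ?T\<^sup>2) * (area f t x / sqrt t * (area g t x / sqrt t))"
      using Vx t by (simp add: area_def F_def G_def field_simps power2_eq_square[of ?T])
    also have "ennreal \<dots> = ennreal (2 * (A * 2 ^ k) * (t / ?T\<^sup>2)) * (enn_root 2 (sqd f t x) * enn_root 2 (sqd g t x))"
      unfolding root using A t area_nonneg[of f t x] area_nonneg[of g t x] by (simp add: ennreal_mult[symmetric])
    finally show "indicator ?E x * ennreal (2 * (A * 2 ^ k) / V x t) * (\<integral>\<^sup>+y. indicator (ball x t) y * H y \<partial>mu)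
      \<le> ennreal (2 * (A * 2 ^ k) * (t / ?T\<^sup>2)) * (indicator ?E x * (enn_root 2 (sqd f t x) * enn_root 2 (sqd g t x)))"
      by (simp add: mult.left_commute)
  qed
  also have "\<dots> = ennreal (2 * (A * 2 ^ k) * (t / ?T\<^sup>2)) * (\<integral>\<^sup>+x. indicator ?E x * (enn_root 2 (sqd f t x) * enn_root 2 (sqd g t x)) \<partial>mu)"
    using f g by (intro nn_integral_cmult) measurable
  finally have 1: "ennreal \<bar>ip mu F G\<bar> \<le> \<dots>" .
  have "ennreal \<bar>density m (\<lambda>s. P s f) (\<lambda>s. P s g) t\<bar> = ennreal (4 * m * ?T\<^sup>2 / t) * ennreal \<bar>ip mu F G\<bar>"
    using m t by (simp add: density_def F_def G_def abs_mult ennreal_mult[symmetric])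
  also have "\<dots> \<le> ennreal (4 * m * ?T\<^sup>2 / t) * (ennreal (2 * (A * 2 ^ k) * (t / ?T\<^sup>2)) * (\<integral>\<^sup>+x. indicator ?E x * (enn_root 2 (sqd f t x) * enn_root 2 (sqd g t x)) \<partial>mu))"
    by (intro mult_left_mono 1) auto
  also have "\<dots> = (ennreal (4 * m * ?T\<^sup>2 / t) * ennreal (2 * (A * 2 ^ k) * (t / ?T\<^sup>2))) * (\<integral>\<^sup>+x. indicator ?E x * (enn_root 2 (sqd f t x) * enn_root 2 (sqd g t x)) \<partial>mu)"
    by (simp add: mult.assoc)
  also have "ennreal (4 * m * ?T\<^sup>2 / t) * ennreal (2 * (A * 2 ^ k) * (t / ?T\<^sup>2)) = ennreal (8 * m * (A * 2 ^ k))"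
    using A m t by (subst ennreal_mult[symmetric]) auto
  finally show ?thesis .
qed

text \<open>Cauchy-Schwarz in t at each fixed x: over the kept scales the square function of g is at
  most sqrt (2 * K), so only that of f is integrated over x.\<close>

lemma pairing_le_square_function:
  "\<exists>C>0. \<forall>f\<in>L2 mu. \<forall>g\<in>L2 mu. (\<forall>y. cmod (g y) \<le> 1) \<longrightarrow>
     ennreal \<bar>ip mu f g\<bar> \<le> ennreal C * (\<integral>\<^sup>+x. sq_fun mu m L P f x \<partial>mu)"
proof -
  obtain K where K: "0 < K" and car: "\<And>g z r. g \<in> L2 mu \<Longrightarrow> (\<forall>y. cmod (g y) \<le> 1) \<Longrightarrow> 0 < r \<Longrightarrow>
     (\<integral>\<^sup>+x. indicator (ball z r) x * (\<integral>\<^sup>+s. indicator {..<r} s * sqd g s x \<partial>lborel) \<partial>mu) \<le> ennreal (K * V z r)"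
    using Carleson_bound by blast
  define B where "B = 8 * m * (A * 2 ^ k)"
  have B: "0 < B" using m A by (simp add: B_def)
  show ?thesis
  proof (rule exI[of _ "B * sqrt (2 * K)"], intro conjI ballI impI)
    show "0 < B * sqrt (2 * K)" using B K by simp
    fix f g assume f: "f \<in> L2 mu" and g: "g \<in> L2 mu" and g1: "\<forall>y. cmod (g y) \<le> 1"
    let ?u = "\<lambda>s. P s f" and ?v = "\<lambda>s. P s g"
    let ?R = "\<lambda>t x. indicator (good g K t) x * (enn_root 2 (sqd f t x) * enn_root 2 (sqd g t x))"
    have "ip mu f g = ip mu (P 0 f) (P 0 g)"
      using orbit_0[OF f] orbit_0[OF g] by (intro ip_cong_AE f g orbit_L2) auto
    then have "ennreal \<bar>ip mu f g\<bar> \<le> (\<integral>\<^sup>+t. indicator {0<..} t * ennreal \<bar>density m ?u ?v t\<bar> \<partial>lborel)"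
      using pairing_bound[OF orbit[OF f] orbit[OF g], of m] m by simp
    also have "\<dots> \<le> (\<integral>\<^sup>+t. ennreal B * (\<integral>\<^sup>+x. ?R t x \<partial>mu) \<partial>lborel)"
    proof (intro nn_integral_mono)
      fix t :: real
      show "indicator {0<..} t * ennreal \<bar>density m ?u ?v t\<bar> \<le> ennreal B * (\<integral>\<^sup>+x. ?R t x \<partial>mu)"
        using density_good_bound[OF f g K _ car[OF g g1], of t] by (cases "0 < t") (auto simp: B_def)
    qed
    also have "\<dots> = ennreal B * (\<integral>\<^sup>+t. (\<integral>\<^sup>+x. ?R t x \<partial>mu) \<partial>lborel)"
      using f g by (intro nn_integral_cmult borel_measurable_nn_integral) measurable
    also have "(\<integral>\<^sup>+t. (\<integral>\<^sup>+x. ?R t x \<partial>mu) \<partial>lborel) = (\<integral>\<^sup>+x. (\<integral>\<^sup>+t. ?R t x \<partial>lborel) \<partial>mu)"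
      using f g by (intro lm.Fubini'[symmetric]) measurable
    also have "\<dots> \<le> (\<integral>\<^sup>+x. sq_fun mu m L P f x * ennreal (sqrt (2 * K)) \<partial>mu)"
    proof (intro nn_integral_mono)
      fix x
      have "(\<integral>\<^sup>+t. ?R t x \<partial>lborel) = (\<integral>\<^sup>+t. enn_root 2 (sqd f t x) * (indicator (good g K t) x * enn_root 2 (sqd g t x)) \<partial>lborel)"
        by (simp add: mult.left_commute)
      also have "\<dots> \<le> enn_root 2 (\<integral>\<^sup>+t. (enn_root 2 (sqd f t x))\<^sup>2 \<partial>lborel) * enn_root 2 (\<integral>\<^sup>+t. (indicator (good g K t) x * enn_root 2 (sqd g t x))\<^sup>2 \<partial>lborel)"
        using f g by (intro nn_integral_Cauchy_Schwarz) measurable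
      also have "enn_root 2 (\<integral>\<^sup>+t. (enn_root 2 (sqd f t x))\<^sup>2 \<partial>lborel) = sq_fun mu m L P f x"
      proof -
        have "indicator {0<..} t * sqd f t x = sqd f t x" for t by (simp add: sqd_def indicator_def)
        then show ?thesis using sq_fun_on_eq[OF f, of "{0<..}" x] by (simp add: enn_root_square)
      qed
      also have "(\<integral>\<^sup>+t. (indicator (good g K t) x * enn_root 2 (sqd g t x))\<^sup>2 \<partial>lborel) = (\<integral>\<^sup>+t. indicator {t. x \<in> good g K t} t * sqd g t x \<partial>lborel)"
        by (intro nn_integral_cong) (auto simp: indicator_def enn_root_square)
      also have "sq_fun mu m L P f x * enn_root 2 \<dots> \<le> sq_fun mu m L P f x * ennreal (sqrt (2 * K))"
      proof (intro mult_left_mono)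
        have "(\<integral>\<^sup>+t. indicator {t. x \<in> good g K t} t * sqd g t x \<partial>lborel) \<le> ennreal (2 * K)"
        \<comment> \<open>By definition of \<open>good\<close> the bound 2 * K holds below each kept
          scale, hence over all kept scales together.\<close>
        proof (rule nn_integral_initial_segments)
          show "(\<lambda>t. sqd g t x) \<in> borel_measurable lborel" using g by measurable
        qed (simp add: good_def)
        then show "enn_root 2 (\<integral>\<^sup>+t. indicator {t. x \<in> good g K t} t * sqd g t x \<partial>lborel) \<le> ennreal (sqrt (2 * K))"
          using K by (simp add: enn_root_le_iff ennreal_power)
      qed simp
      finally show "(\<integral>\<^sup>+t. ?R t x \<partial>lborel) \<le> sq_fun mu m L P f x * ennreal (sqrt (2 * K))" .
    qed
    also have "\<dots> = (\<integral>\<^sup>+x. sq_fun mu m L P f x \<partial>mu) * ennreal (sqrt (2 * K))"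
    proof (rule nn_integral_multc)
      have "(\<lambda>x. enn_root 2 (\<integral>\<^sup>+t. indicator {0<..} t * sqd f t x \<partial>lborel)) \<in> borel_measurable mu"
        by (intro measurable_enn_root measurable_sq_integral f) auto
      moreover have "sq_fun mu m L P f = (\<lambda>x. enn_root 2 (\<integral>\<^sup>+t. indicator {0<..} t * sqd f t x \<partial>lborel))"
        by (intro ext sq_fun_on_eq[OF f]) simp
      ultimately show "sq_fun mu m L P f \<in> borel_measurable mu" by simp
    qed
    finally have "ennreal \<bar>ip mu f g\<bar> \<le> ennreal B * ((\<integral>\<^sup>+x. sq_fun mu m L P f x \<partial>mu) * ennreal (sqrt (2 * K)))"
      by (simp add: mult_left_mono)
    then show "ennreal \<bar>ip mu f g\<bar> \<le> ennreal (B * sqrt (2 * K)) * (\<integral>\<^sup>+x. sq_fun mu m L P f x \<partial>mu)"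
      using B K by (simp add: ennreal_mult mult_ac)
  qed
qed

text \<open>Duality with bounded test functions: the phase of f, truncated to growing balls,
  recovers the \<open>L^1\<close> norm by monotone convergence.\<close>

lemma L1_le_square_function:
  "\<exists>C>0. \<forall>f\<in>L2 mu. L1_norm mu f \<le> ennreal C * (\<integral>\<^sup>+x. sq_fun mu m L P f x \<partial>mu)"
proof -
  obtain C where C: "C > 0" and pair: "\<And>f g. f \<in> L2 mu \<Longrightarrow> g \<in> L2 mu \<Longrightarrow> (\<forall>y. cmod (g y) \<le> 1) \<Longrightarrow>
     ennreal \<bar>ip mu f g\<bar> \<le> ennreal C * (\<integral>\<^sup>+x. sq_fun mu m L P f x \<partial>mu)"
    using pairing_le_square_function by blast
  show ?thesis
  proof (rule exI[of _ C], intro conjI ballI C)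
    fix f assume f: "f \<in> L2 mu"
    note [measurable] = L2_measurable[OF f]
    fix z :: 'a
    define B where "B n = ball z (real n)" for n :: nat
    \<comment> \<open>The truncation to a ball of finite measure puts the phase in
      \<open>L^2\<close>.\<close>
    define g where "g n y = indicator (B n) y * sgn (f y)" for n y
    have bound: "(\<integral>\<^sup>+y. indicator (B n) y * ennreal (cmod (f y)) \<partial>mu) \<le> ennreal C * (\<integral>\<^sup>+x. sq_fun mu m L P f x \<partial>mu)" for n
    proof -
      have g1: "cmod (g n y) \<le> indicator (B n) y" for y by (simp add: g_def norm_mult norm_sgn indicator_def)
      have meas: "g n \<in> borel_measurable mu" unfolding g_def B_def sgn_div_norm by measurable
      have "integrable mu (\<lambda>y. (cmod (g n y))\<^sup>2)"
      proof (rule Bochner_Integration.integrable_bound)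
        show "integrable mu (indicator (B n) :: 'a \<Rightarrow> real)" by (simp add: B_def emeasure_ball)
        show "AE y in mu. norm ((cmod (g n y))\<^sup>2) \<le> norm (indicator (B n) y :: real)"
          by (rule always_eventually) (auto simp: g_def norm_mult norm_sgn indicator_def)
      qed (use meas in measurable)
      then have g: "g n \<in> L2 mu" using meas by (simp add: L2_iff)
      have e: "Re (f y) * Re (g n y) + Im (f y) * Im (g n y) = indicator (B n) y * cmod (f y)" for y
      proof (cases "f y = 0")
        case False
        have "Re (f y) * Re (sgn (f y)) + Im (f y) * Im (sgn (f y)) = ((Re (f y))\<^sup>2 + (Im (f y))\<^sup>2) / cmod (f y)"
          by (simp add: sgn_eq power2_eq_square add_divide_distrib)
        also have "\<dots> = (cmod (f y))\<^sup>2 / cmod (f y)" by (simp only: cmod_power2)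
        also have "\<dots> = cmod (f y)" using False by (simp add: power2_eq_square)
        finally show ?thesis by (auto simp: g_def indicator_def)
      qed (simp add: g_def)
      have int: "integrable mu (\<lambda>y. indicator (B n) y * cmod (f y))" using integrable_ip[OF f g] by (simp only: e)
      have "ip mu f (g n) = (\<integral>y. indicator (B n) y * cmod (f y) \<partial>mu)" using ip_eq[OF f g] by (simp only: e)
      moreover have "(\<integral>\<^sup>+y. indicator (B n) y * ennreal (cmod (f y)) \<partial>mu) = ennreal (\<integral>y. indicator (B n) y * cmod (f y) \<partial>mu)"
        using int by (subst nn_integral_eq_integral[symmetric]) (auto intro!: nn_integral_cong simp: indicator_def)
      ultimately have "(\<integral>\<^sup>+y. indicator (B n) y * ennreal (cmod (f y)) \<partial>mu) \<le> ennreal \<bar>ip mu f (g n)\<bar>"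
        by (simp add: ennreal_leI)
      also have "\<dots> \<le> ennreal C * (\<integral>\<^sup>+x. sq_fun mu m L P f x \<partial>mu)"
      proof (rule pair[OF f g], rule allI)
        fix y show "cmod (g n y) \<le> 1" using g1[of y] by (rule order_trans) (simp add: indicator_def)
      qed
      finally show ?thesis .
    qed
    have "L1_norm mu f = (\<integral>\<^sup>+y. (SUP n. indicator (B n) y * ennreal (cmod (f y))) \<partial>mu)"
      unfolding L1_norm_def
    proof (intro nn_integral_cong antisym)
      fix y
      obtain n where "dist z y < real n" using reals_Archimedean2 by blast
      then have "ennreal (cmod (f y)) = indicator (B n) y * ennreal (cmod (f y))" by (simp add: B_def)
      also have "\<dots> \<le> (SUP n. indicator (B n) y * ennreal (cmod (f y)))" by (intro SUP_upper) auto
      finally show "ennreal (cmod (f y)) \<le> \<dots>" .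
      show "(SUP n. indicator (B n) y * ennreal (cmod (f y))) \<le> ennreal (cmod (f y))"
        by (intro SUP_least) (auto simp: indicator_def)
    qed
    also have "\<dots> = (SUP n. \<integral>\<^sup>+y. indicator (B n) y * ennreal (cmod (f y)) \<partial>mu)"
    proof (rule nn_integral_monotone_convergence_SUP)
      show "incseq (\<lambda>n y. indicator (B n) y * ennreal (cmod (f y)))"
        by (auto simp: incseq_def le_fun_def B_def indicator_def)
      show "(\<lambda>y. indicator (B n) y * ennreal (cmod (f y))) \<in> borel_measurable mu" for n
        unfolding B_def by measurable
    qed
    also have "\<dots> \<le> ennreal C * (\<integral>\<^sup>+x. sq_fun mu m L P f x \<partial>mu)" using bound by (intro SUP_least)
    finally show "L1_norm mu f \<le> ennreal C * (\<integral>\<^sup>+x. sq_fun mu m L P f x \<partial>mu)" .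
  qed
qed

lemma hardy_norms_equivalent:
  "\<exists>C::real. C > 0 \<and> (\<forall>f\<in>L2 mu.
      (\<integral>\<^sup>+ x. sq_fun mu m L P f x \<partial>mu) \<le> ennreal C * ((\<integral>\<^sup>+ x. sq_fun_loc mu m L P f x \<partial>mu) + L1_norm mu f)
    \<and> (\<integral>\<^sup>+ x. sq_fun_loc mu m L P f x \<partial>mu) + L1_norm mu f \<le> ennreal C * (\<integral>\<^sup>+ x. sq_fun mu m L P f x \<partial>mu))"
proof -
  obtain C1 where C1: "C1 > 0" and le1: "\<And>f. f \<in> L2 mu \<Longrightarrow> (\<integral>\<^sup>+ x. sq_fun mu m L P f x \<partial>mu) \<le> ennreal C1 * ((\<integral>\<^sup>+ x. sq_fun_loc mu m L P f x \<partial>mu) + L1_norm mu f)"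
    using sq_fun_le_local by blast
  obtain C2 where C2: "C2 > 0" and le2: "\<And>f. f \<in> L2 mu \<Longrightarrow> L1_norm mu f \<le> ennreal C2 * (\<integral>\<^sup>+x. sq_fun mu m L P f x \<partial>mu)"
    using L1_le_square_function by blast
  show ?thesis
  \<comment> \<open>\<open>C1\<close> serves the first inequality; 1 + \<open>C2\<close> the second,
    the 1 coming from \<open>sq_fun_loc_le\<close>.\<close>
  proof (rule exI[of _ "C1 + (1 + C2)"], intro conjI ballI)
    show "C1 + (1 + C2) > 0" using C1 C2 by simp
    fix f assume f: "f \<in> L2 mu"
    have "ennreal C1 \<le> ennreal (C1 + (1 + C2))" using C2 by (intro ennreal_leI) simp
    then show "(\<integral>\<^sup>+ x. sq_fun mu m L P f x \<partial>mu) \<le> ennreal (C1 + (1 + C2)) * ((\<integral>\<^sup>+ x. sq_fun_loc mu m L P f x \<partial>mu) + L1_norm mu f)"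
      using le1[OF f] by (meson mult_right_mono order_trans zero_le)
    have "(\<integral>\<^sup>+ x. sq_fun_loc mu m L P f x \<partial>mu) + L1_norm mu f \<le> (1 + ennreal C2) * (\<integral>\<^sup>+ x. sq_fun mu m L P f x \<partial>mu)"
      unfolding distrib_right mult_1 by (intro add_mono sq_fun_loc_le le2 f)
    also have "1 + ennreal C2 \<le> ennreal (C1 + (1 + C2))"
      using C1 C2 unfolding ennreal_1[symmetric] by (subst ennreal_plus[symmetric]) (auto simp del: ennreal_1 ennreal_plus intro!: ennreal_leI)
    finally show "(\<integral>\<^sup>+ x. sq_fun_loc mu m L P f x \<partial>mu) + L1_norm mu f \<le> ennreal (C1 + (1 + C2)) * (\<integral>\<^sup>+ x. sq_fun mu m L P f x \<partial>mu)"
      by (simp add: mult_right_mono)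
  qed
qed

end

section \<open>Conclusion\<close>

lemma (in gapped) heat_semigroup_orbit:
  assumes P: "is_heat_semigroup mu D L P" and f: "f \<in> L2 mu"
  shows "sol (\<lambda>t. P t f)" and "AE x in mu. P 0 f x = f x"
proof -
  have *: "\<forall>t\<ge>0. P t f \<in> L2 mu" "AE x in mu. P 0 f x = f x"
     "\<forall>t\<ge>0. ((\<lambda>s. L2_norm mu (\<lambda>x. P s f x - P t f x)) \<longlongrightarrow> 0) (at t within {0..})"
     "\<forall>t>0. P t f \<in> D \<and> ((\<lambda>s. L2_norm mu (\<lambda>x. (P s f x - P t f x) / complex_of_real (s - t) + L (P t f) x)) \<longlongrightarrow> 0) (at t within {0<..})"
    using P f unfolding is_heat_semigroup_def by blast+
  show "AE x in mu. P 0 f x = f x" by (rule *)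
  have "l2_deriv mu (\<lambda>t. P t f) (\<lambda>x. - L (P t f) x) t" if t: "0 < t" for t
    unfolding l2_deriv_def
  proof (intro conjI)
    show "P t f \<in> L2 mu" using * t by simp
    show "(\<lambda>x. - L (P t f) x) \<in> L2 mu" using * t by (intro L2_minus L_L2) auto
    have "\<forall>\<^sub>F s in at t. s \<in> {0<..}" using t by (intro eventually_at_in_open') auto
    then show "\<forall>\<^sub>F s in at t. P s f \<in> L2 mu" by eventually_elim (use * in auto)
    have "at t within {0<..} = at t" using t by (intro at_within_open) auto
    then show "((\<lambda>s. L2_norm mu (\<lambda>x. (P s f x - P t f x) / complex_of_real (s - t) - - L (P t f) x)) \<longlongrightarrow> 0) (at t)"
      using conjunct2[OF *(4)[rule_format, OF t]] by simp
  qed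
  then show "sol (\<lambda>t. P t f)" using * by (simp add: sol_def)
qed

theorem mainTheorem7:
  fixes mu :: "'a::metric_space measure"
    and D :: "('a \<Rightarrow> complex) set"
    and L :: "('a \<Rightarrow> complex) \<Rightarrow> ('a \<Rightarrow> complex)"
    and P :: "real \<Rightarrow> ('a \<Rightarrow> complex) \<Rightarrow> ('a \<Rightarrow> complex)"
    and m :: real
  assumes "doubling_mms mu"
    and "nonneg_selfadjoint mu D L"
    and "m \<ge> 2"
    and "is_heat_semigroup mu D L P"
    and "GGE mu m 1 P"
    and "\<exists>\<delta>>0. \<forall>lam\<in>spectrum_op mu D L. lam \<ge> \<delta>"
  shows "\<exists>C::real. C > 0 \<and> (\<forall>f\<in>L2 mu.
           (\<integral>\<^sup>+ x. sq_fun mu m L P f x \<partial>mu)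
             \<le> ennreal C * ((\<integral>\<^sup>+ x. sq_fun_loc mu m L P f x \<partial>mu) + L1_norm mu f)
         \<and> (\<integral>\<^sup>+ x. sq_fun_loc mu m L P f x \<partial>mu) + L1_norm mu f
             \<le> ennreal C * (\<integral>\<^sup>+ x. sq_fun mu m L P f x \<partial>mu))"
proof -
  obtain k A where "doubling mu k A" using doubling_mms_doubling[OF assms(1)] by blast
  then interpret doubling mu k A .
  interpret selfadjoint mu D L by unfold_locales (rule assms(2))
  obtain \<delta> where \<delta>: "\<delta> > 0" "\<And>lam. lam \<in> spectrum_op mu D L \<Longrightarrow> \<delta> \<le> lam" using assms(6) by blast
  \<comment> \<open>The hypothesis on the spectrum is converted here into the lower bound on the
    form.\<close>
  interpret gapped mu D L \<delta>
    by unfold_locales (use \<delta> in \<open>auto intro: form_lower_bound\<close>)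
  interpret heat_gge mu D L \<delta> k A m P
    by unfold_locales (use assms heat_semigroup_orbit[OF assms(4)] in auto)
  show ?thesis by (rule hardy_norms_equivalent)
qed

end
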